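(* Let $\phi$ be a Ma-Minda function, $n\in\mathbb{N}$, and let $f=h+\overline{g}\in\mathcal{HC}_n(\phi)$, with $h(z)=z+\sum_{k=2}^\infty a_kz^k$, $g(z)=\sum_{k=1}^\infty b_kz^k$ and $g'(z)=\zeta z^nh'(z)$, $|\zeta|\le\frac1{2n-1}$. Let $S_r$ be the area of the image $f(\mathbb{D}_r)$. Then $$M_f(r)+\frac{S_r}{2\pi}\leq d(f(0),\partial f(\mathbb{D}))$$ holds for $|z|=r\le\min\{1/3,\widetilde r_f\}$, where $\widetilde r_f$ is the smallest positive root in $(0,1)$ of $$L(\zeta,n,1)=M_K(r)+|\zeta|\int_0^rt^nM_{K'}(t)\,dt+\int_0^rt\left(1-|\zeta|^2t^{2n}\right)(K'(t))^2\,dt,$$ with $$L(\zeta,n,1)=-K(-1)-|\zeta|\int_0^1t^nK'(-t)\,dt.$$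
   Context: $\mathbb{D}=\{z\in\mathbb{C}:|z|<1\}$ and $\mathbb{D}_r=\{z\in\mathbb{C}:|z|<r\}$; $d(\cdot,\cdot)$ is Euclidean distance; $\prec$ denotes subordination of analytic functions in $\mathbb{D}$. A Ma-Minda function is an analytic univalent function $\phi:\mathbb{D}\to\mathbb{C}$ such that $\phi(\mathbb{D})$ lies in the right half-plane (positive real part), is symmetric with respect to the real axis and starlike with respect to $\phi(0)=1$, and $\phi'(0)>0$. $\mathcal{S}$ is the class of univalent analytic functions $h$ in $\mathbb{D}$ with $h(0)=h'(0)-1=0$, and $\mathcal{C}(\phi)$ is the class of $h\in\mathcal{S}$ with $1+\frac{zh''(z)}{h'(z)}\prec\phi(z)$. The function $$K(z)=\int_0^z\exp\left(\int_0^{s}\frac{\phi(t)-1}{t}\,dt\right)ds\quad(z\in\mathbb{D})$$ satisfies $1+\frac{zK''(z)}{K'(z)}=\phi(z)$. The value $K(-1)$ is understood as the limit of $K(-r)$ as $r\to1^-$. $\mathcal{H}$ is the class of sense-preserving harmonic mappings $f=h+\overline{g}$ in $\mathbb{D}$ (i.e. $|h'|>|g'|$), where $h(z)=z+\sum_{k=2}^\infty a_kz^k$ and $g(z)=\sum_{k=1}^\infty b_kz^k$ are analytic in $\mathbb{D}$. For $n\in\mathbb{N}$, $\mathcal{HC}_n(\phi)$ is the class of $f=h+\overline{g}\in\mathcal{H}$ such that $h\in\mathcal{C}(\phi)$ and $g'(z)=\zeta z^nh'(z)$ with $\zeta\in\mathbb{C}$, $|\zeta|\le\frac1{2n-1}$.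 For an analytic function $F(z)=\sum_{k\ge0}c_kz^k$ in $\mathbb{D}$, $M_F(r)=\sum_{k\ge0}|c_k|r^k$ denotes its majorant series. For $f=h+\overline{g}\in\mathcal{HC}_n(\phi)$, $M_f(r)=r+\sum_{k=2}^\infty(|a_k|+|b_k|)r^k$. *)

theory Defs
  imports "HOL-Complex_Analysis.Complex_Analysis"
begin

abbreviation unit_disc :: "complex set" where
  "unit_disc \<equiv> ball 0 1"

definition subordinate :: "(complex \<Rightarrow> complex) \<Rightarrow> (complex \<Rightarrow> complex) \<Rightarrow> bool" where
  "subordinate F G \<longleftrightarrow>
     (\<exists>\<omega>. \<omega> holomorphic_on unit_disc \<and> \<omega> 0 = 0 \<and> \<omega> ` unit_disc \<subseteq> unit_disc \<and>
          (\<forall>z\<in>unit_disc. F z = G (\<omega> z)))"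

definition ma_minda :: "(complex \<Rightarrow> complex) \<Rightarrow> bool" where
  "ma_minda \<phi> \<longleftrightarrow>
     \<phi> holomorphic_on unit_disc \<and> inj_on \<phi> unit_disc \<and>
     (\<forall>w \<in> \<phi> ` unit_disc. 0 < Re w) \<and>
     cnj ` (\<phi> ` unit_disc) = \<phi> ` unit_disc \<and>
     \<phi> 0 = 1 \<and>
     (\<forall>w \<in> \<phi> ` unit_disc. closed_segment 1 w \<subseteq> \<phi> ` unit_disc) \<and>
     deriv \<phi> 0 \<in> \<real> \<and> 0 < Re (deriv \<phi> 0)"

definition class_S :: "(complex \<Rightarrow> complex) set" where
  "class_S = {h. h holomorphic_on unit_disc \<and> inj_on h unit_disc \<and> h 0 = 0 \<and> deriv h 0 = 1}"

definition class_C :: "(complex \<Rightarrow> complex) \<Rightarrow> (complex \<Rightarrow> complex) set" where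
  "class_C \<phi> =
     {h \<in> class_S. subordinate (\<lambda>z. 1 + z * deriv (deriv h) z / deriv h z) \<phi>}"

text \<open>The inner integrand has a removable singularity at \<open>t = 0\<close>; there \<open>x / 0 = 0\<close> replaces its
  value at a single point of the path, which does not affect the integral.\<close>

definition K_fun :: "(complex \<Rightarrow> complex) \<Rightarrow> complex \<Rightarrow> complex" where
  "K_fun \<phi> z =
     contour_integral (linepath 0 z)
       (\<lambda>s. exp (contour_integral (linepath 0 s) (\<lambda>t. (\<phi> t - 1) / t)))"

definition harmonic_parts ::
    "(complex \<Rightarrow> complex) \<Rightarrow> (complex \<Rightarrow> complex) \<Rightarrow> (complex \<Rightarrow> complex) \<Rightarrow> bool" where
  "harmonic_parts f h g \<longleftrightarrow>
     h holomorphic_on unit_disc \<and> g holomorphic_on unit_disc \<and>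
     h 0 = 0 \<and> deriv h 0 = 1 \<and> g 0 = 0 \<and>
     (\<forall>z\<in>unit_disc. f z = h z + cnj (g z))"

definition class_HC :: "nat \<Rightarrow> (complex \<Rightarrow> complex) \<Rightarrow> (complex \<Rightarrow> complex) set" where
  "class_HC n \<phi> =
     {f. \<exists>h g \<zeta>. harmonic_parts f h g \<and>
           (\<forall>z\<in>unit_disc. norm (deriv g z) < norm (deriv h z)) \<and>
           h \<in> class_C \<phi> \<and>
           (\<forall>z\<in>unit_disc. deriv g z = \<zeta> * z ^ n * deriv h z) \<and>
           norm \<zeta> \<le> 1 / (2 * real n - 1)}"

definition taylor_coeff :: "(complex \<Rightarrow> complex) \<Rightarrow> nat \<Rightarrow> complex" where
  "taylor_coeff F k = (deriv ^^ k) F 0 / fact k"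

definition majorant :: "(complex \<Rightarrow> complex) \<Rightarrow> real \<Rightarrow> real" where
  "majorant F r = (\<Sum>k. norm (taylor_coeff F k) * r ^ k)"

definition harmonic_majorant ::
    "(complex \<Rightarrow> complex) \<Rightarrow> (complex \<Rightarrow> complex) \<Rightarrow> real \<Rightarrow> real" where
  "harmonic_majorant h g r =
     r + (\<Sum>k. (norm (taylor_coeff h (k + 2)) + norm (taylor_coeff g (k + 2))) * r ^ (k + 2))"

text \<open>For a Ma-Minda function \<open>\<phi>\<close>, the symmetry of the image and \<open>\<phi>'(0) > 0\<close> make \<open>\<phi>\<close>, and hence
  \<open>K\<close> and \<open>K'\<close>, real-valued on \<open>(-1, 1)\<close>. So \<open>Re\<close> below only converts types. The value
  \<open>K(-1)\<close> is the limit of \<open>K(-r)\<close> as \<open>r\<close> tends to \<open>1\<close> from the left.\<close>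

definition L_one :: "(complex \<Rightarrow> complex) \<Rightarrow> complex \<Rightarrow> nat \<Rightarrow> real" where
  "L_one \<phi> \<zeta> n =
     - Re (Lim (at_left 1) (\<lambda>r::real. K_fun \<phi> (- of_real r)))
     - norm \<zeta> * integral {0..1} (\<lambda>t::real. t ^ n * Re (deriv (K_fun \<phi>) (- of_real t)))"

definition root_rhs :: "(complex \<Rightarrow> complex) \<Rightarrow> complex \<Rightarrow> nat \<Rightarrow> real \<Rightarrow> real" where
  "root_rhs \<phi> \<zeta> n r =
     majorant (K_fun \<phi>) r
     + norm \<zeta> * integral {0..r} (\<lambda>t. t ^ n * majorant (deriv (K_fun \<phi>)) t)
     + integral {0..r}
         (\<lambda>t. t * (1 - (norm \<zeta>)\<^sup>2 * t ^ (2 * n)) * (Re (deriv (K_fun \<phi>) (of_real t)))\<^sup>2)"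

definition smallest_root :: "(complex \<Rightarrow> complex) \<Rightarrow> complex \<Rightarrow> nat \<Rightarrow> real \<Rightarrow> bool" where
  "smallest_root \<phi> \<zeta> n \<rho> \<longleftrightarrow>
     0 < \<rho> \<and> \<rho> < 1 \<and> L_one \<phi> \<zeta> n = root_rhs \<phi> \<zeta> n \<rho> \<and>
     (\<forall>s. 0 < s \<and> s < \<rho> \<longrightarrow> L_one \<phi> \<zeta> n \<noteq> root_rhs \<phi> \<zeta> n s)"

end

theory Submission imports Defs begin

text \<open>
  Write \<open>D\<close> for the unit disc and \<open>q = \<phi> - 1\<close>, and let \<open>G\<close> be the primitive of \<open>q(z) / z\<close> with
  \<open>G(0) = 0\<close>, so that \<open>K' = exp \<circ> G\<close>. The function \<open>q\<close> is univalent with an image starlike with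
  respect to \<open>0\<close>; by the Schwarz lemma this says that \<open>q(z\<^sub>2) = s q(z\<^sub>1)\<close> with \<open>0 \<le> s \<le> 1\<close>
  forces \<open>|z\<^sub>2| \<le> |z\<^sub>1|\<close>, and \<open>|z\<^sub>2| = |z\<^sub>1|\<close> only if \<open>z\<^sub>2 = z\<^sub>1\<close>. This is used in two ways.

  First, suppose that \<open>H'\<close> has no zeros and that \<open>z H'(z)\<close> has different arguments at different points
  of each circle about \<open>0\<close>. Then the image of each closed disc about \<open>0\<close> lies on one side of the
  tangent at each of its boundary points (\<open>support_strict\<close>), because at a maximiser of a real part over
  a disc the outward normal is determined. Hence \<open>H\<close> is univalent with convex image. For
  \<open>H = G\<close> the hypothesis is the starlikeness of \<open>q\<close>, and the supporting lines at \<open>G(\<plusminus> r)\<close> are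
  vertical, as \<open>\<phi>\<close> is real on the real axis; so \<open>G(- r) \<le> Re G(z) \<le> G(r)\<close> for \<open>|z| \<le> r\<close>. For
  \<open>h \<in> C(\<phi>)\<close> the hypothesis holds as \<open>Re (1 + z h''(z) / h'(z)) > 0\<close>, so \<open>h(D)\<close> is convex.
  Second, Jack's lemma gives \<open>h' \<prec> K'\<close> for \<open>h \<in> C(\<phi>)\<close> (\<open>log_subordinate\<close>). Together:
  \<open>K'(- |z|) \<le> |h'(z)| \<le> K'(|z|)\<close>.

  For \<open>r \<le> 1/3\<close> the left-hand side of the claim is at most the right-hand side \<open>R(r)\<close> of the equation
  that defines \<open>\<rho>\<close>. Indeed, by Bohr's inequality for subordinate functions the majorant of \<open>h'\<close> is at
  most that of \<open>K'\<close> (\<open>majorant_subordinate\<close>), which can be integrated, and the area is at most the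
  integral of the Jacobian \<open>|h'|\<^sup>2 - |g'|\<^sup>2\<close> in polar coordinates (\<open>harmonic_area_le\<close>); see
  \<open>majorant_and_area_le_root_rhs\<close>.

  On the other side, \<open>f\<close> covers the disc of radius \<open>L(\<zeta>, n, 1)\<close> about \<open>0 = f(0)\<close>, since \<open>f\<close> expands
  lengths by at least \<open>(1 - |\<zeta>| |z|\<^sup>n) K'(- |z|)\<close> (\<open>harmonic_covers_ball\<close>). As \<open>f(D)\<close> is open, its
  frontier has distance at least \<open>L(\<zeta>, n, 1)\<close> from \<open>0\<close>, provided that it is not empty; this proviso
  matters, because the distance to the empty set is \<open>0\<close> by convention. It follows from the convexity of
  \<open>h(D)\<close>: in the coordinate \<open>w = h(z)\<close>, \<open>f\<close> becomes \<open>w + cnj (g(h\<inverse>(w)))\<close>, a Lipschitz injection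
  of a convex domain other than the plane, and its limit at a boundary point of
  the domain is a value that \<open>f\<close> omits (\<open>harmonic_image_neq_UNIV\<close>).

  Finally, \<open>R\<close> is continuous with \<open>R(0) = 0 < L(\<zeta>, n, 1) < 1\<close> and \<open>R(r) \<ge> r\<close>. So a smallest root
  exists, and up to it \<open>R\<close> is at most \<open>L(\<zeta>, n, 1)\<close>.
\<close>

section \<open>Maxima of real parts, supporting lines and starlikeness\<close>

lemma Re_max_direction:
  fixes F :: "complex \<Rightarrow> complex"
  assumes der: "(F has_field_derivative c) (at z0)"
    and dir: "eventually (\<lambda>\<epsilon>::real. norm (z0 + of_real \<epsilon> * v) \<le> r) (at_right 0)"
    and max: "\<And>z. norm z \<le> r \<Longrightarrow> Re (F z) \<le> Re (F z0)"
  shows "Re (c * v) \<le> 0"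
proof (rule ccontr)
  assume "\<not> Re (c * v) \<le> 0"
  then have pos: "Re (c * v) > 0" by simp
  have "((\<lambda>\<epsilon>::real. z0 + of_real \<epsilon> * v) has_vector_derivative v) (at 0)"
    by (auto intro!: derivative_eq_intros simp: has_vector_derivative_def scaleR_conv_of_real)
  then have "((F \<circ> (\<lambda>\<epsilon>::real. z0 + of_real \<epsilon> * v)) has_vector_derivative v * c) (at 0)"
    by (rule field_vector_diff_chain_at) (use der in simp)
  then have "((\<lambda>\<epsilon>. Re (F (z0 + of_real \<epsilon> * v))) has_real_derivative Re (c * v)) (at 0)"
    unfolding has_real_derivative_iff_has_vector_derivative
    by (auto simp: o_def mult.commute dest!: bounded_linear.has_vector_derivative[OF bounded_linear_Re])
  from DERIV_pos_inc_right[OF this pos] obtain d where d: "d > 0"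
    "\<And>h. h > 0 \<Longrightarrow> h < d \<Longrightarrow> Re (F z0) < Re (F (z0 + of_real h * v))" by auto
  have "eventually (\<lambda>\<epsilon>::real. 0 < \<epsilon> \<and> \<epsilon> < d) (at_right 0)"
    using eventually_at_right_less eventually_at_right[of 0 d "\<lambda>x. x < d"] d(1)
    by (auto simp: eventually_conj_iff)
  with dir have "eventually (\<lambda>\<epsilon>::real. False) (at_right 0)"
    by eventually_elim (use d(2) max in \<open>fastforce simp: not_less\<close>)
  then show False by simp
qed

lemma Re_max_interior:
  fixes F :: "complex \<Rightarrow> complex"
  assumes der: "(F has_field_derivative c) (at z0)"
    and "norm z0 < r"
    and max: "\<And>z. norm z \<le> r \<Longrightarrow> Re (F z) \<le> Re (F z0)"
  shows "c = 0"
proof -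
  have "((\<lambda>\<epsilon>::real. norm (z0 + of_real \<epsilon> * cnj c)) \<longlongrightarrow> norm (z0 + of_real 0 * cnj c)) (at_right 0)"
    by (intro tendsto_intros)
  then have "eventually (\<lambda>\<epsilon>::real. norm (z0 + of_real \<epsilon> * cnj c) < r) (at_right 0)"
    by (rule order_tendstoD(2)) (use assms in simp)
  then have "Re (c * cnj c) \<le> 0"
    by (intro Re_max_direction[OF der _ max]) (auto elim: eventually_mono)
  then show "c = 0"
    by (simp add: complex_mult_cnj complex_eq_iff sum_power2_le_zero_iff)
qed

text \<open>At a boundary maximum of the real part over a disc, the derivative maps the outward normal to a
  nonnegative real number. Both Jack's lemma and the supporting lines rest on this.\<close>

lemma Re_max_boundary:
  fixes F :: "complex \<Rightarrow> complex"
  assumes der: "(F has_field_derivative c) (at z0)"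
    and r: "norm z0 = r"
    and max: "\<And>z. norm z \<le> r \<Longrightarrow> Re (F z) \<le> Re (F z0)"
  shows "\<exists>m\<ge>0. z0 * c = of_real m"
proof -
  have *: "Re (c * (z0 * u)) \<le> 0" if u: "Re u < 0" for u
  proof (rule Re_max_direction[OF der _ max])
    define e where "e = - 2 * Re u / (norm u)\<^sup>2"
    have "u \<noteq> 0" using u by auto
    then have e: "e > 0" using u by (simp add: e_def divide_neg_pos)
    have "norm (z0 + of_real \<epsilon> * (z0 * u)) \<le> r" if "0 < \<epsilon>" "\<epsilon> < e" for \<epsilon> :: real
    proof -
      have "\<epsilon> * (norm u)\<^sup>2 \<le> - 2 * Re u"
        using that \<open>u \<noteq> 0\<close> by (simp add: e_def field_simps)
      then have "\<epsilon> * (\<epsilon> * (norm u)\<^sup>2 + 2 * Re u) \<le> 0"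
        using that by (intro mult_nonneg_nonpos) auto
      moreover have "(norm (1 + of_real \<epsilon> * u))\<^sup>2 = 1 + \<epsilon> * (\<epsilon> * (norm u)\<^sup>2 + 2 * Re u)"
        by (simp only: cmod_power2) (simp add: algebra_simps power2_eq_square)
      ultimately have "(norm (1 + of_real \<epsilon> * u))\<^sup>2 \<le> 1" by simp
      then have "norm (1 + of_real \<epsilon> * u) \<le> 1"
        by (simp add: power2_le_iff_abs_le abs_square_le_1)
      moreover have "norm (z0 + of_real \<epsilon> * (z0 * u)) = norm z0 * norm (1 + of_real \<epsilon> * u)"
        by (metis norm_mult distrib_left mult.left_commute mult.right_neutral)
      ultimately show ?thesis using r mult_left_le[of "norm (1 + of_real \<epsilon> * u)" "norm z0"]
        by (metis norm_ge_zero)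
    qed
    then show "eventually (\<lambda>\<epsilon>::real. norm (z0 + of_real \<epsilon> * (z0 * u)) \<le> r) (at_right 0)"
      using e by (auto simp: eventually_at_right intro!: exI[of _ e])
  qed
  define a where "a = z0 * c"
  have *: "Re (a * u) \<le> 0" if "Re u \<le> 0" for u
  proof (rule tendsto_upperbound)
    show "((\<lambda>\<epsilon>::real. Re (a * (u - of_real \<epsilon>))) \<longlongrightarrow> Re (a * u)) (at_right 0)"
      by (rule tendsto_eq_intros refl | simp)+
    show "eventually (\<lambda>\<epsilon>. Re (a * (u - of_real \<epsilon>)) \<le> 0) (at_right 0)"
      using eventually_at_right_less[of "0::real"]
    proof eventually_elim
      case (elim \<epsilon>)
      show ?case using *[of "u - of_real \<epsilon>"] that elim by (simp add: a_def mult_ac)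
    qed
  qed auto
  have "Im a = 0" using *[of \<i>] *[of "-\<i>"] by simp
  moreover have "Re a \<ge> 0" using *[of "-1"] by simp
  ultimately show ?thesis by (metis a_def complex_eq_iff Re_complex_of_real Im_complex_of_real)
qed

text \<open>The image of the closed disc about \<open>0\<close> with boundary point \<open>z1\<close>, apart from \<open>H z1\<close> itself,
  lies strictly to one side of the tangent at \<open>H z1\<close>, whose outward normal is \<open>z1 * deriv H z1\<close>. By \<open>sep\<close> no other point of the circle has the same
  outward normal, so none maximises the real part in this direction.\<close>

lemma support_strict:
  fixes H :: "complex \<Rightarrow> complex"
  assumes holH: "H holomorphic_on unit_disc"
    and nz: "\<And>z. z \<in> unit_disc \<Longrightarrow> deriv H z \<noteq> 0"
    and z1: "z1 \<noteq> 0" "norm z1 < 1"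
    and sep: "\<And>z2 m. norm z2 = norm z1 \<Longrightarrow> m > 0 \<Longrightarrow>
        z2 * deriv H z2 = of_real m * (z1 * deriv H z1) \<Longrightarrow> z2 = z1"
    and z2: "norm z2 \<le> norm z1" "z2 \<noteq> z1"
  shows "Re ((H z2 - H z1) / (z1 * deriv H z1)) < 0"
proof -
  define N where "N = z1 * deriv H z1"
  have N: "N \<noteq> 0" using z1 nz by (simp add: N_def)
  define F where "F z = (H z - H z1) / N" for z
  have derF: "(F has_field_derivative deriv H z / N) (at z)" if "norm z \<le> norm z1" for z
  proof -
    have "(H has_field_derivative deriv H z) (at z)"
      by (rule holomorphic_derivI[OF holH]) (use that z1 in auto)
    from DERIV_cdivide[OF DERIV_diff[OF this DERIV_const[of "H z1"]], of N]
    show ?thesis unfolding F_def by simp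
  qed
  have uniq: "z = z1" if z: "norm z \<le> norm z1" and max: "\<And>w. norm w \<le> norm z1 \<Longrightarrow> Re (F w) \<le> Re (F z)" for z
  proof (cases "norm z < norm z1")
    case True
    have "deriv H z / N = 0" by (rule Re_max_interior[OF derF[OF z] True max])
    then show ?thesis using nz[of z] N z z1 by auto
  next
    case False
    then have eq: "norm z = norm z1" using z by simp
    obtain m where m: "m \<ge> 0" "z * (deriv H z / N) = of_real m"
      using Re_max_boundary[OF derF[OF z] eq max] by blast
    have "z \<noteq> 0" using eq z1 by auto
    then have "m \<noteq> 0" using m(2) N nz[of z] z z1 by auto
    moreover have "z * deriv H z = of_real m * (z1 * deriv H z1)"
      using m(2) N by (simp add: N_def field_simps)
    ultimately show ?thesis using sep[OF eq, of m] m by auto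
  qed
  have "continuous_on (cball 0 (norm z1)) (\<lambda>z. Re (F z))"
    unfolding F_def
    by (intro continuous_intros holomorphic_on_imp_continuous_on holomorphic_on_subset[OF holH])
      (use z1 N in auto)
  then obtain z where z: "norm z \<le> norm z1" "\<And>w. norm w \<le> norm z1 \<Longrightarrow> Re (F w) \<le> Re (F z)"
    using continuous_attains_sup[of "cball 0 (norm z1)" "\<lambda>z. Re (F z)"] by (auto simp: Ball_def)
  then have "z = z1" using uniq by blast
  then have le: "Re (F w) \<le> 0" if "norm w \<le> norm z1" for w
    using z(2)[OF that] by (simp add: F_def)
  have "Re (F z2) \<noteq> 0"
    using uniq[of z2] z2 le by auto
  then show ?thesis using le[of z2] z2 by (simp add: F_def N_def)
qed

lemma inj_on_of_separation:
  fixes H :: "complex \<Rightarrow> complex"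
  assumes holH: "H holomorphic_on unit_disc"
    and nz: "\<And>z. z \<in> unit_disc \<Longrightarrow> deriv H z \<noteq> 0"
    and sep: "\<And>z1 z2 m. z1 \<in> unit_disc \<Longrightarrow> norm z2 = norm z1 \<Longrightarrow> m > 0 \<Longrightarrow>
        z2 * deriv H z2 = of_real m * (z1 * deriv H z1) \<Longrightarrow> z2 = z1"
  shows "inj_on H unit_disc"
proof -
  have *: "z2 = z1" if "norm z2 \<le> norm z1" "z1 \<in> unit_disc" "H z1 = H z2" for z1 z2
  proof (rule ccontr)
    assume "z2 \<noteq> z1"
    moreover from this have "z1 \<noteq> 0" using that by auto
    ultimately have "Re ((H z2 - H z1) / (z1 * deriv H z1)) < 0"
      by (intro support_strict[OF holH nz]) (use that sep in auto)
    then show False using that by simp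
  qed
  show ?thesis
  proof (rule inj_onI)
    fix x y assume "x \<in> unit_disc" "y \<in> unit_disc" "H x = H y"
    then show "x = y" using *[of x y] *[of y x] by (cases "norm x \<le> norm y") auto
  qed
qed

text \<open>If a point \<open>w\<close> of a chord were omitted, the supporting line at the point of the image nearest to
  \<open>w\<close> would separate \<open>w\<close> from both ends of the chord.\<close>

lemma convex_image_of_separation:
  fixes H :: "complex \<Rightarrow> complex"
  assumes holH: "H holomorphic_on unit_disc"
    and nz: "\<And>z. z \<in> unit_disc \<Longrightarrow> deriv H z \<noteq> 0"
    and sep: "\<And>z1 z2 m. z1 \<in> unit_disc \<Longrightarrow> norm z2 = norm z1 \<Longrightarrow> m > 0 \<Longrightarrow>
        z2 * deriv H z2 = of_real m * (z1 * deriv H z1) \<Longrightarrow> z2 = z1"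
  shows "convex (H ` unit_disc)"
proof -
  have "closed_segment (H a) (H b) \<subseteq> H ` unit_disc" if ab: "a \<in> unit_disc" "b \<in> unit_disc" for a b
  proof
    fix w assume w: "w \<in> closed_segment (H a) (H b)"
    define r where "r = max (max (norm a) (norm b)) (1/2)"
    have r: "0 < r" "r < 1" "norm a \<le> r" "norm b \<le> r" using ab by (auto simp: r_def)
    have sub: "cball 0 r \<subseteq> unit_disc" using r by auto
    show "w \<in> H ` unit_disc"
    proof (rule ccontr)
      assume nw: "w \<notin> H ` unit_disc"
      have cont: "continuous_on (cball 0 r) H"
        by (intro holomorphic_on_imp_continuous_on holomorphic_on_subset[OF holH] sub)
      then obtain z1 where z1: "norm z1 \<le> r" "\<And>z. norm z \<le> r \<Longrightarrow> norm (H z1 - w) \<le> norm (H z - w)"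
        using continuous_attains_inf[of "cball 0 r" "\<lambda>z. norm (H z - w)"] r(1)
          continuous_on_norm[OF continuous_on_diff[OF cont continuous_on_const[of _ w]]]
        by (auto simp: Ball_def)
      have z1D: "z1 \<in> unit_disc" using z1 r by auto
      define u where "u = w - H z1"
      have u: "u \<noteq> 0" using nw z1D by (auto simp: u_def)
      have wH: "w - H z \<noteq> 0" if "norm z \<le> r" for z using nw that sub by auto
      \<comment> \<open>The point of the compact image nearest to \<open>w\<close> maximises the modulus of \<open>u / (w - H)\<close>.\<close>
      have max: "Re (u / (w - H z)) \<le> Re (u / (w - H z1))" if "norm z \<le> r" for z
      proof -
        have "norm u \<le> norm (w - H z)" using z1(2)[OF that] by (simp add: u_def norm_minus_commute)
        then have "norm (u / (w - H z)) \<le> 1" using wH[OF that] by (simp add: norm_divide)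
        then have "Re (u / (w - H z)) \<le> 1" using complex_Re_le_cmod order_trans by blast
        then show ?thesis using u by (simp add: u_def)
      qed
      have der: "((\<lambda>z. u / (w - H z)) has_field_derivative deriv H z1 / u) (at z1)"
      proof -
        have "(H has_field_derivative deriv H z1) (at z1)"
          by (rule holomorphic_derivI[OF holH]) (use z1D in auto)
        from DERIV_divide[OF DERIV_const DERIV_diff[OF DERIV_const this], of w u] u
        show ?thesis by (simp add: u_def)
      qed
      have "\<not> norm z1 < r"
        using Re_max_interior[OF der _ max] nz[OF z1D] u by auto
      then have eq: "norm z1 = r" using z1 by simp
      then have z10: "z1 \<noteq> 0" using r by auto
      obtain m where m: "m \<ge> 0" "z1 * (deriv H z1 / u) = of_real m"
        using Re_max_boundary[OF der eq max] by blast
      then have m0: "m > 0" using z10 nz[OF z1D] u by (cases "m = 0") auto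
      have half: "Re ((H x - H z1) / u) \<le> 0" if x: "norm x \<le> r" for x
      proof (cases "x = z1")
        case False
        have "Re ((H x - H z1) / (z1 * deriv H z1)) < 0"
          by (rule support_strict[OF holH nz z10 _ sep[OF z1D]]) (use False x eq r in auto)
        moreover have "(H x - H z1) / u = of_real m * ((H x - H z1) / (z1 * deriv H z1))"
          using m(2) m0 u z10 nz[OF z1D] by (simp add: field_simps)
        ultimately show ?thesis using m0 by (simp add: mult_le_0_iff del: times_divide_eq_right)
      qed simp
      obtain t where t: "0 \<le> t" "t \<le> 1" "w = (1 - t) *\<^sub>R H a + t *\<^sub>R H b"
        using w by (auto simp: closed_segment_def)
      have "u / u = (1 - t) *\<^sub>R ((H a - H z1) / u) + t *\<^sub>R ((H b - H z1) / u)"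
      proof -
        have "u = (1 - t) *\<^sub>R (H a - H z1) + t *\<^sub>R (H b - H z1)"
          by (simp add: u_def t(3) scaleR_conv_of_real algebra_simps)
        then show ?thesis by (metis add_divide_distrib scaleR_conv_of_real times_divide_eq_right)
      qed
      from arg_cong[OF this, of Re] u have "1 = (1 - t) * Re ((H a - H z1) / u) + t * Re ((H b - H z1) / u)"
        by simp
      moreover have "\<dots> \<le> 0"
        using half[of a] half[of b] r t
        by (intro add_nonpos_nonpos mult_nonneg_nonpos) auto
      ultimately show False by simp
    qed
  qed
  then show ?thesis unfolding convex_contains_segment by (auto simp: image_iff)
qed

text \<open>Subordination to a univalent function is inclusion of the images.\<close>

lemma factor_through_univalent:
  fixes \<Phi> F :: "complex \<Rightarrow> complex"
  assumes hol: "\<Phi> holomorphic_on unit_disc" and inj: "inj_on \<Phi> unit_disc"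
    and holF: "F holomorphic_on ball 0 r"
    and im: "F ` ball 0 r \<subseteq> \<Phi> ` unit_disc" and "F 0 = \<Phi> 0"
  obtains \<omega> where "\<omega> holomorphic_on ball 0 r" "\<omega> 0 = 0" "\<omega> ` ball 0 r \<subseteq> unit_disc"
    "\<And>z. z \<in> ball 0 r \<Longrightarrow> F z = \<Phi> (\<omega> z)"
proof -
  obtain k where k: "k holomorphic_on (\<Phi> ` unit_disc)" "\<And>z. z \<in> unit_disc \<Longrightarrow> k (\<Phi> z) = z"
    using holomorphic_has_inverse[OF hol open_ball inj] by metis
  show ?thesis
  proof (rule that[of "k \<circ> F"])
    show "k \<circ> F holomorphic_on ball 0 r"
      by (rule holomorphic_on_compose_gen[OF holF k(1) im])
    show "(k \<circ> F) 0 = 0" using k(2)[of 0] assms(5) by simp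
    show "(k \<circ> F) ` ball 0 r \<subseteq> unit_disc" using im k(2) by fastforce
    show "F z = \<Phi> ((k \<circ> F) z)" if "z \<in> ball 0 r" for z
    proof -
      have "F z \<in> \<Phi> ` unit_disc" using im that by blast
      then show ?thesis using k(2) by auto
    qed
  qed
qed

lemma Schwarz_le:
  assumes "\<omega> holomorphic_on unit_disc" "\<omega> 0 = 0" "\<omega> ` unit_disc \<subseteq> unit_disc" "z \<in> unit_disc"
  shows "norm (\<omega> z) \<le> norm z"
  using Schwarz_Lemma(1)[of \<omega> z] assms by (force simp: image_subset_iff)

text \<open>The Schwarz lemma applied to the self-map \<open>q\<inverse> \<circ> (s q)\<close> of the disc. In the case of equality
  it is a rotation with derivative \<open>s\<close> at \<open>0\<close>, so \<open>s = 1\<close>.\<close>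

lemma starlike_norm_le:
  fixes q :: "complex \<Rightarrow> complex"
  assumes hol: "q holomorphic_on unit_disc" and inj: "inj_on q unit_disc" and q0: "q 0 = 0"
    and star: "\<And>w. w \<in> q ` unit_disc \<Longrightarrow> closed_segment 0 w \<subseteq> q ` unit_disc"
    and s: "0 \<le> s" "s \<le> 1" and z: "z1 \<in> unit_disc" "z2 \<in> unit_disc"
    and eq: "q z2 = of_real s * q z1"
  shows "norm z2 \<le> norm z1" and "norm z2 = norm z1 \<Longrightarrow> z2 = z1"
proof -
  have im: "(\<lambda>z. of_real s * q z) ` ball 0 1 \<subseteq> q ` unit_disc"
  proof safe
    fix z :: complex assume "z \<in> ball 0 1"
    then have "closed_segment 0 (q z) \<subseteq> q ` unit_disc" using star by blast
    moreover have "of_real s * q z \<in> closed_segment 0 (q z)"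
      using s by (auto simp: closed_segment_def scaleR_conv_of_real)
    ultimately show "of_real s * q z \<in> q ` unit_disc" by blast
  qed
  obtain \<omega> where \<omega>: "\<omega> holomorphic_on unit_disc" "\<omega> 0 = 0" "\<omega> ` unit_disc \<subseteq> unit_disc"
    "\<And>z. z \<in> unit_disc \<Longrightarrow> of_real s * q z = q (\<omega> z)"
    by (rule factor_through_univalent[OF hol inj _ im])
      (use q0 in \<open>auto intro!: holomorphic_intros hol\<close>)
  have "\<omega> z1 \<in> unit_disc" using \<omega>(3) z by blast
  moreover have "q z2 = q (\<omega> z1)" using eq \<omega>(4) z by simp
  ultimately have z2: "z2 = \<omega> z1" using inj z by (auto dest: inj_onD)
  then show "norm z2 \<le> norm z1" using Schwarz_le[OF \<omega>(1-3)] z by simp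
  assume norm_eq: "norm z2 = norm z1"
  show "z2 = z1"
  proof (cases "z1 = 0")
    case True then show ?thesis using norm_eq by simp
  next
    case False
    obtain \<alpha> where \<alpha>: "\<And>z. norm z < 1 \<Longrightarrow> \<omega> z = \<alpha> * z" "norm \<alpha> = 1"
      using Schwarz_Lemma(3)[OF \<omega>(1,2), of z1] \<omega>(3) z norm_eq z2 False by (force simp: image_subset_iff)
    have d: "(q has_field_derivative deriv q 0) (at 0)"
      by (rule holomorphic_derivI[OF hol]) auto
    then have d': "(q has_field_derivative deriv q 0) (at (\<alpha> * 0))" by simp
    have l: "((\<lambda>z. of_real s * q z) has_field_derivative of_real s * deriv q 0) (at 0)"
      by (rule DERIV_cmult[OF d])
    have "((\<lambda>z. q (\<alpha> * z)) has_field_derivative deriv q 0 * \<alpha>) (at 0)"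
      by (rule DERIV_chain2[OF d' DERIV_cmult_Id])
    moreover have "((\<lambda>z. q (\<alpha> * z)) has_field_derivative of_real s * deriv q 0) (at 0)"
      by (rule has_field_derivative_transform_within_open[OF l open_ball[of 0 1]])
        (use \<omega>(4) \<alpha>(1) in auto)
    ultimately have "deriv q 0 * \<alpha> = of_real s * deriv q 0" by (rule DERIV_unique)
    moreover have "deriv q 0 \<noteq> 0"
      by (rule holomorphic_injective_imp_regular[OF hol open_ball inj]) simp
    ultimately have "\<alpha> = of_real s" by simp
    then have "s = 1" using \<alpha>(2) s by simp
    then show ?thesis using eq inj z by (auto dest: inj_onD)
  qed
qed

section \<open>The logarithm of the derivative of K\<close>

lemma holomorphic_primitive_disc:
  assumes "p holomorphic_on unit_disc"
  obtains P where "\<And>z. z \<in> unit_disc \<Longrightarrow> (P has_field_derivative p z) (at z)" "P 0 = 0"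
    "\<And>z. z \<in> unit_disc \<Longrightarrow> (p has_contour_integral P z) (linepath 0 z)"
proof -
  obtain P0 where "\<And>z. z \<in> unit_disc \<Longrightarrow> (P0 has_field_derivative p z) (at z within unit_disc)"
    using holomorphic_convex_primitive'[OF convex_ball open_ball assms] by blast
  then have P0: "(P0 has_field_derivative p z) (at z)" if "z \<in> unit_disc" for z
    using at_within_open[OF that open_ball] that by metis
  define P where "P z = P0 z - P0 0" for z
  have P: "(P has_field_derivative p z) (at z)" if "z \<in> unit_disc" for z
    unfolding P_def using DERIV_diff[OF P0[OF that] DERIV_const[of "P0 0"]] by simp
  show ?thesis
  proof (rule that[of P])
    show "P 0 = 0" by (simp add: P_def)
    show "(p has_contour_integral P z) (linepath 0 z)" if "z \<in> unit_disc" for z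
    proof -
      have "closed_segment 0 z \<subseteq> unit_disc"
        using that by (meson centre_in_ball convex_ball convex_contains_segment zero_less_one)
      then have "(p has_contour_integral (P (pathfinish (linepath 0 z)) - P (pathstart (linepath 0 z)))) (linepath 0 z)"
        by (intro contour_integral_primitive[of unit_disc] has_field_derivative_at_within[OF P])
          (simp_all only: valid_path_linepath path_image_linepath)
      then show ?thesis using \<open>P 0 = 0\<close> by simp
    qed
  qed (use P in auto)
qed

text \<open>The logarithm of \<open>K'\<close>, called \<open>G\<close> below. As in \<open>K_fun\<close>, the value \<open>x / 0 = 0\<close> of the integrand at
  the single point \<open>0\<close> has no influence.\<close>

definition log_deriv_K :: "(complex \<Rightarrow> complex) \<Rightarrow> complex \<Rightarrow> complex" where
  "log_deriv_K \<phi> s = contour_integral (linepath 0 s) (\<lambda>t. (\<phi> t - 1) / t)"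

text \<open>A fixed Ma-Minda function, with \<open>G\<close> and \<open>K\<close> standing for the functions built from it.\<close>

locale ma_minda_function =
  fixes \<phi> :: "complex \<Rightarrow> complex"
  assumes ma_minda: "ma_minda \<phi>"
begin

abbreviation "G \<equiv> log_deriv_K \<phi>"
abbreviation "K \<equiv> K_fun \<phi>"

lemma phi_hol: "\<phi> holomorphic_on unit_disc" and phi_inj: "inj_on \<phi> unit_disc"
  and phi_0: "\<phi> 0 = 1" and phi_Re: "z \<in> unit_disc \<Longrightarrow> 0 < Re (\<phi> z)"
  using ma_minda by (auto simp: ma_minda_def)

lemma G_props:
  assumes "z \<in> unit_disc"
  shows G_deriv: "(G has_field_derivative deriv G z) (at z)"
    and G_deriv_eq: "z * deriv G z = \<phi> z - 1" and G_0: "G 0 = 0"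
    and G_deriv_0: "deriv G 0 = deriv \<phi> 0"
proof -
  have "(\<lambda>z. \<phi> z - 1) holomorphic_on unit_disc" by (intro holomorphic_intros phi_hol)
  then obtain p where p: "p holomorphic_on unit_disc"
    "\<And>z. norm z < 1 \<Longrightarrow> \<phi> z - 1 = z * p z" "deriv (\<lambda>z. \<phi> z - 1) 0 = p 0"
    by (rule Schwarz3) (auto simp: phi_0)
  have p0: "p 0 = deriv \<phi> 0"
    using p(3) holomorphic_on_imp_differentiable_at[OF phi_hol, of 0] by simp
  obtain P where P: "\<And>z. z \<in> unit_disc \<Longrightarrow> (P has_field_derivative p z) (at z)" "P 0 = 0"
    "\<And>z. z \<in> unit_disc \<Longrightarrow> (p has_contour_integral P z) (linepath 0 z)"
    using holomorphic_primitive_disc[OF p(1)] by metis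
  have GP: "P s = G s" if s: "s \<in> unit_disc" for s
  proof (cases "s = 0")
    case True then show ?thesis by (simp add: log_deriv_K_def P)
  next
    case False
    have "((\<lambda>t. (\<phi> t - 1) / t) has_contour_integral P s) (linepath 0 s)"
      unfolding has_contour_integral_linepath
    proof (rule has_integral_spike_finite[of "{0}"])
      show "((\<lambda>x. p (linepath 0 s x) * (s - 0)) has_integral P s) {0..1}"
        using P(3)[OF s] by (simp add: has_contour_integral_linepath)
      fix x :: real assume x: "x \<in> {0..1} - {0}"
      have "linepath 0 s x = of_real x * s" by (simp add: linepath_def scaleR_conv_of_real)
      moreover have "norm (of_real x * s) < 1"
        using x s by (auto simp: norm_mult intro: le_less_trans[OF mult_left_le_one_le])
      ultimately show "(\<phi> (linepath 0 s x) - 1) / linepath 0 s x * (s - 0) = p (linepath 0 s x) * (s - 0)"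
        using p(2)[of "of_real x * s"] x False by simp
    qed auto
    then show ?thesis by (simp add: log_deriv_K_def contour_integral_unique)
  qed
  have *: "(G has_field_derivative p z) (at z)" if "z \<in> unit_disc" for z
    by (rule has_field_derivative_transform_within_open[OF P(1)[OF that] open_ball that GP])
  then show "(G has_field_derivative deriv G z) (at z)" using assms DERIV_deriv_iff_has_field_derivative by blast
  show "z * deriv G z = \<phi> z - 1" using *[OF assms] p(2)[of z] assms by (simp add: DERIV_imp_deriv)
  show "G 0 = 0" by (simp add: log_deriv_K_def)
  show "deriv G 0 = deriv \<phi> 0" using *[of 0] by (simp add: DERIV_imp_deriv p0)
qed

lemma G_hol: "G holomorphic_on unit_disc"
  unfolding holomorphic_on_open[OF open_ball] using G_deriv by blast

lemma phi_deriv_0: "deriv \<phi> 0 = of_real (Re (deriv \<phi> 0))" "Re (deriv \<phi> 0) > 0"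
  using ma_minda by (auto simp: ma_minda_def)

lemma G_deriv_nonzero:
  assumes "z \<in> unit_disc" shows "deriv G z \<noteq> 0"
proof (cases "z = 0")
  case True
  then show ?thesis using G_deriv_0[of 0] phi_deriv_0 by auto
next
  case False
  then have "\<phi> z \<noteq> \<phi> 0" using phi_inj assms by (auto dest: inj_onD)
  then show ?thesis using G_deriv_eq[OF assms] phi_0 by auto
qed

lemma K_deriv: assumes "z \<in> unit_disc" shows "(K has_field_derivative exp (G z)) (at z)" and K_0: "K 0 = 0"
proof -
  have "(\<lambda>s. exp (G s)) holomorphic_on unit_disc" by (intro holomorphic_intros G_hol)
  then obtain P where P: "\<And>z. z \<in> unit_disc \<Longrightarrow> (P has_field_derivative exp (G z)) (at z)"
    "\<And>z. z \<in> unit_disc \<Longrightarrow> ((\<lambda>s. exp (G s)) has_contour_integral P z) (linepath 0 z)"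
    using holomorphic_primitive_disc[of "\<lambda>s. exp (G s)"] by metis
  have "P s = K s" if "s \<in> unit_disc" for s
    using contour_integral_unique[OF P(2)[OF that]] by (simp add: K_fun_def log_deriv_K_def)
  then show "(K has_field_derivative exp (G z)) (at z)"
    by (rule has_field_derivative_transform_within_open[OF P(1)[OF assms] open_ball assms])
  show "K 0 = 0" by (simp add: K_fun_def)
qed

lemma deriv_K: "z \<in> unit_disc \<Longrightarrow> deriv K z = exp (G z)"
  using K_deriv by (simp add: DERIV_imp_deriv)

lemma K_hol: "K holomorphic_on unit_disc"
  unfolding holomorphic_on_open[OF open_ball] using K_deriv by blast

lemma phi_minus_1_starlike:
  assumes "0 \<le> s" "s \<le> 1" "z1 \<in> unit_disc" "z2 \<in> unit_disc" "\<phi> z2 - 1 = of_real s * (\<phi> z1 - 1)"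
  shows "norm z2 \<le> norm z1" "norm z2 = norm z1 \<Longrightarrow> z2 = z1"
proof -
  have star: "closed_segment 0 w \<subseteq> (\<lambda>z. \<phi> z - 1) ` unit_disc"
    if "w \<in> (\<lambda>z. \<phi> z - 1) ` unit_disc" for w
  proof
    fix v assume v: "v \<in> closed_segment 0 w"
    have "w + 1 \<in> \<phi> ` unit_disc" using that by auto
    then have "closed_segment 1 (w + 1) \<subseteq> \<phi> ` unit_disc"
      using ma_minda unfolding ma_minda_def by blast
    moreover have "v + 1 \<in> closed_segment 1 (w + 1)"
      using v by (auto simp: closed_segment_def algebra_simps)
    ultimately have "v + 1 \<in> \<phi> ` unit_disc" by blast
    then show "v \<in> (\<lambda>z. \<phi> z - 1) ` unit_disc" by (force simp: image_iff algebra_simps)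
  qed
  have "(\<lambda>z. \<phi> z - 1) holomorphic_on unit_disc" "inj_on (\<lambda>z. \<phi> z - 1) unit_disc"
    using phi_inj by (auto intro!: holomorphic_intros phi_hol simp: inj_on_def)
  from starlike_norm_le[OF this _ star assms(1-4)] assms(5) phi_0
  show "norm z2 \<le> norm z1" "norm z2 = norm z1 \<Longrightarrow> z2 = z1" by auto
qed

text \<open>This is starlikeness of the image of \<open>\<phi>\<close>, as \<open>z * deriv G z = \<phi> z - 1\<close>.\<close>

lemma G_separation:
  assumes "z1 \<in> unit_disc" "norm z2 = norm z1" "m > 0"
    and "z2 * deriv G z2 = of_real m * (z1 * deriv G z1)"
  shows "z2 = z1"
proof -
  have z2: "z2 \<in> unit_disc" using assms by simp
  have eq: "\<phi> z2 - 1 = of_real m * (\<phi> z1 - 1)"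
    using assms G_deriv_eq[OF assms(1)] G_deriv_eq[OF z2] by simp
  show ?thesis
  proof (cases "m \<le> 1")
    case True
    show ?thesis by (rule phi_minus_1_starlike(2)[OF _ True assms(1) z2 eq]) (use assms in auto)
  next
    case False
    have "z1 = z2"
      by (rule phi_minus_1_starlike(2)[of "1 / m", OF _ _ z2 assms(1)]) (use False eq assms in auto)
    then show ?thesis by simp
  qed
qed

lemma G_inj: "inj_on G unit_disc"
  by (rule inj_on_of_separation[OF G_hol G_deriv_nonzero G_separation])

text \<open>Both \<open>\<phi>\<close> and \<open>cnj \<circ> \<phi> \<circ> cnj\<close> map the disc onto the same domain with the same value and the
  same positive derivative at \<open>0\<close>, so they agree.\<close>

lemma phi_cnj: assumes "z \<in> unit_disc" shows "\<phi> (cnj z) = cnj (\<phi> z)"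
proof -
  define F where "F z = cnj (\<phi> (cnj z))" for z
  have derF: "(F has_field_derivative cnj (deriv \<phi> (cnj z))) (at z)" if "z \<in> unit_disc" for z
  proof -
    have "(\<phi> has_field_derivative deriv \<phi> (cnj z)) (at (cnj z))"
      by (rule holomorphic_derivI[OF phi_hol]) (use that in auto)
    then show ?thesis using has_field_derivative_cnj_cnj[of \<phi> _ z] by (simp add: F_def[abs_def] o_def)
  qed
  have holF: "F holomorphic_on ball 0 1" unfolding holomorphic_on_open[OF open_ball] using derF by blast
  have im: "F ` ball 0 1 \<subseteq> \<phi> ` unit_disc"
  proof -
    have "F z \<in> cnj ` (\<phi> ` unit_disc)" if "z \<in> ball 0 1" for z
      using that by (auto simp: F_def)
    then show ?thesis using ma_minda unfolding ma_minda_def by blast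
  qed
  have "F 0 = \<phi> 0" by (simp add: F_def phi_0)
  then obtain \<omega> where \<omega>: "\<omega> holomorphic_on unit_disc" "\<omega> 0 = 0" "\<omega> ` unit_disc \<subseteq> unit_disc"
    "\<And>z. z \<in> unit_disc \<Longrightarrow> F z = \<phi> (\<omega> z)"
    by (rule factor_through_univalent[OF phi_hol phi_inj holF im]) metis
  have d\<omega>: "(\<omega> has_field_derivative deriv \<omega> 0) (at 0)"
    by (rule holomorphic_derivI[OF \<omega>(1)]) auto
  have "(\<phi> has_field_derivative deriv \<phi> 0) (at (\<omega> 0))"
    using \<omega>(2) holomorphic_derivI[OF phi_hol, of 0] by simp
  from DERIV_chain2[OF this d\<omega>]
  have "(F has_field_derivative deriv \<phi> 0 * deriv \<omega> 0) (at 0)"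
    by (rule has_field_derivative_transform_within_open[OF _ open_ball[of 0 1]]) (use \<omega> in auto)
  moreover have "(F has_field_derivative deriv \<phi> 0) (at 0)"
    using derF[of 0] phi_deriv_0(1) by (metis centre_in_ball complex_cnj_complex_of_real complex_cnj_zero zero_less_one)
  ultimately have "deriv \<phi> 0 * deriv \<omega> 0 = deriv \<phi> 0" by (rule DERIV_unique)
  then have d1: "deriv \<omega> 0 = 1" using phi_deriv_0 by auto
  then obtain \<alpha> where \<alpha>: "\<And>z. norm z < 1 \<Longrightarrow> \<omega> z = \<alpha> * z"
    using Schwarz_Lemma(3)[OF \<omega>(1,2), of 0] \<omega>(3) by (auto simp: image_subset_iff)
  have "(\<omega> has_field_derivative \<alpha>) (at 0)"
    by (rule has_field_derivative_transform_within_open[OF DERIV_cmult_Id open_ball[of 0 1]])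
      (use \<alpha> in auto)
  then have "\<alpha> = 1" using d1 by (simp add: DERIV_imp_deriv)
  then have "cnj (\<phi> (cnj z)) = \<phi> z" using \<alpha>[of z] \<omega>(4)[OF assms] assms by (simp add: F_def)
  then show ?thesis by (metis complex_cnj_cnj)
qed

lemma G_deriv_real: assumes "\<bar>x\<bar> < 1" shows "Im (deriv G (of_real x)) = 0"
proof (cases "x = 0")
  case True
  then show ?thesis using G_deriv_0[of 0] phi_deriv_0(1) by (metis Im_complex_of_real centre_in_ball of_real_0 zero_less_one)
next
  case False
  have "of_real x * deriv G (of_real x) = \<phi> (of_real x) - 1"
    by (rule G_deriv_eq) (use assms in auto)
  moreover have "Im (\<phi> (of_real x)) = 0"
    using phi_cnj[of "of_real x"] assms by (auto simp: complex_eq_iff)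
  ultimately have "Im (of_real x * deriv G (of_real x)) = 0" by simp
  then show ?thesis using False by simp
qed

lemma Re_G_has_derivative:
  assumes "\<bar>x\<bar> < 1"
  shows "((\<lambda>x. Re (G (of_real x))) has_real_derivative Re (deriv G (of_real x))) (at x)"
    and "((\<lambda>x. Im (G (of_real x))) has_real_derivative 0) (at x)"
proof -
  have "((G \<circ> complex_of_real) has_vector_derivative 1 * deriv G (of_real x)) (at x)"
    by (rule field_vector_diff_chain_at)
      (use assms in \<open>auto intro!: G_deriv derivative_eq_intros simp: has_vector_derivative_def scaleR_conv_of_real\<close>)
  from bounded_linear.has_vector_derivative[OF bounded_linear_Re this]
    bounded_linear.has_vector_derivative[OF bounded_linear_Im this]
  show "((\<lambda>x. Re (G (of_real x))) has_real_derivative Re (deriv G (of_real x))) (at x)"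
    "((\<lambda>x. Im (G (of_real x))) has_real_derivative 0) (at x)"
    using G_deriv_real[OF assms]
    by (simp_all add: has_real_derivative_iff_has_vector_derivative o_def)
qed

lemma G_real: assumes "\<bar>x\<bar> < 1" shows "G (of_real x) = of_real (Re (G (of_real x)))"
proof -
  have "Im (G (of_real x)) = Im (G (of_real 0))"
    by (rule DERIV_isconst3[of "-1" 1]) (use assms Re_G_has_derivative(2) in auto)
  then show ?thesis using G_0[of 0] by (simp add: complex_eq_iff)
qed

lemma G_deriv_pos: assumes "\<bar>x\<bar> < 1" shows "Re (deriv G (of_real x)) > 0"
proof (rule ccontr)
  assume neg: "\<not> ?thesis"
  have cont: "continuous_on {-1<..<1} (\<lambda>x::real. Re (deriv G (of_real x)))"
    by (intro continuous_intros continuous_on_compose2[OF holomorphic_on_imp_continuous_on[OF holomorphic_deriv[OF G_hol open_ball]]])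
      auto
  have "connected ((\<lambda>x::real. Re (deriv G (of_real x))) ` {-1<..<1})"
    by (rule connected_continuous_image[OF cont]) simp
  moreover have "Re (deriv G (of_real x)) \<in> (\<lambda>x::real. Re (deriv G (of_real x))) ` {-1<..<1}"
    by (rule image_eqI[of _ _ x]) (use assms in auto)
  moreover have "Re (deriv G (of_real 0)) \<in> (\<lambda>x::real. Re (deriv G (of_real x))) ` {-1<..<1}"
    by (rule image_eqI[of _ _ 0]) auto
  moreover have "Re (deriv G (of_real 0)) > 0" using G_deriv_0[of 0] phi_deriv_0 by simp
  ultimately have "0 \<in> (\<lambda>x::real. Re (deriv G (of_real x))) ` {-1<..<1}"
    using connectedD_interval[of _ "Re (deriv G (of_real x))" "Re (deriv G (of_real 0))" 0] neg by auto
  then obtain y where y: "-1 < y" "y < 1" "Re (deriv G (of_real y)) = 0" by auto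
  then have "\<bar>y\<bar> < 1" by linarith
  with y show False using G_deriv_nonzero[of "of_real y"] G_deriv_real[of y] by (auto simp: complex_eq_iff)
qed

lemma Re_G_strict_mono: assumes "-1 < x" "x < y" "y < 1"
  shows "Re (G (of_real x)) < Re (G (of_real y))"
  by (rule DERIV_pos_imp_increasing[OF assms(2)])
    (use assms Re_G_has_derivative(1) G_deriv_pos in \<open>force\<close>)

text \<open>The supporting lines of the image of the disc of radius \<open>r\<close> at \<open>G (\<plusminus> r)\<close> are vertical.\<close>

lemma Re_G_bounds:
  assumes "norm z \<le> r" "r < 1"
  shows "Re (G (of_real (- r))) \<le> Re (G z)" "Re (G z) \<le> Re (G (of_real r))"
proof -
  have r: "r \<ge> 0" using assms norm_ge_zero order_trans by blast
  have *: "Re ((G z - G (of_real x)) / (of_real x * deriv G (of_real x))) \<le> 0" if "\<bar>x\<bar> = r" "x \<noteq> 0" for x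
  proof (cases "z = of_real x")
    case False
    have "Re ((G z - G (of_real x)) / (of_real x * deriv G (of_real x))) < 0"
      by (rule support_strict[OF G_hol G_deriv_nonzero _ _ G_separation]) (use that False assms in auto)
    then show ?thesis by simp
  qed simp
  have **: "(Re (G z) - Re (G (of_real x))) * x \<le> 0" if "\<bar>x\<bar> = r" "x \<noteq> 0" for x
  proof -
    have "deriv G (of_real x) = of_real (Re (deriv G (of_real x)))"
      using G_deriv_real[of x] that assms by (simp add: complex_eq_iff)
    moreover define d where "d = Re (deriv G (of_real x))"
    ultimately have d: "deriv G (of_real x) = of_real d" "d > 0"
      using G_deriv_pos[of x] \<open>\<bar>x\<bar> = r\<close> assms(2) by simp_all
    have "Re ((G z - G (of_real x)) / of_real (x * d)) \<le> 0" using *[OF that] d by simp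
    then have "(Re (G z) - Re (G (of_real x))) / (x * d) \<le> 0" by (simp only: Re_divide_of_real minus_complex.simps)
    then have "(Re (G z) - Re (G (of_real x))) / (x * d) * (x * x * d) \<le> 0"
      by (rule mult_nonpos_nonneg) (use d(2) in auto)
    moreover have "A / (x * d) * (x * x * d) = A * x" for A :: real
      using d(2) that(2) by (simp add: field_simps)
    ultimately show ?thesis by metis
  qed
  have "Re (G (of_real (- r))) \<le> Re (G z) \<and> Re (G z) \<le> Re (G (of_real r))"
  proof (cases "r = 0")
    case True then show ?thesis using assms(1) by simp
  next
    case False
    then have "r > 0" using r by simp
    then show ?thesis using **[of "-r"] **[of r] by (simp add: mult_le_0_iff zero_le_mult_iff)
  qed
  then show "Re (G (of_real (- r))) \<le> Re (G z)" "Re (G z) \<le> Re (G (of_real r))" by blast+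
qed

end

section \<open>Subordination to the derivative of K\<close>

context ma_minda_function
begin

text \<open>Jack's lemma. Where \<open>|w(z) / z|\<close> is maximal over a closed disc, \<open>z w'(z) / w(z)\<close> is real and at
  least \<open>1\<close>, and comparing \<open>z P'(z)\<close> with \<open>w G'(w)\<close> there yields
  \<open>\<phi>(\<omega>(z)) - 1 = t (\<phi>(w(z)) - 1)\<close> with \<open>t \<ge> 1\<close>; starlikeness then bounds \<open>|w(z)|\<close> by
  \<open>|\<omega>(z)| \<le> |z|\<close>.\<close>

lemma log_factor_norm_le:
  assumes P: "\<And>z. z \<in> unit_disc \<Longrightarrow> (P has_field_derivative P' z) (at z)" "P 0 = 0"
    and P': "\<And>z. z \<in> unit_disc \<Longrightarrow> z * P' z = \<phi> (\<omega> z) - 1"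
    and \<omega>: "\<omega> holomorphic_on unit_disc" "\<omega> 0 = 0" "\<omega> ` unit_disc \<subseteq> unit_disc"
    and r: "r \<le> 1" and im: "P ` ball 0 r \<subseteq> G ` unit_disc"
  obtains w where "w holomorphic_on ball 0 r" "w 0 = 0" "w ` ball 0 r \<subseteq> unit_disc"
    "\<And>z. z \<in> ball 0 r \<Longrightarrow> P z = G (w z)" "\<And>z. z \<in> ball 0 r \<Longrightarrow> norm (w z) \<le> norm z"
proof -
  have sub: "ball 0 r \<subseteq> unit_disc" using r by auto
  have holP: "P holomorphic_on ball 0 r"
    unfolding holomorphic_on_open[OF open_ball] using P sub by blast
  obtain w where w: "w holomorphic_on ball 0 r" "w 0 = 0" "w ` ball 0 r \<subseteq> unit_disc"
    "\<And>z. z \<in> ball 0 r \<Longrightarrow> P z = G (w z)"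
    by (rule factor_through_univalent[OF G_hol G_inj holP im]) (use P(2) G_0[of 0] in auto)
  obtain \<psi> where \<psi>: "\<psi> holomorphic_on ball 0 r" "\<And>z. norm z < r \<Longrightarrow> w z = z * \<psi> z"
    by (rule Schwarz3[OF w(1,2)]) blast
  have "norm (w z) \<le> norm z" if z: "z \<in> ball 0 r" for z
  proof -
    have "norm z < r" using z by simp
    then obtain \<rho> where \<rho>: "norm z < \<rho>" "\<rho> < r" using dense by blast
    have \<rho>0: "\<rho> > 0" using \<rho>(1) by (meson norm_ge_zero order.strict_trans1)
    have sub\<rho>: "cball 0 \<rho> \<subseteq> ball 0 r" using \<rho> by auto
    have cont: "continuous_on (cball 0 \<rho>) \<psi>"
      by (intro holomorphic_on_imp_continuous_on holomorphic_on_subset[OF \<psi>(1)] sub\<rho>)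
    have "continuous_on (sphere 0 \<rho>) (\<lambda>z. norm (\<psi> z))"
      by (intro continuous_intros continuous_on_subset[OF cont]) auto
    moreover have "sphere (0::complex) \<rho> \<noteq> {}" using \<rho>0 by (simp add: sphere_eq_empty)
    ultimately obtain s where s: "norm s = \<rho>" "\<And>u. norm u = \<rho> \<Longrightarrow> norm (\<psi> u) \<le> norm (\<psi> s)"
      using continuous_attains_sup[of "sphere 0 \<rho>" "\<lambda>z. norm (\<psi> z)"] by auto
    have max: "norm (\<psi> u) \<le> norm (\<psi> s)" if "norm u \<le> \<rho>" for u
      by (rule maximum_modulus_frontier[of \<psi> "cball 0 \<rho>"])
        (use \<rho>0 that s cont in \<open>auto intro!: holomorphic_on_subset[OF \<psi>(1)] subsetD[OF sub\<rho>]\<close>)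
    have "norm (\<psi> s) \<le> 1"
    proof (rule ccontr)
      assume "\<not> norm (\<psi> s) \<le> 1"
      define c where "c = \<psi> s"
      have c: "c \<noteq> 0" "norm c > 1" using \<open>\<not> norm (\<psi> s) \<le> 1\<close> by (auto simp: c_def)
      have sr: "s \<in> ball 0 r" using s \<rho> by simp
      have sD: "s \<in> unit_disc" using sr sub by blast
      have d\<psi>: "(\<psi> has_field_derivative deriv \<psi> s) (at s)"
        by (rule holomorphic_derivI[OF \<psi>(1) open_ball sr])
      have maxc: "Re (\<psi> u / c) \<le> Re (\<psi> s / c)" if "norm u \<le> \<rho>" for u
      proof -
        have "norm (\<psi> u / c) \<le> 1" using max[OF that] c by (simp add: c_def norm_divide)
        then have "Re (\<psi> u / c) \<le> 1" using complex_Re_le_cmod order_trans by blast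
        then show ?thesis using c(1) by (simp add: c_def)
      qed
      obtain m where m: "m \<ge> 0" "s * (deriv \<psi> s / c) = of_real m"
        using Re_max_boundary[OF DERIV_cdivide[OF d\<psi>, of c] s(1) maxc] by blast
      have "((\<lambda>z. z * \<psi> z) has_field_derivative 1 * \<psi> s + deriv \<psi> s * s) (at s)"
        by (rule DERIV_mult[OF DERIV_ident d\<psi>])
      then have dw: "(w has_field_derivative (1 + of_real m) * c) (at s)"
        by (rule has_field_derivative_transform_within_open[OF _ open_ball sr, THEN DERIV_cong])
          (use m c \<psi>(2) in \<open>auto simp: c_def field_simps\<close>)
      have wD: "w s \<in> unit_disc" using w(3) sr by blast
      have "((\<lambda>z. G (w z)) has_field_derivative deriv G (w s) * ((1 + of_real m) * c)) (at s)"
        by (rule DERIV_chain2[OF G_deriv[OF wD] dw])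
      then have "(P has_field_derivative deriv G (w s) * ((1 + of_real m) * c)) (at s)"
        by (rule has_field_derivative_transform_within_open[OF _ open_ball sr]) (use w(4) in auto)
      then have "P' s = deriv G (w s) * ((1 + of_real m) * c)"
        using P(1)[OF sD] DERIV_unique by blast
      then have "\<phi> (\<omega> s) - 1 = (1 + of_real m) * (w s * deriv G (w s))"
        using P'[OF sD] \<psi>(2)[of s] sr by (simp add: c_def mult_ac)
      also have "w s * deriv G (w s) = \<phi> (w s) - 1" by (rule G_deriv_eq[OF wD])
      finally have eq: "\<phi> (\<omega> s) - 1 = (1 + of_real m) * (\<phi> (w s) - 1)" .
      have "1 + complex_of_real m \<noteq> 0" using m(1) by (simp add: complex_eq_iff)
      then have "\<phi> (w s) - 1 = of_real (1 / (1 + m)) * (\<phi> (\<omega> s) - 1)"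
        using eq by simp
      then have "norm (w s) \<le> norm (\<omega> s)"
        by (rule phi_minus_1_starlike(1)[rotated 4]) (use m(1) wD subsetD[OF \<omega>(3) imageI[OF sD]] in simp_all)
      also have "\<dots> \<le> norm s" by (rule Schwarz_le[OF \<omega> sD])
      finally have "\<rho> * norm c \<le> \<rho> * 1" using \<psi>(2)[of s] s \<rho> by (simp add: norm_mult c_def)
      then show False using \<rho>0 c(2) by simp
    qed
    then have "norm (\<psi> z) \<le> 1" using max[of z] \<rho>(1) by simp
    then show ?thesis using \<psi>(2)[of z] z by (simp add: norm_mult mult_left_le)
  qed
  then show ?thesis using that w by blast
qed

text \<open>If \<open>z P'(z)\<close> is subordinate to \<open>z G'(z)\<close>, then \<open>P\<close> is subordinate to \<open>G\<close>. The lemma before shows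
  that \<open>P\<close> cannot leave the image of \<open>G\<close> at a radius less than \<open>1\<close>: as long as it stays inside,
  \<open>P\<close> maps the disc of radius \<open>r\<close> into the image under \<open>G\<close> of the same disc.\<close>

lemma log_subordinate:
  assumes P: "\<And>z. z \<in> unit_disc \<Longrightarrow> (P has_field_derivative P' z) (at z)" "P 0 = 0"
    and P': "\<And>z. z \<in> unit_disc \<Longrightarrow> z * P' z = \<phi> (\<omega> z) - 1"
    and \<omega>: "\<omega> holomorphic_on unit_disc" "\<omega> 0 = 0" "\<omega> ` unit_disc \<subseteq> unit_disc"
  obtains w where "w holomorphic_on unit_disc" "w 0 = 0" "w ` unit_disc \<subseteq> unit_disc"
    "\<And>z. z \<in> unit_disc \<Longrightarrow> P z = G (w z)" "\<And>z. z \<in> unit_disc \<Longrightarrow> norm (w z) \<le> norm z"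
proof -
  define A where "A = {r. 0 < r \<and> r \<le> 1 \<and> P ` ball 0 r \<subseteq> G ` unit_disc}"
  have contP: "continuous_on unit_disc P"
    by (meson P(1) DERIV_isCont continuous_at_imp_continuous_on)
  define U where "U = unit_disc \<inter> P -` (G ` unit_disc)"
  have opG: "open (G ` unit_disc)" by (rule open_mapping_thm3[OF G_hol open_ball G_inj])
  have opU: "open U" unfolding U_def by (rule continuous_open_preimage[OF contP open_ball opG])
  have "P 0 \<in> G ` unit_disc" using P(2) G_0[of 0] by (intro image_eqI[of _ _ 0]) auto
  then have "0 \<in> U" by (simp add: U_def)
  then obtain d where d: "d > 0" "ball 0 d \<subseteq> U" using opU openE by blast
  have "min d 1 \<in> A" using d by (auto simp: A_def U_def)
  then have ne: "A \<noteq> {}" by blast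
  have bdd: "bdd_above A" by (auto simp: A_def bdd_above_def)
  \<comment> \<open>The largest radius up to which \<open>P\<close> stays inside the image of \<open>G\<close>.\<close>
  define r0 where "r0 = Sup A"
  have r0: "0 < r0" "r0 \<le> 1"
    using cSup_upper[OF \<open>min d 1 \<in> A\<close> bdd] d ne by (auto simp: r0_def A_def intro!: cSup_least)
  have imr0: "P ` ball 0 r0 \<subseteq> G ` unit_disc"
  proof safe
    fix z :: complex assume "z \<in> ball 0 r0"
    then obtain r where "r \<in> A" "norm z < r" using less_cSup_iff[OF ne bdd] by (auto simp: r0_def)
    then show "P z \<in> G ` unit_disc" by (auto simp: A_def)
  qed
  have "r0 = 1"
  proof (rule ccontr)
    assume "r0 \<noteq> 1"
    then have r01: "r0 < 1" using r0 by simp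
    obtain w where w: "\<And>z. z \<in> ball 0 r0 \<Longrightarrow> P z = G (w z)" "\<And>z. z \<in> ball 0 r0 \<Longrightarrow> norm (w z) \<le> norm z"
      by (rule log_factor_norm_le[OF P P' \<omega> r0(2) imr0]) blast+
    have "P ` ball 0 r0 \<subseteq> G ` cball 0 r0" using w by fastforce
    moreover have "closed (G ` cball 0 r0)"
      by (intro compact_imp_closed compact_continuous_image holomorphic_on_imp_continuous_on
          holomorphic_on_subset[OF G_hol]) (use r01 in auto)
    moreover have "continuous_on (closure (ball 0 r0)) P"
      by (rule continuous_on_subset[OF contP]) (use r0 r01 in auto)
    ultimately have "P ` closure (ball 0 r0) \<subseteq> G ` cball 0 r0" by (intro image_closure_subset)
    then have "P ` cball 0 r0 \<subseteq> G ` cball 0 r0" using r0 by simp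
    moreover have "G ` cball 0 r0 \<subseteq> G ` unit_disc" using r01 by (intro image_mono) auto
    ultimately have "cball 0 r0 \<subseteq> U" using r01 by (auto simp: U_def)
    then obtain e where e: "e > 0" "(\<Union>x\<in>cball 0 r0. ball x e) \<subseteq> U"
      using compact_subset_open_imp_ball_epsilon_subset[OF compact_cball opU] by blast
    define r1 where "r1 = min 1 (r0 + e)"
    have "P ` ball 0 r1 \<subseteq> G ` unit_disc"
    proof safe
      fix z :: complex assume z: "z \<in> ball 0 r1"
      have "z \<in> U"
      proof (cases "norm z \<le> r0")
        case True then show ?thesis using e by (meson UN_I centre_in_ball mem_cball_0 subsetD)
      next
        case False
        define x where "x = of_real (r0 / norm z) * z"
        have z0: "norm z > 0" using False r0 by linarith
        have nx: "norm x = r0" using z0 r0 by (simp add: x_def norm_mult norm_divide)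
        have "x - z = of_real (r0 / norm z - 1) * z" by (simp add: x_def algebra_simps)
        then have "norm (x - z) = \<bar>r0 / norm z - 1\<bar> * norm z" by (metis norm_mult norm_of_real)
        moreover have "\<bar>r0 / norm z - 1\<bar> = 1 - r0 / norm z" using z0 False by (simp add: abs_if)
        ultimately have "norm (x - z) = norm z - r0" using z0 by (simp add: left_diff_distrib)
        then have "dist x z < e" using z by (simp add: dist_norm r1_def)
        then have "z \<in> ball x e" "x \<in> cball 0 r0" using nx by auto
        then show ?thesis using e(2) by blast
      qed
      then show "P z \<in> G ` unit_disc" by (simp add: U_def)
    qed
    moreover have "0 < r1" "r1 \<le> 1" using r0 e by (auto simp: r1_def)
    ultimately have "r1 \<in> A" by (simp add: A_def)
    then have "r1 \<le> r0" using bdd by (simp add: r0_def cSup_upper)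
    then show False using r01 e by (simp add: r1_def)
  qed
  show ?thesis
    by (rule log_factor_norm_le[OF P P' \<omega> r0(2) imr0]) (use \<open>r0 = 1\<close> that in auto)
qed

end

section \<open>Bohr's inequality for subordinate functions\<close>

lemma taylor_sums:
  assumes "F holomorphic_on unit_disc" "z \<in> unit_disc"
  shows "(\<lambda>k. taylor_coeff F k * z ^ k) sums F z"
  using holomorphic_power_series[OF assms] by (simp add: taylor_coeff_def)

lemma taylor_abs_summable:
  assumes "F holomorphic_on unit_disc" "\<bar>r\<bar> < 1"
  shows "summable (\<lambda>k. norm (taylor_coeff F k) * r ^ k)"
proof -
  obtain s where s: "\<bar>r\<bar> < s" "s < 1" using dense assms(2) by blast
  then have "summable (\<lambda>k. taylor_coeff F k * of_real s ^ k)"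
    using taylor_sums[OF assms(1), of "of_real s"] by (auto simp: sums_iff)
  from powser_insidea[OF this, of "of_real r"] s
  have "summable (\<lambda>k. norm (taylor_coeff F k) * \<bar>r\<bar> ^ k)"
    by (simp add: norm_mult norm_power)
  then have "summable (\<lambda>k. norm (norm (taylor_coeff F k) * r ^ k))"
    by (simp add: abs_mult power_abs)
  then show ?thesis by (rule summable_norm_cancel)
qed

lemma has_fps_expansion_taylor:
  assumes "F holomorphic_on unit_disc"
  shows "F has_fps_expansion Abs_fps (taylor_coeff F)"
  using has_fps_expansion_fps_expansion[OF open_ball _ assms]
  by (simp add: fps_expansion_def taylor_coeff_def[abs_def])

lemma taylor_coeff_fps:
  "F has_fps_expansion A \<Longrightarrow> taylor_coeff F k = fps_nth A k"
  by (simp add: fps_nth_fps_expansion taylor_coeff_def)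

text \<open>Adding to Cauchy's formula for the coefficient the vanishing integral of \<open>cnj p / u\<^sup>k\<close> turns
  \<open>p\<close> into \<open>2 Re p\<close>, which is nonnegative.\<close>

lemma caratheodory_coeff_bound:
  assumes hol: "p holomorphic_on unit_disc" and pos: "\<And>z. z \<in> unit_disc \<Longrightarrow> 0 \<le> Re (p z)" and k: "k \<ge> 1"
  shows "norm (taylor_coeff p k) \<le> 2 * Re (p 0)"
proof -
  have bound: "norm (taylor_coeff p k) * r ^ k \<le> 2 * Re (p 0)" if r: "0 < r" "r < 1" for r
  proof -
    define \<gamma> where "\<gamma> t = of_real r * exp (2 * of_real pi * \<i> * of_real t)" for t :: real
    have \<gamma>: "circlepath 0 r = \<gamma>" by (auto simp: circlepath \<gamma>_def fun_eq_iff)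
    have norm_\<gamma>: "norm (\<gamma> t) = r" for t using r by (simp add: \<gamma>_def norm_mult)
    have \<gamma>0: "\<gamma> t \<noteq> 0" for t using norm_\<gamma>[of t] r by auto
    have hci: "((\<lambda>t. f (\<gamma> t) * (2 * of_real pi * \<i> * \<gamma> t)) has_integral I) {0..1}"
      if "(f has_contour_integral I) (circlepath 0 r)" for f I
    proof (rule has_integral_eq[rotated])
      show "((\<lambda>t. f (\<gamma> t) * vector_derivative \<gamma> (at t within {0..1})) has_integral I) {0..1}"
        using that by (simp add: has_contour_integral_def \<gamma>)
      fix t :: real assume "t \<in> {0..1}"
      then have "vector_derivative \<gamma> (at t within {0..1}) = 2 * of_real pi * \<i> * \<gamma> t"
        using vector_derivative_circlepath01[of t 0 r] by (simp add: \<gamma>) (simp add: \<gamma>_def mult_ac)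
      then show "f (\<gamma> t) * vector_derivative \<gamma> (at t within {0..1}) = f (\<gamma> t) * (2 * of_real pi * \<i> * \<gamma> t)" by simp
    qed
    have cont: "continuous_on (cball 0 r) p"
      by (intro holomorphic_on_imp_continuous_on holomorphic_on_subset[OF hol]) (use r in auto)
    have holr: "p holomorphic_on ball 0 r" by (rule holomorphic_on_subset[OF hol]) (use r in auto)
    have coeff: "((\<lambda>t. p (\<gamma> t) / \<gamma> t ^ j) has_integral taylor_coeff p j) {0..1}" for j
    proof -
      have "((\<lambda>u. p u / (u - 0) ^ Suc j) has_contour_integral (2 * pi * \<i>) / fact j * (deriv ^^ j) p 0) (circlepath 0 r)"
        by (rule Cauchy_has_contour_integral_higher_derivative_circlepath[OF cont holr]) (use r in auto)
      from has_integral_mult_left[OF hci[OF this], of "1 / (2 * of_real pi * \<i>)"]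
      show ?thesis using \<gamma>0 by (simp add: taylor_coeff_def field_simps)
    qed
    have zero: "((\<lambda>t. cnj (p (\<gamma> t)) / \<gamma> t ^ k) has_integral 0) {0..1}"
    proof -
      have "((\<lambda>u. p u * u ^ (k - 1)) has_contour_integral 0) (circlepath 0 r)"
        by (rule Cauchy_theorem_disc_simple[of _ 0 1])
          (use r in \<open>auto intro!: holomorphic_intros hol\<close>)
      note has_integral_mult_left[OF hci[OF this], of "1 / (2 * of_real pi * \<i>)"]
      moreover have "(\<lambda>t. p (\<gamma> t) * \<gamma> t ^ (k - 1) * (2 * of_real pi * \<i> * \<gamma> t) * (1 / (2 * of_real pi * \<i>)))
          = (\<lambda>t. p (\<gamma> t) * \<gamma> t ^ (k - 1) * \<gamma> t)" (is "?l = ?r")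
      proof (rule ext)
        fix t
        have "2 * of_real pi * \<i> * \<gamma> t * (1 / (2 * of_real pi * \<i>)) = \<gamma> t" by simp
        then show "?l t = ?r t" by (metis mult.assoc)
      qed
      ultimately have "((\<lambda>t. p (\<gamma> t) * \<gamma> t ^ (k - 1) * \<gamma> t) has_integral 0) {0..1}"
        by (simp only: mult_zero_left)
      moreover have "(\<lambda>t. p (\<gamma> t) * \<gamma> t ^ (k - 1) * \<gamma> t) = (\<lambda>t. p (\<gamma> t) * \<gamma> t ^ k)"
        using k by (cases k) (auto simp: mult_ac)
      ultimately have "((\<lambda>t. p (\<gamma> t) * \<gamma> t ^ k) has_integral 0) {0..1}" by (simp only:)
      from has_integral_linear[OF this bounded_linear_cnj]
      have "((\<lambda>t. cnj (p (\<gamma> t) * \<gamma> t ^ k)) has_integral cnj 0) {0..1}"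
        by (simp only: o_def)
      from has_integral_mult_left[OF this, of "1 / of_real (r ^ 2) ^ k"]
      have "((\<lambda>t. cnj (p (\<gamma> t) * \<gamma> t ^ k) * (1 / of_real (r ^ 2) ^ k)) has_integral 0) {0..1}" by simp
      moreover have "cnj (p (\<gamma> t) * \<gamma> t ^ k) * (1 / of_real (r ^ 2) ^ k) = cnj (p (\<gamma> t)) / \<gamma> t ^ k" for t
      proof -
        have eq: "complex_of_real (r ^ 2) = \<gamma> t * cnj (\<gamma> t)"
          using complex_norm_square[of "\<gamma> t"] norm_\<gamma>[of t] by simp
        show ?thesis unfolding eq using \<gamma>0[of t] by (simp add: power_mult_distrib)
      qed
      ultimately show ?thesis by (simp only:)
    qed
    have int: "((\<lambda>t. of_real (2 * Re (p (\<gamma> t))) / \<gamma> t ^ k) has_integral taylor_coeff p k) {0..1}"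
    proof -
      have "p (\<gamma> t) / \<gamma> t ^ k + cnj (p (\<gamma> t)) / \<gamma> t ^ k = of_real (2 * Re (p (\<gamma> t))) / \<gamma> t ^ k" for t
        by (metis add_divide_distrib complex_add_cnj)
      then show ?thesis using has_integral_add[OF coeff[of k] zero] by (simp only: add_0_right)
    qed
    have "((\<lambda>t. p (\<gamma> t)) has_integral p 0) {0..1}"
      using coeff[of 0] by (simp add: taylor_coeff_def)
    from has_integral_linear[OF this bounded_linear_Re]
    have "((\<lambda>t. Re (p (\<gamma> t))) has_integral Re (p 0)) {0..1}"
      by (simp only: o_def)
    from has_integral_mult_left[OF this, of "2 / r ^ k"]
    have int2: "((\<lambda>t. 2 * Re (p (\<gamma> t)) / r ^ k) has_integral 2 * Re (p 0) / r ^ k) {0..1}"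
      by (simp add: mult_ac)
    have "norm (integral {0..1} (\<lambda>t. of_real (2 * Re (p (\<gamma> t))) / \<gamma> t ^ k)) \<le> integral {0..1} (\<lambda>t. 2 * Re (p (\<gamma> t)) / r ^ k)"
    proof (rule integral_norm_bound_integral)
      fix t
      have "0 \<le> Re (p (\<gamma> t))" using pos[of "\<gamma> t"] norm_\<gamma>[of t] r by simp
      then show "norm (of_real (2 * Re (p (\<gamma> t))) / \<gamma> t ^ k) \<le> 2 * Re (p (\<gamma> t)) / r ^ k"
        by (simp add: norm_divide norm_power norm_\<gamma>)
    qed (use int int2 in \<open>auto simp: has_integral_integrable\<close>)
    then have "norm (taylor_coeff p k) \<le> 2 * Re (p 0) / r ^ k"
      by (simp only: integral_unique[OF int] integral_unique[OF int2])
    then show ?thesis using r by (simp add: field_simps)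
  qed
  show ?thesis
  proof (rule tendsto_upperbound)
    show "((\<lambda>r. norm (taylor_coeff p k) * r ^ k) \<longlongrightarrow> norm (taylor_coeff p k)) (at_left 1)"
      by (rule tendsto_eq_intros refl | simp)+
    have "eventually (\<lambda>r::real. r \<in> {0<..<1}) (at_left 1)"
      by (rule eventually_at_left_real) simp
    then show "eventually (\<lambda>r. norm (taylor_coeff p k) * r ^ k \<le> 2 * Re (p 0)) (at_left 1)"
      by eventually_elim (use bound in auto)
  qed simp
qed

lemma bounded_coeff_bound:
  assumes hol: "\<psi> holomorphic_on unit_disc" and le: "\<And>z. z \<in> unit_disc \<Longrightarrow> norm (\<psi> z) \<le> 1" and k: "k \<ge> 1"
  shows "norm (taylor_coeff \<psi> k) \<le> 2 * (1 - norm (\<psi> 0))"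
proof -
  \<comment> \<open>The rotation that makes \<open>e * \<psi> 0\<close> real and nonnegative; then \<open>1 - e * \<psi> z\<close> has nonnegative real part.\<close>
  define e where "e = (if \<psi> 0 = 0 then 1 else cnj (sgn (\<psi> 0)))"
  have e: "norm e = 1" "e * \<psi> 0 = of_real (norm (\<psi> 0))"
  proof -
    have "cnj (sgn (\<psi> 0)) * \<psi> 0 = of_real (norm (\<psi> 0))" if "\<psi> 0 \<noteq> 0"
    proof -
      have "cnj (\<psi> 0) * \<psi> 0 = of_real (norm (\<psi> 0)) * of_real (norm (\<psi> 0))"
        using complex_norm_square[of "\<psi> 0"] by (simp add: power2_eq_square mult.commute)
      then show ?thesis using that by (simp add: sgn_eq)
    qed
    then show "norm e = 1" "e * \<psi> 0 = of_real (norm (\<psi> 0))"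
      by (auto simp: e_def norm_sgn)
  qed
  define p where "p z = 1 - e * \<psi> z" for z
  have "norm (taylor_coeff p k) \<le> 2 * Re (p 0)"
  proof (rule caratheodory_coeff_bound[OF _ _ k])
    show "p holomorphic_on unit_disc" unfolding p_def by (intro holomorphic_intros hol)
    fix z :: complex assume "z \<in> unit_disc"
    then have "norm (e * \<psi> z) \<le> 1" using e le by (simp add: norm_mult)
    then show "0 \<le> Re (p z)" using complex_Re_le_cmod[of "e * \<psi> z"] by (simp add: p_def)
  qed
  moreover have "taylor_coeff p k = - e * taylor_coeff \<psi> k"
  proof -
    have "p has_fps_expansion (1 - fps_const e * Abs_fps (taylor_coeff \<psi>))"
      unfolding p_def by (intro fps_expansion_intros has_fps_expansion_taylor hol)
    from taylor_coeff_fps[OF this] show ?thesis using k by simp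
  qed
  moreover have "Re (p 0) = 1 - norm (\<psi> 0)" using e(2) by (simp add: p_def)
  ultimately show ?thesis using e by (simp add: norm_mult)
qed

text \<open>Bohr's inequality for \<open>\<psi>(z) = \<omega>(z) / z\<close>: with \<open>b = |\<psi>(0)|\<close> the series is at most
  \<open>b + 2 (1 - b) (1/3 + 1/9 + \<dots>) = 1\<close> for \<open>r = 1/3\<close>.\<close>

lemma bohr_schwarz:
  assumes hol: "\<omega> holomorphic_on unit_disc" "\<omega> 0 = 0" "\<omega> ` unit_disc \<subseteq> unit_disc"
    and r: "0 \<le> r" "r \<le> 1 / 3"
  shows "(\<Sum>k\<le>M. norm (taylor_coeff \<omega> k) * r ^ k) \<le> r"
proof -
  obtain \<psi> where \<psi>: "\<psi> holomorphic_on unit_disc" "\<And>z. norm z < 1 \<Longrightarrow> \<omega> z = z * \<psi> z"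
    by (rule Schwarz3[OF hol(1,2)]) blast
  have le: "norm (\<psi> z) \<le> 1" if "z \<in> unit_disc" for z
  proof -
    have nz: "norm (\<psi> z) \<le> 1" if "z \<in> unit_disc" "z \<noteq> 0" for z
      using Schwarz_le[OF hol that(1)] \<psi>(2)[of z] that by (simp add: norm_mult)
    have "(\<psi> \<longlongrightarrow> \<psi> z) (at z)"
      using holomorphic_on_imp_continuous_on[OF \<psi>(1)] that by (simp add: continuous_on_eq_continuous_at isCont_def)
    then have "((\<lambda>z. norm (\<psi> z)) \<longlongrightarrow> norm (\<psi> z)) (at z)" by (rule tendsto_norm)
    moreover have "eventually (\<lambda>z. z \<in> unit_disc - {0}) (at z)"
    proof (cases "z = 0")
      case True
      then show ?thesis using eventually_at_in_open[of unit_disc z] that by simp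
    next
      case False
      then show ?thesis using that by (intro eventually_at_in_open') auto
    qed
    then have "eventually (\<lambda>z. norm (\<psi> z) \<le> 1) (at z)" by eventually_elim (use nz in auto)
    ultimately show ?thesis by (rule tendsto_upperbound) simp
  qed
  have \<omega>\<psi>: "\<omega> has_fps_expansion fps_X * Abs_fps (taylor_coeff \<psi>)"
  proof -
    have "(\<lambda>z. z * \<psi> z) has_fps_expansion fps_X * Abs_fps (taylor_coeff \<psi>)"
      by (intro fps_expansion_intros has_fps_expansion_taylor \<psi>)
    moreover have "eventually (\<lambda>z::complex. z \<in> unit_disc) (nhds 0)"
      by (rule eventually_nhds_in_open) auto
    then have "eventually (\<lambda>z. \<omega> z = z * \<psi> z) (nhds 0)" by eventually_elim (use \<psi>(2) in auto)
    ultimately show ?thesis using has_fps_expansion_cong[of \<omega> "\<lambda>z. z * \<psi> z", OF _ refl] by blast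
  qed
  have coeff: "taylor_coeff \<omega> 0 = 0" "taylor_coeff \<omega> (Suc k) = taylor_coeff \<psi> k" for k
    unfolding taylor_coeff_fps[OF \<omega>\<psi>] by simp_all
  define b where "b = norm (\<psi> 0)"
  have b: "b \<le> 1" using le[of 0] by (simp add: b_def)
  have geo: "(\<Sum>k<m. norm (taylor_coeff \<psi> k) * r ^ k) \<le> b + (1 - b) * (1 - 1 / 3 ^ (m - 1))" if "m > 0" for m
    using that
  proof (induction m rule: nat_induct_non_zero)
    case 1 then show ?case by (simp add: b_def taylor_coeff_def)
  next
    case (Suc m)
    have "norm (taylor_coeff \<psi> m) * r ^ m \<le> (2 * (1 - b)) * (1 / 3) ^ m"
      unfolding b_def using Suc.hyps r
      by (intro mult_mono bounded_coeff_bound[OF \<psi>(1) le] power_mono) (use b in \<open>auto simp: b_def\<close>)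
    also have "\<dots> = (1 - b) * (1 - 1 / 3 ^ (Suc m - 1)) - (1 - b) * (1 - 1 / 3 ^ (m - 1))"
    proof -
      obtain l where l: "m = Suc l" using Suc.hyps by (cases m) auto
      have X: "2 * (1 / 3) ^ Suc l = (1 - 1 / 3 ^ Suc l) - (1 - 1 / 3 ^ l :: real)"
        by (simp add: power_one_over)
      have "(2 * (1 - b)) * (1 / 3) ^ Suc l = (1 - b) * (2 * (1 / 3) ^ Suc l)" by simp
      also have "\<dots> = (1 - b) * (1 - 1 / 3 ^ Suc l) - (1 - b) * (1 - 1 / 3 ^ l)"
        unfolding X by (rule right_diff_distrib)
      finally show ?thesis using l by simp
    qed
    finally show ?case using Suc.IH by simp
  qed
  have geo': "(\<Sum>k<m. norm (taylor_coeff \<psi> k) * r ^ k) \<le> 1" for m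
  proof (cases "m = 0")
    case False
    have "(1 - b) * (1 - 1 / 3 ^ (m - 1)) \<le> (1 - b) * 1" by (rule mult_left_mono) (use b in auto)
    then show ?thesis using geo[of m] False by simp
  qed simp
  have "(\<Sum>k\<le>M. norm (taylor_coeff \<omega> k) * r ^ k) = r * (\<Sum>k<M. norm (taylor_coeff \<psi> k) * r ^ k)"
    by (subst sum.atMost_shift) (simp add: coeff sum_distrib_left mult_ac)
  also have "\<dots> \<le> r * 1" by (rule mult_left_mono[OF geo' r(1)])
  finally show ?thesis by simp
qed

text \<open>Partial sums of the majorant series are submultiplicative.\<close>

lemma majorant_partial_mult:
  fixes A B :: "complex fps"
  assumes "0 \<le> r"
  shows "(\<Sum>k\<le>M. norm (fps_nth (A * B) k) * r ^ k)
    \<le> (\<Sum>k\<le>M. norm (fps_nth A k) * r ^ k) * (\<Sum>k\<le>M. norm (fps_nth B k) * r ^ k)"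
proof -
  define a where "a k = norm (fps_nth A k) * r ^ k" for k
  define b where "b k = norm (fps_nth B k) * r ^ k" for k
  have nn: "a k \<ge> 0" "b k \<ge> 0" for k using assms by (auto simp: a_def b_def)
  have "(\<Sum>k\<le>M. norm (fps_nth (A * B) k) * r ^ k) \<le> (\<Sum>k\<le>M. \<Sum>i\<le>k. a i * b (k - i))"
  proof (rule sum_mono)
    fix k
    have "norm (fps_nth (A * B) k) \<le> (\<Sum>i\<le>k. norm (fps_nth A i * fps_nth B (k - i)))"
      unfolding fps_mult_nth atLeast0AtMost by (rule norm_sum)
    then have "norm (fps_nth (A * B) k) * r ^ k \<le> (\<Sum>i\<le>k. norm (fps_nth A i * fps_nth B (k - i))) * r ^ k"
      by (rule mult_right_mono) (use assms in simp)
    also have "\<dots> = (\<Sum>i\<le>k. a i * b (k - i))"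
      unfolding sum_distrib_right
    proof (rule sum.cong[OF refl])
      fix i assume "i \<in> {..k}"
      then have "r ^ k = r ^ i * r ^ (k - i)" by (simp flip: power_add)
      then show "norm (fps_nth A i * fps_nth B (k - i)) * r ^ k = a i * b (k - i)"
        by (simp add: a_def b_def norm_mult)
    qed
    finally show "norm (fps_nth (A * B) k) * r ^ k \<le> (\<Sum>i\<le>k. a i * b (k - i))" .
  qed
  also have "\<dots> = (\<Sum>(i,j)\<in>{(i,j). i + j \<le> M}. a i * b j)"
    by (rule sum.triangle_reindex_eq[symmetric])
  also have "\<dots> \<le> (\<Sum>(i,j)\<in>{..M} \<times> {..M}. a i * b j)"
    by (rule sum_mono2) (use nn in auto)
  also have "\<dots> = (\<Sum>k\<le>M. a k) * (\<Sum>k\<le>M. b k)"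
    by (simp add: sum_product sum.cartesian_product)
  finally show ?thesis by (simp add: a_def b_def)
qed

lemma majorant_partial_power:
  fixes A :: "complex fps"
  assumes "0 \<le> r"
  shows "(\<Sum>k\<le>M. norm (fps_nth (A ^ i) k) * r ^ k) \<le> (\<Sum>k\<le>M. norm (fps_nth A k) * r ^ k) ^ i"
proof (induction i)
  case 0
  have "(\<Sum>k\<le>M. norm (fps_nth (1::complex fps) k) * r ^ k) = (\<Sum>k\<le>M. if k = 0 then 1 else 0)"
    by (rule sum.cong) auto
  then show ?case by simp
next
  case (Suc i)
  have "(\<Sum>k\<le>M. norm (fps_nth A k) * r ^ k) \<ge> 0" using assms by (intro sum_nonneg) auto
  then show ?case
    using majorant_partial_mult[OF assms, of A "A ^ i" M] mult_left_mono[OF Suc.IH] by fastforce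
qed

lemma taylor_split:
  assumes hol: "Q holomorphic_on unit_disc"
  obtains R where "R holomorphic_on unit_disc"
    "\<And>z. z \<in> unit_disc \<Longrightarrow> Q z = (\<Sum>i\<le>N. taylor_coeff Q i * z ^ i) + z ^ Suc N * R z"
proof -
  define R where "R z = (\<Sum>k. taylor_coeff Q (k + Suc N) * z ^ k)" for z
  have shift: "(\<lambda>k. taylor_coeff Q (k + Suc N) * z ^ (k + Suc N)) sums (Q z - (\<Sum>i\<le>N. taylor_coeff Q i * z ^ i))"
    if "z \<in> unit_disc" for z
    using sums_split_initial_segment[OF taylor_sums[OF hol that], of "Suc N"] by (simp add: lessThan_Suc_atMost)
  have sums: "(\<lambda>k. taylor_coeff Q (k + Suc N) * z ^ k) sums R z" if "z \<in> unit_disc" for z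
  proof (cases "z = 0")
    case True
    then show ?thesis unfolding R_def by (intro summable_sums) (simp add: summable_0_powser)
  next
    case False
    have "summable (\<lambda>k. taylor_coeff Q (k + Suc N) * z ^ (k + Suc N) * (1 / z ^ Suc N))"
      by (intro summable_mult2 sums_summable[OF shift[OF that]])
    then have "summable (\<lambda>k. taylor_coeff Q (k + Suc N) * z ^ k)"
      using False by (simp add: power_add field_simps)
    then show ?thesis unfolding R_def by (rule summable_sums)
  qed
  show ?thesis
  proof (rule that[of R])
    show "R holomorphic_on unit_disc"
      by (rule power_series_holomorphic[of 0 1 "\<lambda>k. taylor_coeff Q (k + Suc N)"]) (use sums in auto)
    fix z :: complex assume z: "z \<in> unit_disc"
    have "(\<lambda>k. taylor_coeff Q (k + Suc N) * z ^ (k + Suc N)) sums (R z * z ^ Suc N)"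
      using sums_mult2[OF sums[OF z], of "z ^ Suc N"] by (simp add: power_add mult_ac)
    from sums_unique2[OF this shift[OF z]]
    show "Q z = (\<Sum>i\<le>N. taylor_coeff Q i * z ^ i) + z ^ Suc N * R z" by (simp add: algebra_simps)
  qed
qed

text \<open>As \<open>\<omega> 0 = 0\<close>, only the first \<open>N + 1\<close> terms of the expansion of \<open>Q\<close> contribute.\<close>

lemma taylor_coeff_compose:
  assumes holQ: "Q holomorphic_on unit_disc" and \<omega>: "\<omega> holomorphic_on unit_disc" "\<omega> 0 = 0" "\<omega> ` unit_disc \<subseteq> unit_disc"
    and F: "\<And>z. z \<in> unit_disc \<Longrightarrow> F z = Q (\<omega> z)"
  shows "taylor_coeff F N = (\<Sum>i\<le>N. taylor_coeff Q i * fps_nth (Abs_fps (taylor_coeff \<omega>) ^ i) N)"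
proof -
  obtain R where R: "R holomorphic_on unit_disc"
    "\<And>z. z \<in> unit_disc \<Longrightarrow> Q z = (\<Sum>i\<le>N. taylor_coeff Q i * z ^ i) + z ^ Suc N * R z"
    using taylor_split[OF holQ] by metis
  define W where "W = Abs_fps (taylor_coeff \<omega>)"
  have W: "\<omega> has_fps_expansion W" unfolding W_def by (rule has_fps_expansion_taylor[OF \<omega>(1)])
  have W0: "fps_nth W 0 = 0" using \<omega>(2) by (simp add: W_def taylor_coeff_def)
  have "(\<lambda>z. R (\<omega> z)) holomorphic_on unit_disc"
    using holomorphic_on_compose_gen[OF \<omega>(1) R(1) \<omega>(3)] by (simp add: o_def)
  note RR = has_fps_expansion_taylor[OF this]
  let ?S = "(\<Sum>i\<le>N. fps_const (taylor_coeff Q i) * W ^ i) + W ^ Suc N * Abs_fps (taylor_coeff (\<lambda>z. R (\<omega> z)))"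
  have "(\<lambda>z. (\<Sum>i\<le>N. taylor_coeff Q i * \<omega> z ^ i) + \<omega> z ^ Suc N * R (\<omega> z)) has_fps_expansion ?S"
    by (intro fps_expansion_intros W RR)
  moreover have "eventually (\<lambda>z::complex. z \<in> unit_disc) (nhds 0)"
    by (rule eventually_nhds_in_open) auto
  then have "eventually (\<lambda>z. F z = (\<Sum>i\<le>N. taylor_coeff Q i * \<omega> z ^ i) + \<omega> z ^ Suc N * R (\<omega> z)) (nhds 0)"
  proof eventually_elim
    case (elim z)
    then have "\<omega> z \<in> unit_disc" using \<omega>(3) by blast
    then show ?case using F[OF elim] R(2) by simp
  qed
  ultimately have "F has_fps_expansion ?S"
    using has_fps_expansion_cong[of F "\<lambda>z. (\<Sum>i\<le>N. taylor_coeff Q i * \<omega> z ^ i) + \<omega> z ^ Suc N * R (\<omega> z)", OF _ refl]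
    by blast
  then have "taylor_coeff F N = fps_nth ?S N" by (rule taylor_coeff_fps)
  moreover have "fps_nth (W ^ Suc N * B) N = 0" for B
    unfolding fps_mult_nth using startsby_zero_power_prefix[OF W0, of "Suc N"]
    by (intro sum.neutral) (auto simp del: power_Suc)
  ultimately show ?thesis by (simp add: fps_sum_nth W_def del: power_Suc)
qed

text \<open>The constant \<open>1/3\<close> enters through \<open>bohr_schwarz\<close>: the majorant of \<open>\<omega>\<close> is at most \<open>r\<close>, so the
  majorant of \<open>\<omega>\<^sup>i\<close> is at most \<open>r\<^sup>i\<close>.\<close>

lemma majorant_subordinate:
  assumes holQ: "Q holomorphic_on unit_disc" and \<omega>: "\<omega> holomorphic_on unit_disc" "\<omega> 0 = 0" "\<omega> ` unit_disc \<subseteq> unit_disc"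
    and F: "\<And>z. z \<in> unit_disc \<Longrightarrow> F z = Q (\<omega> z)"
    and r: "0 \<le> r" "r \<le> 1 / 3"
  shows "majorant F r \<le> majorant Q r"
proof -
  define W where "W = Abs_fps (taylor_coeff \<omega>)"
  have holF: "F holomorphic_on unit_disc"
    using holomorphic_on_compose_gen[OF \<omega>(1) holQ \<omega>(3)] holomorphic_transform[of "Q \<circ> \<omega>" unit_disc F] F
    by (auto simp: o_def)
  have partial: "(\<Sum>k\<le>M. norm (taylor_coeff F k) * r ^ k) \<le> majorant Q r" for M
  proof -
    have "(\<Sum>k\<le>M. norm (taylor_coeff F k) * r ^ k)
        \<le> (\<Sum>k\<le>M. (\<Sum>i\<le>M. norm (taylor_coeff Q i) * norm (fps_nth (W ^ i) k)) * r ^ k)"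
    proof (intro sum_mono mult_right_mono)
      fix k assume k: "k \<in> {..M}"
      have "norm (taylor_coeff F k) \<le> (\<Sum>i\<le>k. norm (taylor_coeff Q i * fps_nth (W ^ i) k))"
        using norm_sum[of "\<lambda>i. taylor_coeff Q i * fps_nth (W ^ i) k" "{..k}"]
        using taylor_coeff_compose[of Q \<omega> F k, OF holQ \<omega> F] by (simp add: W_def)
      also have "\<dots> \<le> (\<Sum>i\<le>M. norm (taylor_coeff Q i * fps_nth (W ^ i) k))"
        by (rule sum_mono2) (use k in auto)
      finally show "norm (taylor_coeff F k) \<le> (\<Sum>i\<le>M. norm (taylor_coeff Q i) * norm (fps_nth (W ^ i) k))"
        by (simp add: norm_mult)
    qed (use r in auto)
    also have "\<dots> = (\<Sum>i\<le>M. norm (taylor_coeff Q i) * (\<Sum>k\<le>M. norm (fps_nth (W ^ i) k) * r ^ k))"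
      unfolding sum_distrib_left sum_distrib_right by (subst sum.swap) (simp add: mult_ac)
    also have "\<dots> \<le> (\<Sum>i\<le>M. norm (taylor_coeff Q i) * r ^ i)"
    proof (intro sum_mono mult_left_mono)
      fix i
      have "(\<Sum>k\<le>M. norm (fps_nth (W ^ i) k) * r ^ k) \<le> (\<Sum>k\<le>M. norm (fps_nth W k) * r ^ k) ^ i"
        by (rule majorant_partial_power[OF r(1)])
      also have "\<dots> \<le> r ^ i"
        using bohr_schwarz[OF \<omega> r, of M] r by (intro power_mono sum_nonneg) (auto simp: W_def)
      finally show "(\<Sum>k\<le>M. norm (fps_nth (W ^ i) k) * r ^ k) \<le> r ^ i" .
    qed auto
    also have "\<dots> \<le> majorant Q r"
      unfolding majorant_def
      by (rule sum_le_suminf[OF taylor_abs_summable[OF holQ]]) (use r in auto)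
    finally show ?thesis .
  qed
  show ?thesis
    unfolding majorant_def[of F]
  proof (rule suminf_le_const[OF taylor_abs_summable[OF holF]])
    show "(\<Sum>k<n. norm (taylor_coeff F k) * r ^ k) \<le> majorant Q r" for n
    proof (rule order_trans[OF sum_mono2 partial[of n]])
      show "0 \<le> norm (taylor_coeff F k) * r ^ k" for k using r by simp
    qed auto
  qed (use r in auto)
qed

section \<open>Univalence and omitted values of harmonic mappings\<close>

text \<open>A nonvanishing function on the disc has a holomorphic logarithm, the primitive of \<open>p' / p\<close>.\<close>

lemma exp_log_deriv_primitive:
  assumes hol: "p holomorphic_on unit_disc" and nz: "\<And>z. z \<in> unit_disc \<Longrightarrow> p z \<noteq> 0" and p0: "p 0 = 1"
  obtains P where "\<And>z. z \<in> unit_disc \<Longrightarrow> (P has_field_derivative deriv p z / p z) (at z)"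
    "P 0 = 0" "\<And>z. z \<in> unit_disc \<Longrightarrow> p z = exp (P z)"
proof -
  have "(\<lambda>z. deriv p z / p z) holomorphic_on unit_disc"
    by (intro holomorphic_intros holomorphic_deriv[OF hol] hol nz) auto
  then obtain P where P: "\<And>z. z \<in> unit_disc \<Longrightarrow> (P has_field_derivative deriv p z / p z) (at z)" "P 0 = 0"
    by (rule holomorphic_primitive_disc) blast
  have "\<exists>c. \<forall>z\<in>unit_disc. p z * exp (- P z) = c"
  proof (rule has_field_derivative_zero_constant[OF convex_ball])
    fix z :: complex assume z: "z \<in> unit_disc"
    have dp: "(p has_field_derivative deriv p z) (at z)" by (rule holomorphic_derivI[OF hol open_ball z])
    have "((\<lambda>z. p z * exp (- P z)) has_field_derivative 0) (at z)"
      by (rule derivative_eq_intros dp P(1)[OF z] refl)+ (use nz[OF z] in simp)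
    then show "((\<lambda>z. p z * exp (- P z)) has_field_derivative 0) (at z within unit_disc)"
      by (rule has_field_derivative_at_within)
  qed
  then obtain c where c: "\<And>z. z \<in> unit_disc \<Longrightarrow> p z * exp (- P z) = c" by blast
  have "c = 1" using c[of 0] by (simp add: P p0)
  then have "p z = exp (P z)" if "z \<in> unit_disc" for z
    using c[OF that] by (simp add: exp_minus field_simps)
  then show ?thesis using that P by blast
qed

text \<open>By \<open>pos\<close>, the argument of \<open>z exp(P(z))\<close> is strictly increasing along a circle; it increases by
  \<open>2 \<pi>\<close> in total. Applied with \<open>P = log h'\<close>.\<close>

lemma separation_of_convexity:
  assumes P: "\<And>z. z \<in> unit_disc \<Longrightarrow> (P has_field_derivative P' z) (at z)"
    and pos: "\<And>z. z \<in> unit_disc \<Longrightarrow> 0 < Re (1 + z * P' z)"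
    and z: "z1 \<in> unit_disc" "norm z2 = norm z1" and m: "m > 0"
    and eq: "z2 * exp (P z2) = of_real m * (z1 * exp (P z1))"
  shows "z2 = z1"
proof (cases "z1 = 0")
  case True then show ?thesis using z by simp
next
  case False
  define \<theta> where "\<theta> = Arg2pi (z2 / z1)"
  have \<theta>: "0 \<le> \<theta>" "\<theta> < 2 * pi" "z2 = z1 * exp (\<i> * of_real \<theta>)"
  proof -
    have "norm (z2 / z1) = 1" using False z by (simp add: norm_divide)
    then have "z2 / z1 = exp (\<i> * of_real \<theta>)"
      using Arg2pi_eq[of "z2 / z1"] unfolding \<theta>_def by simp
    then show "z2 = z1 * exp (\<i> * of_real \<theta>)" using False by (simp add: field_simps)
  qed (auto simp: \<theta>_def Arg2pi_ge_0 Arg2pi_lt_2pi)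
  define A where "A t = t + Im (P (z1 * exp (\<i> * of_real t)))" for t
  have der: "\<exists>y. (A has_real_derivative y) (at t) \<and> y > 0" for t
  proof -
    define u where "u = z1 * exp (\<i> * of_real t)"
    have uD: "u \<in> unit_disc" using z by (simp add: u_def norm_mult)
    have "((\<lambda>t. z1 * exp (\<i> * of_real t)) has_vector_derivative \<i> * u) (at t)"
    proof -
      have "((\<lambda>t. z1 * exp (\<i> * t)) has_field_derivative \<i> * u) (at (of_real t))"
        by (rule derivative_eq_intros refl | simp add: u_def)+
      moreover have "(complex_of_real has_vector_derivative 1) (at t)"
        by (auto simp: has_vector_derivative_def scaleR_conv_of_real intro!: derivative_eq_intros)
      ultimately show ?thesis
        using field_vector_diff_chain_at[of of_real 1 t "\<lambda>t. z1 * exp (\<i> * t)" "\<i> * u"] by (simp add: o_def)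
    qed
    from field_vector_diff_chain_at[OF this, of P "P' u"] P[OF uD]
    have "((P \<circ> (\<lambda>t. z1 * exp (\<i> * of_real t))) has_vector_derivative (\<i> * u) * P' u) (at t)"
      by (simp add: u_def)
    from bounded_linear.has_vector_derivative[OF bounded_linear_Im this]
    have "((\<lambda>t. Im (P (z1 * exp (\<i> * of_real t)))) has_real_derivative Re (u * P' u)) (at t)"
      by (simp add: has_real_derivative_iff_has_vector_derivative o_def algebra_simps)
    then have "(A has_real_derivative 1 + Re (u * P' u)) (at t)"
      unfolding A_def by (intro DERIV_add DERIV_ident)
    then show ?thesis using pos[OF uD] by auto
  qed
  have mono: "A s < A t" if "s < t" for s t
    by (rule DERIV_pos_imp_increasing[OF that]) (use der in blast)
  have per: "A (2 * pi) = A 0 + 2 * pi"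
  proof -
    have "exp (\<i> * of_real (2 * pi)) = 1" unfolding exp_eq_1 by (simp add: exI[of _ 1])
    then show ?thesis unfolding A_def by simp
  qed
  have "exp (\<i> * of_real \<theta> + P z2 - P z1 - of_real (ln m)) = 1"
  proof -
    have "exp (\<i> * of_real \<theta>) * exp (P z2) = of_real m * exp (P z1)"
      using eq False by (simp add: \<theta>(3) mult_ac)
    then show ?thesis using m by (simp add: exp_add exp_diff exp_of_real field_simps)
  qed
  then obtain n :: int where "Im (\<i> * of_real \<theta> + P z2 - P z1 - of_real (ln m)) = of_int (2 * n) * pi"
    unfolding exp_eq_1 by blast
  then have n: "A \<theta> - A 0 = of_int n * (2 * pi)" by (simp add: A_def \<theta>(3))
  have "\<theta> = 0"
  proof (rule ccontr)
    assume "\<theta> \<noteq> 0"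
    then have "A 0 < A \<theta>" "A \<theta> < A (2 * pi)" using \<theta> by (auto intro!: mono)
    then have "0 * (2 * pi) < of_int n * (2 * pi)" "of_int n * (2 * pi) < 1 * (2 * pi)"
      using n per by linarith+
    then have "(0::real) < of_int n" "of_int n < (1::real)"
      using mult_less_cancel_right_pos[of "2 * pi"] by (metis pi_gt_zero zero_less_mult_iff zero_less_numeral)+
    then have "0 < n" "n < 1" by simp_all
    then show False by simp
  qed
  then show ?thesis using \<theta>(3) by simp
qed

text \<open>The derivative of \<open>g \<circ> h\<inverse>\<close> has modulus less than \<open>1\<close>, hence at most some \<open>B < 1\<close> on the
  segment from \<open>h z1\<close> to \<open>h z2\<close>.\<close>

lemma dilatation_contraction:
  fixes h g :: "complex \<Rightarrow> complex"
  assumes h: "h holomorphic_on unit_disc" "inj_on h unit_disc" "convex (h ` unit_disc)"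
    and g: "g holomorphic_on unit_disc"
    and lt: "\<And>z. z \<in> unit_disc \<Longrightarrow> norm (deriv g z) < norm (deriv h z)"
    and z: "z1 \<in> unit_disc" "z2 \<in> unit_disc" "z1 \<noteq> z2"
  shows "norm (g z1 - g z2) < norm (h z1 - h z2)"
proof -
  obtain k where k: "k holomorphic_on (h ` unit_disc)" "\<And>z. z \<in> unit_disc \<Longrightarrow> deriv h z * deriv k (h z) = 1"
    "\<And>z. z \<in> unit_disc \<Longrightarrow> k (h z) = z"
    using holomorphic_has_inverse[OF h(1) open_ball h(2)] by blast
  have op: "open (h ` unit_disc)" by (rule open_mapping_thm3[OF h(1) open_ball h(2)])
  define S where "S = closed_segment (h z1) (h z2)"
  have S: "S \<subseteq> h ` unit_disc"
    unfolding S_def using h(3) z by (simp add: convex_contains_segment)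
  define D where "D w = deriv g (k w) * deriv k w" for w
  have derD: "((\<lambda>w. g (k w)) has_field_derivative D w) (at w)" if "w \<in> h ` unit_disc" for w
  proof -
    have "(k has_field_derivative deriv k w) (at w)" by (rule holomorphic_derivI[OF k(1) op that])
    moreover have "(g has_field_derivative deriv g (k w)) (at (k w))"
      by (rule holomorphic_derivI[OF g open_ball]) (use that k(3) in auto)
    ultimately show ?thesis unfolding D_def by (rule DERIV_chain2[rotated])
  qed
  have D_lt: "norm (D w) < 1" if "w \<in> h ` unit_disc" for w
  proof -
    from that obtain z where z: "z \<in> unit_disc" "w = h z" by blast
    have "norm (deriv h z) * norm (deriv k w) = 1" using k(2)[OF z(1)] z(2) by (metis norm_mult norm_one)
    moreover have "norm (deriv k w) \<noteq> 0" using calculation by auto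
    ultimately show ?thesis using lt[OF z(1)] k(3)[OF z(1)] z(2) mult_strict_right_mono[OF lt[OF z(1)], of "norm (deriv k w)"]
      by (simp add: D_def norm_mult)
  qed
  have "(\<lambda>w. g (k w)) holomorphic_on h ` unit_disc"
    unfolding holomorphic_on_open[OF op] using derD by blast
  then have "deriv (\<lambda>w. g (k w)) holomorphic_on h ` unit_disc" by (rule holomorphic_deriv[OF _ op])
  then have "continuous_on S (deriv (\<lambda>w. g (k w)))"
    by (intro holomorphic_on_imp_continuous_on holomorphic_on_subset[OF _ S])
  then have "continuous_on S D"
    by (rule continuous_on_eq) (use derD S in \<open>auto simp: DERIV_imp_deriv\<close>)
  then obtain s where s: "s \<in> S" "\<And>w. w \<in> S \<Longrightarrow> norm (D w) \<le> norm (D s)"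
    using continuous_attains_sup[of S "\<lambda>w. norm (D w)"] by (auto simp: S_def intro: continuous_on_norm)
  have "norm (g (k (h z1)) - g (k (h z2))) \<le> norm (D s) * norm (h z1 - h z2)"
  proof (rule field_differentiable_bound[of S "\<lambda>w. g (k w)" D])
    show "((\<lambda>w. g (k w)) has_field_derivative D w) (at w within S)" if "w \<in> S" for w
      using derD[of w] S that by (blast intro: has_field_derivative_at_within)
  qed (use s in \<open>auto simp: S_def\<close>)
  also have "\<dots> < 1 * norm (h z1 - h z2)"
    by (rule mult_strict_right_mono) (use D_lt[of s] s S z h(2) in \<open>auto dest: inj_onD\<close>)
  finally show ?thesis using k(3) z by simp
qed

lemma harmonic_inj_on:
  fixes h g :: "complex \<Rightarrow> complex"
  assumes h: "h holomorphic_on unit_disc" "inj_on h unit_disc" "convex (h ` unit_disc)"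
    and g: "g holomorphic_on unit_disc"
    and lt: "\<And>z. z \<in> unit_disc \<Longrightarrow> norm (deriv g z) < norm (deriv h z)"
  shows "inj_on (\<lambda>z. h z + cnj (g z)) unit_disc"
proof (rule inj_onI, rule ccontr)
  fix z1 z2 assume z: "z1 \<in> unit_disc" "z2 \<in> unit_disc" "h z1 + cnj (g z1) = h z2 + cnj (g z2)" "z1 \<noteq> z2"
  then have "h z1 - h z2 = cnj (g z2 - g z1)" by (simp add: algebra_simps)
  then have "norm (h z1 - h z2) = norm (g z1 - g z2)" by (metis complex_mod_cnj norm_minus_commute)
  then show False using dilatation_contraction[OF h g lt z(1,2,4)] by simp
qed

lemma harmonic_image_neq_UNIV:
  fixes h g :: "complex \<Rightarrow> complex"
  assumes h: "h holomorphic_on unit_disc" "inj_on h unit_disc" "convex (h ` unit_disc)"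
    and g: "g holomorphic_on unit_disc"
    and lt: "\<And>z. z \<in> unit_disc \<Longrightarrow> norm (deriv g z) < norm (deriv h z)"
  shows "(\<lambda>z. h z + cnj (g z)) ` unit_disc \<noteq> UNIV"
proof
  let ?f = "\<lambda>z. h z + cnj (g z)"
  assume full: "?f ` unit_disc = UNIV"
  have op: "open (h ` unit_disc)" by (rule open_mapping_thm3[OF h(1) open_ball h(2)])
  have "h ` unit_disc \<noteq> UNIV"
  proof
    assume U: "h ` unit_disc = UNIV"
    obtain k where k: "k holomorphic_on (h ` unit_disc)" "\<And>z. z \<in> unit_disc \<Longrightarrow> k (h z) = z"
      using holomorphic_has_inverse[OF h(1) open_ball h(2)] by metis
    have "range k \<subseteq> unit_disc" using k(2) U by (metis image_iff image_subsetI UNIV_I)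
    then have "bounded (range k)" using bounded_ball bounded_subset by blast
    then obtain c where "\<And>w. k w = c" using Liouville_theorem[of k] k(1) U by (auto simp: constant_on_def)
    then show False using k(2)[of 0] k(2)[of "1/2"] by (simp add: norm_divide)
  qed
  then have "frontier (h ` unit_disc) \<noteq> {}" by (auto simp: frontier_eq_empty)
  then obtain w0 where w0: "w0 \<in> closure (h ` unit_disc)" "w0 \<notin> h ` unit_disc"
    using op by (auto simp: frontier_def interior_open)
  then obtain x where x: "\<And>n. x n \<in> h ` unit_disc" "x \<longlonglongrightarrow> w0"
    unfolding closure_sequential by blast
  define z where "z n = inv_into unit_disc h (x n)" for n :: nat
  have z: "z n \<in> unit_disc" "x n = h (z n)" for n
    unfolding z_def using x(1)[of n] by (rule inv_into_into, simp add: f_inv_into_f[OF x(1)])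
  \<comment> \<open>\<open>?f\<close> is a Lipschitz function of \<open>h\<close>, so it converges along \<open>z\<close>, although \<open>h (z n)\<close> leaves the
    image of \<open>h\<close> in the limit.\<close>
  have Lip: "dist (?f (z m)) (?f (z n)) \<le> 2 * dist (x m) (x n)" for m n
  proof (cases "z m = z n")
    case False
    have "norm (g (z m) - g (z n)) < norm (h (z m) - h (z n))"
      by (rule dilatation_contraction[OF h g lt z(1) z(1) False])
    moreover have "?f (z m) - ?f (z n) = (h (z m) - h (z n)) + cnj (g (z m) - g (z n))" by simp
    then have "norm (?f (z m) - ?f (z n)) \<le> norm (h (z m) - h (z n)) + norm (g (z m) - g (z n))"
      by (metis complex_mod_cnj norm_triangle_ineq)
    ultimately show ?thesis by (simp add: dist_norm z(2))
  qed (simp add: z(2))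
  have "Cauchy (\<lambda>n. ?f (z n))"
  proof (rule metric_CauchyI)
    fix e :: real assume "e > 0"
    then obtain M where "\<And>m n. m \<ge> M \<Longrightarrow> n \<ge> M \<Longrightarrow> dist (x m) (x n) < e / 2"
      using metric_CauchyD[OF LIMSEQ_imp_Cauchy[OF x(2)], of "e/2"] by auto
    then have "2 * dist (x m) (x n) < e" if "m \<ge> M" "n \<ge> M" for m n using that by (simp add: field_simps)
    then have "\<forall>m\<ge>M. \<forall>n\<ge>M. dist (?f (z m)) (?f (z n)) < e"
      using order.strict_trans1[OF Lip] by blast
    then show "\<exists>M. \<forall>m\<ge>M. \<forall>n\<ge>M. dist (?f (z m)) (?f (z n)) < e" by blast
  qed
  then obtain v where v: "(\<lambda>n. ?f (z n)) \<longlonglongrightarrow> v" using Cauchy_convergent convergent_def by blast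
  have cont: "continuous_on unit_disc ?f"
    by (intro continuous_intros holomorphic_on_imp_continuous_on h g)
  obtain finv where finv: "homeomorphism unit_disc (?f ` unit_disc) ?f finv"
    using invariance_of_domain_homeomorphism[OF open_ball cont _ harmonic_inj_on[OF h g lt]] by auto
  have "continuous_on UNIV finv" using finv full by (simp add: homeomorphism_def)
  then have "(\<lambda>n. finv (?f (z n))) \<longlonglongrightarrow> finv v"
    using v by (intro continuous_on_tendsto_compose[of UNIV finv]) auto
  moreover have "finv (?f (z n)) = z n" for n using finv z(1) by (auto simp: homeomorphism_def)
  ultimately have "z \<longlonglongrightarrow> finv v" by simp
  moreover have fv: "finv v \<in> unit_disc" using finv full by (auto simp: homeomorphism_def)
  ultimately have "(\<lambda>n. h (z n)) \<longlonglongrightarrow> h (finv v)"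
    using holomorphic_on_imp_continuous_on[OF h(1)] z(1)
    by (intro continuous_on_tendsto_compose[of unit_disc h]) auto
  moreover have "(\<lambda>n. h (z n)) \<longlonglongrightarrow> w0" using x(2) unfolding z(2)[symmetric] .
  ultimately have "h (finv v) = w0" by (rule LIMSEQ_unique)
  then show False using w0(2) fv by blast
qed

section \<open>Covering of discs\<close>

text \<open>The real-linear map \<open>v \<mapsto> a v + cnj (b v)\<close> has determinant \<open>|a|\<^sup>2 - |b|\<^sup>2\<close>; Cramer's rule solves it.\<close>

lemma real_linear_solution:
  fixes a b e :: complex
  assumes "norm b < norm a"
  obtains v where "a * v + cnj (b * v) = e"
proof -
  define d where "d = a * cnj a - b * cnj b"
  have "d = of_real ((norm a)\<^sup>2 - (norm b)\<^sup>2)"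
    by (simp only: d_def of_real_diff complex_norm_square)
  moreover have "(norm b)\<^sup>2 < (norm a)\<^sup>2" using assms by (simp add: power_strict_mono)
  ultimately have d: "d \<noteq> 0" "cnj d = d" by (auto simp del: of_real_diff)
  define v where "v = (cnj a * e - cnj b * cnj e) / d"
  have "a * v + cnj (b * v) = (a * (cnj a * e - cnj b * cnj e) + cnj b * (a * cnj e - b * e)) / d"
    by (simp add: v_def d(2) add_divide_distrib)
  also have "\<dots> = d * e / d" by (simp add: d_def algebra_simps)
  finally show ?thesis using d(1) that by simp
qed

text \<open>If \<open>h + cnj g\<close> expands lengths by at least \<open>\<kappa>(|z|)\<close>, the image of the disc of radius \<open>s\<close> contains
  the disc of radius \<open>integral {0..s} \<kappa>\<close>. Instead of lifting segments, the proof minimises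
  \<open>|f(z) - w| + c integral {0..norm z} \<kappa>\<close> over the closed disc, with \<open>c < 1\<close>: moving \<open>z\<close> so that
  \<open>f(z)\<close> heads for \<open>w\<close> at unit speed decreases the sum, unless \<open>f(z) = w\<close>.\<close>

lemma harmonic_covers_ball:
  fixes h g :: "complex \<Rightarrow> complex" and \<kappa> :: "real \<Rightarrow> real"
  assumes h: "h holomorphic_on unit_disc" and g: "g holomorphic_on unit_disc"
    and f0: "h 0 + cnj (g 0) = 0"
    and cont: "continuous_on {0..s} \<kappa>" and pos: "\<And>t. t \<in> {0..s} \<Longrightarrow> 0 < \<kappa> t"
    and lower: "\<And>z. z \<in> unit_disc \<Longrightarrow> norm z \<le> s \<Longrightarrow> \<kappa> (norm z) \<le> norm (deriv h z) - norm (deriv g z)"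
    and s: "0 \<le> s" "s < 1" and w: "norm w < integral {0..s} \<kappa>"
  shows "w \<in> (\<lambda>z. h z + cnj (g z)) ` unit_disc"
proof -
  define f where "f z = h z + cnj (g z)" for z
  define L where "L t = integral {0..t} \<kappa>" for t
  have int: "\<kappa> integrable_on {0..t}" if "t \<le> s" for t
    by (rule integrable_continuous_real, rule continuous_on_subset[OF cont]) (use that in auto)
  have L_mono: "L t \<le> L u" if "0 \<le> t" "t \<le> u" "u \<le> s" for t u
    unfolding L_def by (rule integral_subset_le) (use that int pos in \<open>auto intro: less_imp_le\<close>)
  have L0: "L 0 = 0" by (simp add: L_def)
  have Lpos: "L t \<ge> 0" if "0 \<le> t" "t \<le> s" for t using L_mono[of 0 t] L0 that by simp
  have Ls: "L s > 0" using w norm_ge_zero[of w] unfolding L_def by linarith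
  obtain c where c: "norm w / L s < c" "c < 1" using dense[of "norm w / L s" 1] w Ls by (auto simp: L_def)
  have c0: "c > 0" using c(1) Ls by (meson divide_nonneg_pos norm_ge_zero order.strict_trans1)
  have wc: "norm w < c * L s" using c(1) Ls by (simp add: divide_less_eq)
  define \<Psi> where "\<Psi> z = norm (f z - w) + c * L (norm z)" for z
  have sub: "cball 0 s \<subseteq> unit_disc" using s by auto
  have "continuous_on {0..s} L" unfolding L_def by (rule indefinite_integral_continuous_1[OF int]) simp
  then have "continuous_on (cball 0 s) (\<lambda>z::complex. L (norm z))"
    by (rule continuous_on_compose2) (auto intro: continuous_intros)
  then have "continuous_on (cball 0 s) \<Psi>"
    unfolding \<Psi>_def f_def
    by (intro continuous_intros holomorphic_on_imp_continuous_on holomorphic_on_subset[OF h]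
        holomorphic_on_subset[OF g] sub)
  then obtain z where z: "norm z \<le> s" "\<And>u. norm u \<le> s \<Longrightarrow> \<Psi> z \<le> \<Psi> u"
    using continuous_attains_inf[of "cball 0 s" \<Psi>] s by auto
  have zD: "z \<in> unit_disc" using z(1) s by simp
  have "\<Psi> z \<le> norm w" using z(2)[of 0] s f0 L0 by (simp add: \<Psi>_def f_def)
  then have "c * L (norm z) < c * L s" using wc norm_ge_zero[of "f z - w"] unfolding \<Psi>_def by linarith
  then have zs: "norm z < s" using z(1) c0 by (cases "norm z = s") auto
  have "f z = w"
  proof (rule ccontr)
    assume neq: "f z \<noteq> w"
    define e where "e = - sgn (f z - w)"
    have e: "norm e = 1" using neq by (simp add: e_def norm_sgn)
    have lam: "0 < \<kappa> (norm z)" "\<kappa> (norm z) \<le> norm (deriv h z) - norm (deriv g z)"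
      using pos[of "norm z"] lower[OF zD] z(1) by auto
    \<comment> \<open>In the direction \<open>v\<close>, \<open>f\<close> moves towards \<open>w\<close> with unit speed.\<close>
    then obtain v where v: "deriv h z * v + cnj (deriv g z * v) = e"
      using real_linear_solution[of "deriv g z" "deriv h z" e] by auto
    have v0: "norm v > 0" using v e by auto
    have "1 \<ge> norm (deriv h z * v) - norm (cnj (deriv g z * v))"
      using norm_triangle_ineq2[of "deriv h z * v" "- cnj (deriv g z * v)"] v e by simp
    then have "(norm (deriv h z) - norm (deriv g z)) * norm v \<le> 1"
      by (simp add: norm_mult left_diff_distrib)
    then have lv: "\<kappa> (norm z) * norm v \<le> 1"
      using mult_right_mono[OF lam(2), of "norm v"] by simp
    define \<delta> where "\<delta> = (s - norm z) / norm v"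
    have \<delta>: "\<delta> > 0" using zs v0 by (simp add: \<delta>_def)
    have \<delta>': "norm z + \<epsilon> * norm v \<le> s" if "\<epsilon> \<le> \<delta>" for \<epsilon>
      using mult_right_mono[OF that, of "norm v"] v0 by (simp add: \<delta>_def)
    define F where "F \<epsilon> = f (z + of_real \<epsilon> * v)" for \<epsilon> :: real
    have line: "((\<lambda>\<epsilon>. z + of_real \<epsilon> * v) has_vector_derivative v) (at 0)"
      by (auto intro!: derivative_eq_intros simp: has_vector_derivative_def scaleR_conv_of_real)
    have "((\<lambda>\<epsilon>. h (z + of_real \<epsilon> * v)) has_vector_derivative v * deriv h z) (at 0)"
      using field_vector_diff_chain_at[OF line, of h "deriv h z"] holomorphic_derivI[OF h open_ball zD]
      by (simp add: o_def)
    moreover have "((\<lambda>\<epsilon>. g (z + of_real \<epsilon> * v)) has_vector_derivative v * deriv g z) (at 0)"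
      using field_vector_diff_chain_at[OF line, of g "deriv g z"] holomorphic_derivI[OF g open_ball zD]
      by (simp add: o_def)
    from bounded_linear.has_vector_derivative[OF bounded_linear_cnj this]
    have "((\<lambda>\<epsilon>. cnj (g (z + of_real \<epsilon> * v))) has_vector_derivative cnj (v * deriv g z)) (at 0)" .
    ultimately have "(F has_vector_derivative v * deriv h z + cnj (v * deriv g z)) (at 0)"
      unfolding F_def f_def by (rule has_vector_derivative_add)
    then have derF: "(F has_vector_derivative e) (at 0)" using v by (simp add: mult.commute)
    have "((\<lambda>\<epsilon>. norm (F \<epsilon> - w)) has_derivative (\<lambda>x. (x *\<^sub>R e) \<bullet> sgn (F 0 - w))) (at 0)"
    proof -
      have "((\<lambda>\<epsilon>. F \<epsilon> - w) has_derivative (\<lambda>x. x *\<^sub>R e)) (at 0)"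
        using has_derivative_diff[OF derF[unfolded has_vector_derivative_def] has_derivative_const[of w]] by simp
      moreover have "(norm has_derivative (\<lambda>y. y \<bullet> sgn (F 0 - w))) (at (F 0 - w))"
        by (rule has_derivative_norm) (use neq in \<open>simp add: F_def\<close>)
      ultimately show ?thesis by (rule has_derivative_compose)
    qed
    moreover have "(\<lambda>x. (x *\<^sub>R e) \<bullet> sgn (F 0 - w)) = (*) (- 1)"
    proof
      fix x :: real
      have "sgn (f z - w) \<bullet> sgn (f z - w) = 1"
        using neq by (simp add: power2_norm_eq_inner[symmetric] norm_sgn)
      then show "(x *\<^sub>R e) \<bullet> sgn (F 0 - w) = - 1 * x" by (simp add: F_def e_def)
    qed
    ultimately have d1: "((\<lambda>\<epsilon>. norm (F \<epsilon> - w)) has_real_derivative - 1) (at 0 within {0..\<delta>})"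
      by (simp add: has_field_derivative_def has_derivative_at_withinI)
    have "(L has_real_derivative \<kappa> (norm z)) (at (norm z) within {0..s})"
      unfolding L_def by (rule integral_has_real_derivative[OF cont]) (use z(1) in auto)
    then have "(L has_real_derivative \<kappa> (norm z)) (at (norm z) within (\<lambda>\<epsilon>. norm z + \<epsilon> * norm v) ` {0..\<delta>})"
      by (rule DERIV_subset) (use \<delta>' in auto)
    moreover have "((\<lambda>\<epsilon>. norm z + \<epsilon> * norm v) has_real_derivative norm v) (at 0 within {0..\<delta>})"
      by (auto intro!: derivative_eq_intros)
    ultimately have d2: "((\<lambda>\<epsilon>. L (norm z + \<epsilon> * norm v)) has_real_derivative \<kappa> (norm z) * norm v) (at 0 within {0..\<delta>})"
      using DERIV_image_chain[of L "\<kappa> (norm z)" "\<lambda>\<epsilon>. norm z + \<epsilon> * norm v" 0 "{0..\<delta>}" "norm v"] by (simp add: o_def)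
    define Q where "Q \<epsilon> = norm (F \<epsilon> - w) + c * L (norm z + \<epsilon> * norm v)" for \<epsilon>
    have derQ: "(Q has_real_derivative - 1 + c * (\<kappa> (norm z) * norm v)) (at 0 within {0..\<delta>})"
      unfolding Q_def by (rule DERIV_add[OF d1 DERIV_cmult[OF d2]])
    have "c * (\<kappa> (norm z) * norm v) \<le> c * 1" by (rule mult_left_mono[OF lv]) (use c0 in simp)
    then have "- 1 + c * (\<kappa> (norm z) * norm v) < 0" using c(2) by simp
    from has_real_derivative_neg_dec_right[OF derQ this]
    obtain d where d: "d > 0" "\<And>\<epsilon>. 0 < \<epsilon> \<Longrightarrow> \<epsilon> \<in> {0..\<delta>} \<Longrightarrow> \<epsilon> < d \<Longrightarrow> Q \<epsilon> < Q 0" by auto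
    define \<epsilon> where "\<epsilon> = min \<delta> (d / 2)"
    have \<epsilon>: "0 < \<epsilon>" "\<epsilon> \<le> \<delta>" "\<epsilon> < d" using \<delta> d by (auto simp: \<epsilon>_def)
    have n: "norm (z + of_real \<epsilon> * v) \<le> norm z + \<epsilon> * norm v"
      using norm_triangle_ineq[of z "of_real \<epsilon> * v"] \<epsilon> by (simp add: norm_mult)
    have "\<Psi> (z + of_real \<epsilon> * v) \<le> Q \<epsilon>"
      unfolding \<Psi>_def F_def Q_def by (intro add_left_mono mult_left_mono L_mono n \<delta>') (use \<epsilon> c0 in auto)
    also have "\<dots> < Q 0" by (rule d(2)) (use \<epsilon> in auto)
    also have "\<dots> = \<Psi> z" by (simp add: F_def \<Psi>_def Q_def)
    finally have "\<Psi> (z + of_real \<epsilon> * v) < \<Psi> z" .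
    moreover have "norm (z + of_real \<epsilon> * v) \<le> s" using n \<delta>'[OF \<epsilon>(2)] by simp
    ultimately show False using z(2) not_less by blast
  qed
  then show ?thesis using zD by (auto simp: f_def)
qed

section \<open>Area of the image of a disc\<close>

text \<open>The identification of \<open>real ^ 2\<close> with the complex plane, which preserves Lebesgue measure. It
  carries change of variables in Cartesian powers of the reals over to complex functions.\<close>

definition complex_of_vec :: "real ^ 2 \<Rightarrow> complex" where
  "complex_of_vec x = Complex (x $ 1) (x $ 2)"

definition vec_of_complex :: "complex \<Rightarrow> real ^ 2" where
  "vec_of_complex z = vector [Re z, Im z]"

lemma vec_of_complex_nth [simp]: "vec_of_complex z $ 1 = Re z" "vec_of_complex z $ 2 = Im z"
  by (simp_all add: vec_of_complex_def)

lemma vec_complex_inverse [simp]: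
  "complex_of_vec (vec_of_complex z) = z" "vec_of_complex (complex_of_vec x) = x"
  by (simp_all add: complex_of_vec_def vec_eq_iff forall_2)

lemma bounded_linear_vec_of_complex: "bounded_linear vec_of_complex"
  by (intro linear_conv_bounded_linear[THEN iffD1] linearI) (simp_all add: vec_eq_iff forall_2)

lemma bounded_linear_complex_of_vec: "bounded_linear complex_of_vec"
  by (intro linear_conv_bounded_linear[THEN iffD1] linearI) (simp_all add: complex_of_vec_def complex_eq_iff)

lemma Basis_real_2: "(Basis :: (real ^ 2) set) = {axis 1 1, axis 2 1}"
  by (auto simp: Basis_vec_def UNIV_2)

lemma axis_neq: "axis 1 (1::real) \<noteq> (axis 2 1 :: real ^ 2)"
  by (simp add: axis_eq_axis)

lemma distr_complex_of_vec: "distr lborel borel complex_of_vec = lborel"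
proof (rule lborel_eqI[symmetric])
  have meas: "complex_of_vec \<in> borel_measurable lborel"
    using bounded_linear.continuous_on[OF bounded_linear_complex_of_vec continuous_on_id]
    by (simp add: borel_measurable_continuous_onI)
  fix l u :: complex assume lu: "\<And>b. b \<in> Basis \<Longrightarrow> l \<bullet> b \<le> u \<bullet> b"
  have "emeasure (distr lborel borel complex_of_vec) (box l u) = emeasure lborel (complex_of_vec -` box l u)"
    by (subst emeasure_distr[OF meas]) auto
  also have "complex_of_vec -` box l u = box (vec_of_complex l) (vec_of_complex u)"
    by (auto simp: complex_of_vec_def mem_box Basis_complex_def Basis_real_2 inner_axis)
  also have "emeasure lborel \<dots> = (\<Prod>b\<in>Basis. (vec_of_complex u - vec_of_complex l) \<bullet> b)"
    by (rule emeasure_lborel_box) (use lu[of 1] lu[of \<i>] in \<open>auto simp: Basis_complex_def Basis_real_2 inner_axis\<close>)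
  also have "\<dots> = (\<Prod>b\<in>Basis. (u - l) \<bullet> b)"
    by (simp add: Basis_complex_def Basis_real_2 inner_axis axis_neq)
  finally show "emeasure (distr lborel borel complex_of_vec) (box l u) = (\<Prod>b\<in>Basis. (u - l) \<bullet> b)" .
qed simp

lemma measure_vec_of_complex_image:
  assumes "compact S"
  shows "measure lebesgue (vec_of_complex ` S) = measure lebesgue S"
proof -
  have meas: "complex_of_vec \<in> borel_measurable lborel"
    using bounded_linear.continuous_on[OF bounded_linear_complex_of_vec continuous_on_id]
    by (simp add: borel_measurable_continuous_onI)
  have S: "S \<in> sets borel" using assms by (simp add: compact_imp_closed borel_closed)
  have "compact (vec_of_complex ` S)"
    by (intro compact_continuous_image assms bounded_linear.continuous_on[OF bounded_linear_vec_of_complex] continuous_on_id)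
  then have V: "vec_of_complex ` S \<in> sets borel" by (simp add: compact_imp_closed borel_closed)
  have "measure lborel S = measure lborel (complex_of_vec -` S)"
    using measure_distr[OF meas, of S] S by (simp add: distr_complex_of_vec)
  also have "complex_of_vec -` S = vec_of_complex ` S"
    by (auto simp: image_iff) (metis vec_complex_inverse(2))
  finally show ?thesis using S V by (simp add: measure_completion)
qed

text \<open>Fubini's theorem for a product integrand, read off from the product structure of \<open>lborel\<close>.\<close>

lemma integral_rectangle_first_coordinate:
  fixes J :: "real \<Rightarrow> real"
  assumes cont: "continuous_on {0..r} J" and nonneg: "\<And>t. t \<in> {0..r} \<Longrightarrow> 0 \<le> J t" and c: "0 \<le> c"
  shows "integral (cbox (vector [0, 0]) (vector [r, c] :: real ^ 2)) (\<lambda>x. J (x $ 1)) = c * integral {0..r} J"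
    and "(\<lambda>x. J (x $ 1)) integrable_on cbox (vector [0, 0]) (vector [r, c] :: real ^ 2)"
proof -
  define S where "S = cbox (vector [0, 0]) (vector [r, c] :: real ^ 2)"
  have S: "x \<in> S \<longleftrightarrow> x $ 1 \<in> {0..r} \<and> x $ 2 \<in> {0..c}" for x
    by (auto simp: S_def mem_box Basis_real_2 inner_axis)
  show int: "(\<lambda>x. J (x $ 1)) integrable_on cbox (vector [0, 0]) (vector [r, c] :: real ^ 2)"
    by (rule integrable_continuous, rule continuous_on_compose2[OF cont])
      (use S in \<open>auto simp: S_def intro!: continuous_intros\<close>)
  define F where "F b t = (if b = axis 1 1 then ennreal (J t) * indicator {0..r} t else indicator {0..c} t)"
    for b :: "real ^ 2" and t
  have Jmeas: "(\<lambda>t. ennreal (J t) * indicator {0..r} t) \<in> borel_measurable borel"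
  proof -
    have "(\<lambda>t. ennreal (indicator {0..r} t *\<^sub>R J t)) \<in> borel_measurable borel"
      using borel_measurable_continuous_on_indicator[OF _ cont] by simp
    moreover have "(\<lambda>t. ennreal (indicator {0..r} t *\<^sub>R J t)) = (\<lambda>t. ennreal (J t) * indicator {0..r} t)"
      by (auto simp: indicator_def)
    ultimately show ?thesis by simp
  qed
  have Jint: "0 \<le> integral {0..r} J"
    by (intro integral_nonneg integrable_continuous_real cont nonneg)
  have "ennreal (integral S (\<lambda>x. J (x $ 1))) = (\<integral>\<^sup>+x. ennreal (J (x $ 1)) * indicator S x \<partial>lborel)"
    by (rule nn_integral_has_integral_lebesgue'[symmetric])
      (use nonneg S int in \<open>auto simp: S_def[symmetric] integrable_integral\<close>)
  also have "\<dots> = (\<integral>\<^sup>+x. (\<Prod>b\<in>Basis. F b (x \<bullet> b)) \<partial>lborel)"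
    by (rule nn_integral_cong)
      (auto simp: F_def Basis_real_2 inner_axis axis_neq axis_neq[symmetric] S indicator_def)
  also have "\<dots> = (\<Prod>b\<in>Basis. (\<integral>\<^sup>+t. F b t \<partial>lborel))"
    by (rule nn_integral_lborel_prod) (use Jmeas in \<open>auto simp: F_def[abs_def]\<close>)
  also have "\<dots> = (\<integral>\<^sup>+t. ennreal (J t) * indicator {0..r} t \<partial>lborel) * (\<integral>\<^sup>+t. indicator {0..c} t \<partial>lborel)"
    by (simp add: F_def Basis_real_2 axis_neq axis_neq[symmetric])
  also have "(\<integral>\<^sup>+t. ennreal (J t) * indicator {0..r} t \<partial>lborel) = ennreal (integral {0..r} J)"
    by (rule nn_integral_has_integral_lebesgue')
      (use nonneg cont in \<open>auto intro: integrable_integral integrable_continuous_real\<close>)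
  also have "(\<integral>\<^sup>+t. indicator {0..c} t \<partial>lborel) = ennreal c"
    using c by (simp add: nn_integral_indicator)
  also have "ennreal (integral {0..r} J) * ennreal c = ennreal (c * integral {0..r} J)"
    using c Jint by (simp add: ennreal_mult mult.commute)
  finally have eq: "ennreal (integral S (\<lambda>x. J (x $ 1))) = ennreal (c * integral {0..r} J)" .
  have "0 \<le> integral S (\<lambda>x. J (x $ 1))"
    by (rule integral_nonneg) (use int nonneg S in \<open>auto simp: S_def[symmetric]\<close>)
  moreover have "0 \<le> c * integral {0..r} J" using c Jint by simp
  ultimately have "integral S (\<lambda>x. J (x $ 1)) = c * integral {0..r} J" using eq by simp
  then show "integral (cbox (vector [0, 0]) (vector [r, c] :: real ^ 2)) (\<lambda>x. J (x $ 1)) = c * integral {0..r} J"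
    by (simp add: S_def)
qed

text \<open>\<open>J\<close> bounds the Jacobian in polar coordinates. No injectivity is needed for an upper bound, so the
  overlap of the polar coordinates at \<open>r = 0\<close> and along the positive real axis does no harm.\<close>

lemma harmonic_area_le:
  fixes h g :: "complex \<Rightarrow> complex" and J :: "real \<Rightarrow> real"
  assumes h: "h holomorphic_on unit_disc" and g: "g holomorphic_on unit_disc"
    and r: "0 \<le> r" "r < 1" and cont: "continuous_on {0..r} J"
    and le: "\<And>z. norm z \<le> r \<Longrightarrow> norm z * \<bar>(norm (deriv h z))\<^sup>2 - (norm (deriv g z))\<^sup>2\<bar> \<le> J (norm z)"
  shows "measure lebesgue ((\<lambda>z. h z + cnj (g z)) ` ball 0 r) \<le> 2 * pi * integral {0..r} J"
proof -
  define f where "f z = h z + cnj (g z)" for z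
  define pol where "pol x = of_real (x $ 1) * exp (\<i> * of_real (x $ 2))" for x :: "real ^ 2"
  define S where "S = cbox (vector [0, 0]) (vector [r, 2 * pi] :: real ^ 2)"
  have S: "x \<in> S \<longleftrightarrow> x $ 1 \<in> {0..r} \<and> x $ 2 \<in> {0..2 * pi}" for x
    by (auto simp: S_def mem_box Basis_real_2 inner_axis)
  have norm_pol: "norm (pol x) = x $ 1" if "x \<in> S" for x using that by (simp add: pol_def norm_mult S)
  have polD: "pol x \<in> unit_disc" if "x \<in> S" for x using norm_pol[OF that] that r by (simp add: S)
  have pol_image: "pol ` S = cball 0 r"
  proof (intro equalityI subsetI)
    fix z assume "z \<in> pol ` S"
    then show "z \<in> cball 0 r" using norm_pol by (auto simp: S)
  next
    fix z :: complex assume z: "z \<in> cball 0 r"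
    have "z = pol (vector [norm z, Arg2pi z])" using Arg2pi_eq[of z] by (simp add: pol_def)
    moreover have "vector [norm z, Arg2pi z] \<in> S"
      using z Arg2pi_ge_0[of z] Arg2pi_lt_2pi[of z] by (simp add: S less_imp_le)
    ultimately show "z \<in> pol ` S" by blast
  qed
  define pol' where "pol' x v = of_real (v $ 1) * exp (\<i> * of_real (x $ 2)) + of_real (v $ 2) * (\<i> * pol x)"
    for x v :: "real ^ 2"
  have der_pol: "(pol has_derivative pol' x) (at x within S)" for x
  proof -
    have c: "((\<lambda>x. x $ i) has_derivative (\<lambda>v. v $ i)) (at x within S)" for i :: 2
      by (rule bounded_linear_imp_has_derivative[OF bounded_linear_vec_nth])
    have "((\<lambda>t::real. exp (\<i> * of_real t)) has_vector_derivative \<i> * exp (\<i> * of_real (x $ 2))) (at (x $ 2) within (\<lambda>x. x $ 2) ` S)"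
      by (auto intro!: derivative_eq_intros has_vector_derivative_real_field)
    from has_derivative_in_compose[OF c this[unfolded has_vector_derivative_def]]
    have e: "((\<lambda>x. exp (\<i> * of_real (x $ 2))) has_derivative (\<lambda>v. (v $ 2) *\<^sub>R (\<i> * exp (\<i> * of_real (x $ 2))))) (at x within S)"
      by simp
    have "((\<lambda>x. complex_of_real (x $ 1)) has_derivative (\<lambda>v. complex_of_real (v $ 1))) (at x within S)"
      by (rule bounded_linear.has_derivative[OF bounded_linear_of_real c])
    from has_derivative_mult[OF this e] show ?thesis
      unfolding pol_def[abs_def] by (rule has_derivative_eq_rhs) (auto simp: pol'_def pol_def fun_eq_iff scaleR_conv_of_real algebra_simps)
  qed
  define T where "T x = vec_of_complex (f (pol x))" for x
  define T' where "T' x v = vec_of_complex (deriv h (pol x) * pol' x v + cnj (deriv g (pol x) * pol' x v))" for x v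
  have der: "(T has_derivative T' x) (at x within S)" if x: "x \<in> S" for x
  proof -
    have dh: "(h has_derivative (*) (deriv h (pol x))) (at (pol x))"
      using holomorphic_derivI[OF h open_ball polD[OF x]] by (simp add: has_field_derivative_def)
    have dg: "(g has_derivative (*) (deriv g (pol x))) (at (pol x))"
      using holomorphic_derivI[OF g open_ball polD[OF x]] by (simp add: has_field_derivative_def)
    show ?thesis
      unfolding T_def[abs_def] T'_def[abs_def] f_def
      by (intro bounded_linear.has_derivative[OF bounded_linear_vec_of_complex] has_derivative_add
          bounded_linear.has_derivative[OF bounded_linear_cnj]
          has_derivative_compose[OF der_pol dh] has_derivative_compose[OF der_pol dg])
  qed
  have det: "\<bar>det (matrix (T' x))\<bar> = x $ 1 * \<bar>(norm (deriv h (pol x)))\<^sup>2 - (norm (deriv g (pol x)))\<^sup>2\<bar>" if x: "x \<in> S" for x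
  proof -
    define a where "a = deriv h (pol x) * exp (\<i> * of_real (x $ 2))"
    define b where "b = deriv g (pol x) * exp (\<i> * of_real (x $ 2))"
    have ab: "norm a = norm (deriv h (pol x))" "norm b = norm (deriv g (pol x))"
      by (simp_all add: a_def b_def norm_mult)
    have T1: "T' x (axis 1 1) = vec_of_complex (a + cnj b)"
      by (simp add: T'_def pol'_def a_def b_def axis_def)
    have T2: "T' x (axis 2 1) = vec_of_complex (of_real (x $ 1) * (\<i> * (a - cnj b)))"
      by (simp add: T'_def pol'_def a_def b_def axis_def pol_def algebra_simps)
    have "det (matrix (T' x)) = x $ 1 * ((norm a)\<^sup>2 - (norm b)\<^sup>2)"
      unfolding cmod_power2
      by (simp add: det_2 matrix_def T1 T2 algebra_simps power2_eq_square)
    then show ?thesis using x by (simp add: abs_mult ab S)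
  qed
  have cont_pol: "continuous_on S pol" using der_pol has_derivative_continuous_on by blast
  have cdh: "continuous_on S (\<lambda>x. deriv h (pol x))" "continuous_on S (\<lambda>x. deriv g (pol x))"
    by (rule continuous_on_compose2[OF holomorphic_on_imp_continuous_on[OF holomorphic_deriv[OF h open_ball]] cont_pol];
        use polD in blast)
      (rule continuous_on_compose2[OF holomorphic_on_imp_continuous_on[OF holomorphic_deriv[OF g open_ball]] cont_pol];
        use polD in blast)
  have "continuous_on S (\<lambda>x. x $ 1 * \<bar>(norm (deriv h (pol x)))\<^sup>2 - (norm (deriv g (pol x)))\<^sup>2\<bar>)"
    by (intro continuous_intros cdh)
  then have "continuous_on S (\<lambda>x. \<bar>det (matrix (T' x))\<bar>)"
    by (rule continuous_on_eq) (simp add: det)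
  then have int: "(\<lambda>x. \<bar>det (matrix (T' x))\<bar>) integrable_on S"
    unfolding S_def by (rule integrable_continuous)
  have Jnn: "0 \<le> J t" if "t \<in> {0..r}" for t
  proof -
    have "0 \<le> t * \<bar>(norm (deriv h (of_real t)))\<^sup>2 - (norm (deriv g (of_real t)))\<^sup>2\<bar>" using that by simp
    also have "\<dots> \<le> J t" using le[of "of_real t"] that by simp
    finally show ?thesis .
  qed
  have "measure lebesgue (T ` S) \<le> integral S (\<lambda>x. \<bar>det (matrix (T' x))\<bar>)"
    by (rule measure_differentiable_image[OF _ der int]) (simp add: S_def)
  also have "\<dots> \<le> integral S (\<lambda>x. J (x $ 1))"
  proof (rule integral_le[OF int])
    show "(\<lambda>x. J (x $ 1)) integrable_on S"
      unfolding S_def by (rule integral_rectangle_first_coordinate(2)[OF cont Jnn]) auto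
    fix x assume x: "x \<in> S"
    show "\<bar>det (matrix (T' x))\<bar> \<le> J (x $ 1)"
      using le[of "pol x"] norm_pol[OF x] x by (simp add: det[OF x] S)
  qed
  also have "\<dots> = 2 * pi * integral {0..r} J"
    unfolding S_def by (rule integral_rectangle_first_coordinate(1)[OF cont Jnn]) auto
  finally have bound: "measure lebesgue (T ` S) \<le> 2 * pi * integral {0..r} J" .
  have "continuous_on (cball 0 r) f"
    unfolding f_def by (intro continuous_intros holomorphic_on_imp_continuous_on
        holomorphic_on_subset[OF h] holomorphic_on_subset[OF g]) (use r in auto)
  then have comp: "compact (f ` cball 0 r)" by (rule compact_continuous_image) simp
  have "T ` S = vec_of_complex ` f ` cball 0 r"
    unfolding pol_image[symmetric] by (auto simp: T_def image_image)
  then have "measure lebesgue (f ` cball 0 r) \<le> 2 * pi * integral {0..r} J"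
    using bound measure_vec_of_complex_image[OF comp] by simp
  moreover have "measure lebesgue (f ` ball 0 r) \<le> measure lebesgue (f ` cball 0 r)"
  proof (cases "f ` ball 0 r \<in> sets lebesgue")
    case True
    show ?thesis
      by (rule measure_mono_fmeasurable[OF _ True lmeasurable_compact[OF comp]]) auto
  qed (simp add: measure_notin_sets)
  ultimately show ?thesis by (simp add: f_def)
qed

section \<open>Majorant series and the class C(phi)\<close>

lemma taylor_coeff_0: "taylor_coeff F 0 = F 0" and taylor_coeff_1: "taylor_coeff F 1 = deriv F 0"
  by (simp_all add: taylor_coeff_def)

lemma taylor_coeff_deriv: "taylor_coeff (deriv F) k = of_nat (Suc k) * taylor_coeff F (Suc k)"
proof -
  have "(deriv ^^ Suc k) F 0 = (deriv ^^ k) (deriv F) 0" by (simp add: funpow_Suc_right del: funpow.simps)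
  then show ?thesis unfolding taylor_coeff_def by (simp add: field_simps del: of_nat_Suc funpow.simps)
qed

lemma majorant_has_derivative:
  assumes hol: "F holomorphic_on unit_disc" and r: "\<bar>r\<bar> < 1"
  shows "(majorant F has_real_derivative majorant (deriv F) r) (at r)"
proof -
  obtain s where s: "\<bar>r\<bar> < s" "s < 1" using dense r by blast
  have "((\<lambda>r. \<Sum>k. norm (taylor_coeff F k) * r ^ k) has_real_derivative
      (\<Sum>k. diffs (\<lambda>k. norm (taylor_coeff F k)) k * r ^ k)) (at r)"
    by (rule termdiffs_strong[OF taylor_abs_summable[OF hol, of s]]) (use s in auto)
  moreover have "diffs (\<lambda>k. norm (taylor_coeff F k)) = (\<lambda>k. norm (taylor_coeff (deriv F) k))"
    by (auto simp: diffs_def taylor_coeff_deriv norm_mult simp del: of_nat_Suc)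
  ultimately show ?thesis unfolding majorant_def by simp
qed

lemma majorant_continuous_on:
  assumes "F holomorphic_on unit_disc" "S \<subseteq> {-1<..<1}"
  shows "continuous_on S (majorant F)"
proof (rule DERIV_continuous_on)
  fix x assume "x \<in> S"
  then have "\<bar>x\<bar> < 1" using assms(2) by (auto simp: abs_less_iff)
  then show "(majorant F has_real_derivative majorant (deriv F) x) (at x within S)"
    using majorant_has_derivative[OF assms(1)] has_field_derivative_at_within by blast
qed

lemma majorant_0 [simp]: "majorant F 0 = norm (F 0)"
  using suminf_finite[of "{0}" "\<lambda>k. norm (taylor_coeff F k) * 0 ^ k"] by (simp add: majorant_def taylor_coeff_0)

lemma majorant_has_integral:
  assumes "F holomorphic_on unit_disc" "F 0 = 0" "0 \<le> r" "r < 1"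
  shows "(majorant (deriv F) has_integral majorant F r) {0..r}"
proof -
  have "(majorant (deriv F) has_integral majorant F r - majorant F 0) {0..r}"
  proof (rule fundamental_theorem_of_calculus[OF assms(3)])
    fix x assume "x \<in> {0..r}"
    then have "\<bar>x\<bar> < 1" using assms by auto
    then show "(majorant F has_vector_derivative majorant (deriv F) x) (at x within {0..r})"
      using majorant_has_derivative[OF assms(1)]
      by (simp add: has_real_derivative_iff_has_vector_derivative has_vector_derivative_at_within)
  qed
  then show ?thesis using assms(2) by simp
qed

lemma majorant_nonneg:
  assumes "F holomorphic_on unit_disc" "0 \<le> r" "r < 1"
  shows "0 \<le> majorant F r"
  unfolding majorant_def by (rule suminf_nonneg[OF taylor_abs_summable]) (use assms in auto)

lemma majorant_ge_linear:
  assumes "F holomorphic_on unit_disc" "0 \<le> r" "r < 1"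
  shows "norm (deriv F 0) * r \<le> majorant F r"
proof -
  have "(\<Sum>k\<in>{1}. norm (taylor_coeff F k) * r ^ k) \<le> majorant F r"
    unfolding majorant_def by (rule sum_le_suminf[OF taylor_abs_summable]) (use assms in auto)
  then show ?thesis by (simp add: taylor_coeff_1[unfolded One_nat_def])
qed

lemma majorant_monomial_mult:
  assumes hol: "p holomorphic_on unit_disc" and eq: "\<And>z. z \<in> unit_disc \<Longrightarrow> q z = c * z ^ n * p z"
    and r: "\<bar>r\<bar> < 1"
  shows "majorant q r = norm c * r ^ n * majorant p r"
proof -
  have "(\<lambda>z. c * z ^ n * p z) has_fps_expansion fps_const c * fps_X ^ n * Abs_fps (taylor_coeff p)"
    by (intro fps_expansion_intros has_fps_expansion_taylor hol)
  moreover have "eventually (\<lambda>z::complex. z \<in> unit_disc) (nhds 0)"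
    by (rule eventually_nhds_in_open) auto
  then have "eventually (\<lambda>z. q z = c * z ^ n * p z) (nhds 0)" by eventually_elim (use eq in auto)
  ultimately have "q has_fps_expansion fps_const c * fps_X ^ n * Abs_fps (taylor_coeff p)"
    using has_fps_expansion_cong[of q "\<lambda>z. c * z ^ n * p z", OF _ refl] by blast
  from taylor_coeff_fps[OF this]
  have coeff: "taylor_coeff q k = (if k < n then 0 else c * taylor_coeff p (k - n))" for k
    by (simp add: mult.assoc fps_X_power_mult_nth)
  have "(\<lambda>k. norm (taylor_coeff p k) * r ^ k) sums majorant p r"
    unfolding majorant_def by (rule summable_sums[OF taylor_abs_summable[OF hol r]])
  from sums_mult[OF this, of "norm c * r ^ n"]
  have "(\<lambda>k. norm (taylor_coeff q (k + n)) * r ^ (k + n)) sums (norm c * r ^ n * majorant p r)"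
    by (simp add: coeff norm_mult power_add mult_ac)
  then have "(\<lambda>k. norm (taylor_coeff q k) * r ^ k) sums (norm c * r ^ n * majorant p r + (\<Sum>i<n. norm (taylor_coeff q i) * r ^ i))"
    by (subst (asm) sums_iff_shift)
  then show ?thesis unfolding majorant_def by (simp add: coeff sums_iff)
qed

lemma harmonic_majorant_eq:
  assumes h: "h holomorphic_on unit_disc" "h 0 = 0" "deriv h 0 = 1"
    and g: "g holomorphic_on unit_disc" "g 0 = 0" "deriv g 0 = 0" and r: "\<bar>r\<bar> < 1"
  shows "harmonic_majorant h g r = majorant h r + majorant g r"
proof -
  have tail: "summable (\<lambda>k. norm (taylor_coeff F (k + 2)) * r ^ (k + 2))"
    "majorant F r = (\<Sum>k. norm (taylor_coeff F (k + 2)) * r ^ (k + 2)) + norm (F 0) + norm (deriv F 0) * r"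
    if "F holomorphic_on unit_disc" for F
  proof -
    show "summable (\<lambda>k. norm (taylor_coeff F (k + 2)) * r ^ (k + 2))"
      using summable_ignore_initial_segment[OF taylor_abs_summable[OF that r]] .
    show "majorant F r = (\<Sum>k. norm (taylor_coeff F (k + 2)) * r ^ (k + 2)) + norm (F 0) + norm (deriv F 0) * r"
      using suminf_split_initial_segment[OF taylor_abs_summable[OF that r], of 2]
      by (simp add: majorant_def numeral_2_eq_2 taylor_coeff_0 taylor_coeff_1[unfolded One_nat_def])
  qed
  show ?thesis
    unfolding harmonic_majorant_def distrib_right suminf_add[OF tail(1)[OF h(1)] tail(1)[OF g(1)], symmetric]
    using tail(2)[OF h(1)] tail(2)[OF g(1)] h g by simp
qed

lemma real_valued_holomorphic_constant:
  assumes hol: "F holomorphic_on unit_disc" and im: "\<And>z. z \<in> unit_disc \<Longrightarrow> Im (F z) = 0"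
    and z: "z \<in> unit_disc"
  shows "F z = F 0"
proof -
  have "F constant_on unit_disc"
  proof (rule ccontr)
    assume "\<not> ?thesis"
    then have "open (F ` unit_disc)"
      using open_mapping_thm[of F unit_disc unit_disc] hol by auto
    moreover have "F 0 \<in> F ` unit_disc" by auto
    ultimately obtain e where e: "e > 0" "ball (F 0) e \<subseteq> F ` unit_disc" by (rule openE)
    have "F 0 + \<i> * of_real (e / 2) \<in> ball (F 0) e" using e by (simp add: dist_norm norm_mult)
    then obtain x where x: "x \<in> unit_disc" "F 0 + \<i> * of_real (e / 2) = F x" using e(2) by blast
    then have "Im (F 0 + \<i> * of_real (e / 2)) = Im (F x)" by simp
    then show False using im[OF x(1)] im[of 0] e(1) by simp
  qed
  then obtain c where "\<And>x. x \<in> unit_disc \<Longrightarrow> F x = c" unfolding constant_on_def by blast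
  from this[OF z] this[of 0] show ?thesis by simp
qed

text \<open>The decomposition \<open>f = h + cnj g\<close> is unique, since a holomorphic function with real values is
  constant.\<close>

lemma harmonic_parts_unique:
  assumes "harmonic_parts f h g" "harmonic_parts f h1 g1" "z \<in> unit_disc"
  shows "h z = h1 z" "g z = g1 z"
proof -
  define u where "u z = h z - h1 z" for z
  define v where "v z = g1 z - g z" for z
  have hol: "u holomorphic_on unit_disc" "v holomorphic_on unit_disc"
    using assms unfolding u_def v_def harmonic_parts_def by (auto intro!: holomorphic_intros)
  have uv: "u z = cnj (v z)" if "z \<in> unit_disc" for z
    using assms(1,2) that by (simp add: u_def v_def harmonic_parts_def algebra_simps)
  have "u z + v z = u 0 + v 0"
    by (rule real_valued_holomorphic_constant[of "\<lambda>z. u z + v z", OF _ _ assms(3)])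
      (use hol uv in \<open>auto intro!: holomorphic_intros\<close>)
  moreover have "\<i> * (u z - v z) = \<i> * (u 0 - v 0)"
    by (rule real_valued_holomorphic_constant[of "\<lambda>z. \<i> * (u z - v z)", OF _ _ assms(3)])
      (use hol uv in \<open>auto intro!: holomorphic_intros\<close>)
  moreover have "u 0 = 0" "v 0 = 0" using assms by (simp_all add: u_def v_def harmonic_parts_def)
  ultimately have "u z + v z = 0" "u z - v z = 0" by auto
  then have "u z = 0" "v z = 0" by (auto simp: eq_neg_iff_add_eq_0)
  then show "h z = h1 z" "g z = g1 z" by (simp_all add: u_def v_def)
qed

context ma_minda_function
begin

lemma class_C_subordinate:
  assumes "h \<in> class_C \<phi>"
  obtains w where "w holomorphic_on unit_disc" "w 0 = 0" "w ` unit_disc \<subseteq> unit_disc"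
    "\<And>z. z \<in> unit_disc \<Longrightarrow> deriv h z = exp (G (w z))"
    and "convex (h ` unit_disc)"
proof -
  have h: "h holomorphic_on unit_disc" "inj_on h unit_disc" "h 0 = 0" "deriv h 0 = 1"
    using assms by (auto simp: class_C_def class_S_def)
  obtain \<omega> where \<omega>: "\<omega> holomorphic_on unit_disc" "\<omega> 0 = 0" "\<omega> ` unit_disc \<subseteq> unit_disc"
    "\<And>z. z \<in> unit_disc \<Longrightarrow> 1 + z * deriv (deriv h) z / deriv h z = \<phi> (\<omega> z)"
    using assms unfolding class_C_def subordinate_def by blast
  have nz: "deriv h z \<noteq> 0" if "z \<in> unit_disc" for z
    by (rule holomorphic_injective_imp_regular[OF h(1) open_ball h(2) that])
  obtain P where P: "\<And>z. z \<in> unit_disc \<Longrightarrow> (P has_field_derivative deriv (deriv h) z / deriv h z) (at z)"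
    "P 0 = 0" "\<And>z. z \<in> unit_disc \<Longrightarrow> deriv h z = exp (P z)"
    by (rule exp_log_deriv_primitive[OF holomorphic_deriv[OF h(1) open_ball] nz h(4)]) (assumption, rule that)
  have P': "z * (deriv (deriv h) z / deriv h z) = \<phi> (\<omega> z) - 1" if "z \<in> unit_disc" for z
    using \<omega>(4)[OF that] by (simp add: algebra_simps)
  have "0 < Re (1 + z * (deriv (deriv h) z / deriv h z))" if "z \<in> unit_disc" for z
    using P'[OF that] phi_Re[OF subsetD[OF \<omega>(3) imageI[OF that]]] by simp
  note sep = separation_of_convexity[OF P(1) this]
  have sep': "z2 = z1" if "z1 \<in> unit_disc" "norm z2 = norm z1" "m > 0" "z2 * deriv h z2 = of_real m * (z1 * deriv h z1)" for z1 z2 m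
    by (rule sep[OF _ _ that(1,2,3)]) (use that P(3) in auto)
  have conv: "convex (h ` unit_disc)"
    by (rule convex_image_of_separation[OF h(1) nz sep'])
  obtain w where w: "w holomorphic_on unit_disc" "w 0 = 0" "w ` unit_disc \<subseteq> unit_disc"
    "\<And>z. z \<in> unit_disc \<Longrightarrow> P z = G (w z)"
    by (rule log_subordinate[OF P(1,2) P' \<omega>(1-3)]) (assumption, assumption, rule that)
  show ?thesis by (rule that[OF w(1-3) _ conv]) (use P(3) w(4) in auto)
qed

text \<open>The bounds are \<open>K'(- |z|) \<le> |h'(z)| \<le> K'(|z|)\<close>.\<close>

lemma class_C_distortion:
  assumes h: "h \<in> class_C \<phi>" and z: "z \<in> unit_disc"
  shows "exp (Re (G (of_real (- norm z)))) \<le> norm (deriv h z)"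
    and "norm (deriv h z) \<le> exp (Re (G (of_real (norm z))))"
proof -
  obtain w where w: "w holomorphic_on unit_disc" "w 0 = 0" "w ` unit_disc \<subseteq> unit_disc"
    "\<And>z. z \<in> unit_disc \<Longrightarrow> deriv h z = exp (G (w z))"
    by (rule class_C_subordinate[OF h]) (rule that)
  have "norm (w z) \<le> norm z" by (rule Schwarz_le[OF w(1-3) z])
  from Re_G_bounds[OF this] z w(4)[OF z]
  show "exp (Re (G (of_real (- norm z)))) \<le> norm (deriv h z)"
    and "norm (deriv h z) \<le> exp (Re (G (of_real (norm z))))" by simp_all
qed

lemma class_C_majorant_le:
  assumes h: "h \<in> class_C \<phi>" and r: "0 \<le> r" "r \<le> 1 / 3"
  shows "majorant (deriv h) r \<le> majorant (deriv K) r"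
proof -
  obtain w where w: "w holomorphic_on unit_disc" "w 0 = 0" "w ` unit_disc \<subseteq> unit_disc"
    "\<And>z. z \<in> unit_disc \<Longrightarrow> deriv h z = exp (G (w z))"
    by (rule class_C_subordinate[OF h]) (rule that)
  have "deriv h z = deriv K (w z)" if "z \<in> unit_disc" for z
    using w(4)[OF that] deriv_K[of "w z"] subsetD[OF w(3) imageI[OF that]] by simp
  then show ?thesis
    by (rule majorant_subordinate[OF holomorphic_deriv[OF K_hol open_ball] w(1-3) _ r])
qed

end

section \<open>The equation for the radius\<close>

text \<open>The function \<open>t \<mapsto> K'(- t)\<close> on \<open>[0, 1)\<close>, called \<open>k0\<close> below. The value \<open>0\<close> at \<open>t \<ge> 1\<close>, where
  \<open>K_fun\<close> has no meaning, keeps it decreasing.\<close>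

definition slope_neg :: "(complex \<Rightarrow> complex) \<Rightarrow> real \<Rightarrow> real" where
  "slope_neg \<phi> t = (if t < 1 then Re (deriv (K_fun \<phi>) (- of_real t)) else 0)"

context ma_minda_function
begin

abbreviation "k0 \<equiv> slope_neg \<phi>"

lemma Re_deriv_K: "\<bar>t\<bar> < 1 \<Longrightarrow> Re (deriv K (of_real t)) = exp (Re (G (of_real t)))"
  and deriv_K_real: "\<bar>t\<bar> < 1 \<Longrightarrow> deriv K (of_real t) = of_real (Re (deriv K (of_real t)))"
proof -
  assume t: "\<bar>t\<bar> < 1"
  have "deriv K (of_real t) = exp (of_real (Re (G (of_real t))))"
    using deriv_K[of "of_real t"] G_real[OF t] t by simp
  then have eq: "deriv K (of_real t) = of_real (exp (Re (G (of_real t))))" by (simp only: exp_of_real)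
  show "Re (deriv K (of_real t)) = exp (Re (G (of_real t)))" unfolding eq by simp
  show "deriv K (of_real t) = of_real (Re (deriv K (of_real t)))" unfolding eq by simp
qed

lemma k0_eq: "0 \<le> t \<Longrightarrow> t < 1 \<Longrightarrow> k0 t = exp (Re (G (of_real (- t))))"
  using Re_deriv_K[of "- t"] by (simp add: slope_neg_def)

lemma k0_nonneg: "0 \<le> t \<Longrightarrow> 0 \<le> k0 t"
  using k0_eq[of t] by (cases "t < 1") (auto simp: slope_neg_def)

lemma k0_pos: "0 \<le> t \<Longrightarrow> t < 1 \<Longrightarrow> 0 < k0 t"
  by (simp add: k0_eq)

lemma k0_strict_antimono: "0 \<le> s \<Longrightarrow> s < t \<Longrightarrow> t < 1 \<Longrightarrow> k0 t < k0 s"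
  using Re_G_strict_mono[of "-t" "-s"] by (simp add: k0_eq)

lemma k0_antimono: "0 \<le> s \<Longrightarrow> s \<le> t \<Longrightarrow> k0 t \<le> k0 s"
  using k0_strict_antimono[of s t] k0_nonneg[of s] by (cases "s = t"; cases "t < 1") (auto simp: slope_neg_def)

lemma k0_0: "k0 0 = 1"
  using G_0[of 0] by (simp add: k0_eq)

lemma k0_le_1: "0 \<le> t \<Longrightarrow> k0 t \<le> 1"
  using k0_antimono[of 0 t] k0_0 by simp

lemma continuous_on_deriv_K_real:
  assumes "S \<subseteq> {-1<..<1}"
  shows "continuous_on S (\<lambda>t. Re (deriv K (of_real t)))"
  by (intro continuous_intros continuous_on_compose2[OF holomorphic_on_imp_continuous_on[OF holomorphic_deriv[OF K_hol open_ball]]])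
    (auto simp: abs_less_iff dest!: subsetD[OF assms])

lemma continuous_on_k0: assumes "s < 1" shows "continuous_on {0..s} k0"
proof (rule continuous_on_eq)
  have "continuous_on {-s..0} (\<lambda>t. Re (deriv K (of_real t)))"
    by (rule continuous_on_deriv_K_real) (use assms in auto)
  then show "continuous_on {0..s} (\<lambda>t. Re (deriv K (of_real (- t))))"
    by (rule continuous_on_compose2) (auto intro!: continuous_intros)
qed (use assms in \<open>auto simp: slope_neg_def\<close>)

text \<open>\<open>k0\<close> is monotone, so the second mean value theorem provides integrability up to the end point.\<close>

lemma continuous_mult_k0_integrable:
  fixes p :: "real \<Rightarrow> real"
  assumes "continuous_on {0..1} p" "0 \<le> r" "r \<le> 1"
  shows "(\<lambda>t. p t * k0 t) integrable_on {0..r}"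
proof -
  have "p integrable_on {0..r}"
    by (rule integrable_continuous_real, rule continuous_on_subset[OF assms(1)]) (use assms in auto)
  then obtain c where "((\<lambda>t. - k0 t * p t) has_integral (- k0 0 * integral {0..c} p + - k0 r * integral {c..r} p)) {0..r}"
    by (rule second_mean_value_theorem_full[of p 0 r "\<lambda>t. - k0 t"]) (use assms k0_antimono in auto)
  then have "(\<lambda>t. - (- k0 t * p t)) integrable_on {0..r}"
    by (intro integrable_neg) (auto simp: integrable_on_def)
  then show ?thesis by (simp add: mult.commute)
qed

lemma k0_integrable: "0 \<le> r \<Longrightarrow> r \<le> 1 \<Longrightarrow> k0 integrable_on {0..r}"
  using continuous_mult_k0_integrable[of "\<lambda>_. 1" r] by simp

lemma K_neg_eq:
  assumes "0 \<le> r" "r < 1"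
  shows "K (- of_real r) = - of_real (integral {0..r} k0)"
proof -
  have "((\<lambda>t. complex_of_real (k0 t)) has_integral - K (- of_real r) - - K (- of_real 0)) {0..r}"
  proof (rule fundamental_theorem_of_calculus[OF assms(1)])
    fix t assume t: "t \<in> {0..r}"
    have "(K has_field_derivative deriv K (of_real (- t))) (at (- of_real t))"
      using K_deriv[of "of_real (- t)"] deriv_K[of "of_real (- t)"] t assms by simp
    moreover have "((\<lambda>t. - complex_of_real t) has_vector_derivative - 1) (at t within {0..r})"
      by (auto simp: has_vector_derivative_def scaleR_conv_of_real intro!: derivative_eq_intros)
    ultimately have "((\<lambda>t. K (- of_real t)) has_vector_derivative - 1 * deriv K (of_real (- t))) (at t within {0..r})"
      using field_vector_diff_chain_within[of "\<lambda>t. - complex_of_real t" "-1" t "{0..r}" K "deriv K (of_real (- t))"]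
      by (simp add: o_def has_field_derivative_at_within)
    moreover have "deriv K (of_real (- t)) = of_real (k0 t)"
      using deriv_K_real[of "- t"] t assms by (simp add: slope_neg_def)
    ultimately show "((\<lambda>t. - K (- of_real t)) has_vector_derivative complex_of_real (k0 t)) (at t within {0..r})"
      using has_vector_derivative_minus by fastforce
  qed
  then have "((\<lambda>t. complex_of_real (k0 t)) has_integral - K (- of_real r)) {0..r}"
    using K_0[of 0] by simp
  moreover have "((\<lambda>t. complex_of_real (k0 t)) has_integral of_real (integral {0..r} k0)) {0..r}"
    using has_integral_linear[OF integrable_integral[OF k0_integrable[of r]] bounded_linear_of_real] assms
    by (simp add: o_def)
  ultimately have "- K (- of_real r) = of_real (integral {0..r} k0)" by (rule has_integral_unique)
  then show ?thesis by (metis minus_minus)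
qed

text \<open>Both \<open>- K(-1)\<close> and the integral that defines \<open>L_one\<close> are improper at \<open>1\<close>; by monotonicity of
  \<open>k0\<close> they are ordinary integrals over \<open>[0, 1]\<close>.\<close>

lemma L_one_eq:
  "L_one \<phi> \<zeta> n = integral {0..1} (\<lambda>t. (1 - norm \<zeta> * t ^ n) * k0 t)"
proof -
  have "continuous_on {0..1} (\<lambda>r. integral {0..r} k0)"
    by (rule indefinite_integral_continuous_1[OF k0_integrable]) auto
  then have lim: "((\<lambda>r. integral {0..r} k0) \<longlongrightarrow> integral {0..1} k0) (at_left 1)"
    by (rule continuous_on_Icc_at_leftD) simp
  have "((\<lambda>r. - complex_of_real (integral {0..r} k0)) \<longlongrightarrow> - of_real (integral {0..1} k0)) (at_left 1)"
    by (intro tendsto_intros lim)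
  moreover have "eventually (\<lambda>r::real. r \<in> {0<..<1}) (at_left 1)"
    by (rule eventually_at_left_real) simp
  then have "eventually (\<lambda>r. - complex_of_real (integral {0..r} k0) = K (- of_real r)) (at_left 1)"
    by eventually_elim (simp add: K_neg_eq)
  ultimately have "((\<lambda>r. K (- of_real r)) \<longlongrightarrow> - of_real (integral {0..1} k0)) (at_left 1)"
    using tendsto_cong by fast
  then have Lim: "Lim (at_left 1) (\<lambda>r. K (- of_real r)) = - of_real (integral {0..1} k0)"
    by (intro tendsto_Lim) auto
  have spike: "integral {0..1} (\<lambda>t. t ^ n * Re (deriv K (- of_real t))) = integral {0..1} (\<lambda>t. t ^ n * k0 t)"
    by (rule integral_spike[of "{1}"]) (auto simp: slope_neg_def)
  have int: "(\<lambda>t. t ^ n * k0 t) integrable_on {0..1}"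
    by (rule continuous_mult_k0_integrable) (auto intro!: continuous_intros)
  have "integral {0..1} (\<lambda>t. (1 - norm \<zeta> * t ^ n) * k0 t) = integral {0..1} (\<lambda>t. k0 t - norm \<zeta> * (t ^ n * k0 t))"
    by (simp add: algebra_simps)
  also have "\<dots> = integral {0..1} k0 - integral {0..1} (\<lambda>t. norm \<zeta> * (t ^ n * k0 t))"
    by (rule integral_diff) (use integrable_cmul[OF int, of "norm \<zeta>"] in \<open>auto intro!: k0_integrable\<close>)
  also have "\<dots> = integral {0..1} k0 - norm \<zeta> * integral {0..1} (\<lambda>t. t ^ n * k0 t)" by simp
  finally show ?thesis unfolding L_one_def Lim spike by simp
qed

lemma lower_density_integrable:
  fixes \<zeta> :: complex
  shows "0 \<le> r \<Longrightarrow> r \<le> 1 \<Longrightarrow> (\<lambda>t. (1 - norm \<zeta> * t ^ n) * k0 t) integrable_on {0..r}"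
  by (rule continuous_mult_k0_integrable) (auto intro!: continuous_intros)

lemma lower_density_nonneg:
  fixes \<zeta> :: complex
  assumes "norm \<zeta> \<le> 1" "t \<in> {0..1}"
  shows "0 \<le> (1 - norm \<zeta> * t ^ n) * k0 t"
  using assms k0_nonneg[of t] mult_le_one[of "norm \<zeta>" "t ^ n"] by (simp add: power_le_one)

lemma L_one_pos:
  assumes "norm \<zeta> \<le> 1" "n \<ge> 1"
  shows "0 < L_one \<phi> \<zeta> n"
proof -
  have "(1/2 * k0 (1/2)) * (1/2 - 0) = integral {0..1/2::real} (\<lambda>t. 1/2 * k0 (1/2))" by simp
  also have "\<dots> \<le> integral {0..1/2} (\<lambda>t. (1 - norm \<zeta> * t ^ n) * k0 t)"
  proof (rule integral_le)
    fix t :: real assume t: "t \<in> {0..1/2}"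
    have "t ^ n \<le> t ^ 1" by (rule power_decreasing) (use t assms in auto)
    then have "norm \<zeta> * t ^ n \<le> 1 * (1/2)" by (intro mult_mono) (use t assms in auto)
    then show "1/2 * k0 (1/2) \<le> (1 - norm \<zeta> * t ^ n) * k0 t"
      using t by (intro mult_mono k0_antimono k0_nonneg) auto
  qed (auto intro: lower_density_integrable)
  also have "\<dots> \<le> integral {0..1} (\<lambda>t. (1 - norm \<zeta> * t ^ n) * k0 t)"
    by (rule integral_subset_le) (use lower_density_integrable lower_density_nonneg assms in auto)
  also have "\<dots> = L_one \<phi> \<zeta> n" by (simp add: L_one_eq)
  finally have "(1/2 * k0 (1/2)) * (1/2 - 0) \<le> L_one \<phi> \<zeta> n" .
  moreover have "0 < (1/2 * k0 (1/2)) * (1/2 - 0)" using k0_pos[of "1/2"] by simp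
  ultimately show ?thesis by (rule order.strict_trans2[rotated])
qed

text \<open>The integrand is at most \<open>1\<close>, and at most \<open>k0 (1/2) < 1\<close> on the right half of the interval.\<close>

lemma L_one_less_1:
  assumes "norm \<zeta> \<le> 1"
  shows "L_one \<phi> \<zeta> n < 1"
proof -
  have int: "(\<lambda>t. (1 - norm \<zeta> * t ^ n) * k0 t) integrable_on {0..1}"
    by (rule lower_density_integrable) auto
  have le: "(1 - norm \<zeta> * t ^ n) * k0 t \<le> k0 t" if "0 \<le> t" for t
    using k0_nonneg[OF that] that by (simp add: left_diff_distrib)
  have "L_one \<phi> \<zeta> n = integral {0..1/2} (\<lambda>t. (1 - norm \<zeta> * t ^ n) * k0 t) + integral {1/2..1} (\<lambda>t. (1 - norm \<zeta> * t ^ n) * k0 t)"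
    unfolding L_one_eq by (rule Henstock_Kurzweil_Integration.integral_combine[OF _ _ int, symmetric]) auto
  also have "\<dots> \<le> integral {0..1/2::real} (\<lambda>t. 1) + integral {1/2..1} (\<lambda>t::real. k0 (1/2))"
  proof (intro add_mono integral_le)
    show "(\<lambda>t. (1 - norm \<zeta> * t ^ n) * k0 t) integrable_on {1/2..1}"
      by (rule integrable_on_subinterval[OF int]) auto
    show "(\<lambda>t. (1 - norm \<zeta> * t ^ n) * k0 t) integrable_on {0..1/2}"
      by (rule integrable_on_subinterval[OF int]) auto
    show "(1 - norm \<zeta> * t ^ n) * k0 t \<le> 1" if "t \<in> {0..1/2}" for t
      using le[of t] k0_le_1[of t] that by auto
    show "(1 - norm \<zeta> * t ^ n) * k0 t \<le> k0 (1/2)" if "t \<in> {1/2..1}" for t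
      using le[of t] k0_antimono[of "1/2" t] that by auto
  qed auto
  also have "\<dots> = 1/2 + k0 (1/2) / 2" by simp
  also have "\<dots> < 1" using k0_strict_antimono[of 0 "1/2"] k0_0 by simp
  finally show ?thesis .
qed

lemma root_rhs_continuous: assumes "s < 1" shows "continuous_on {0..s} (root_rhs \<phi> \<zeta> n)"
proof -
  have sub: "{0..s} \<subseteq> {-1<..<1}" using assms by auto
  have "continuous_on {0..s} (\<lambda>t. t ^ n * majorant (deriv K) t)"
    by (intro continuous_intros majorant_continuous_on holomorphic_deriv[OF K_hol] sub) auto
  then have 1: "continuous_on {0..s} (\<lambda>r. integral {0..r} (\<lambda>t. t ^ n * majorant (deriv K) t))"
    by (intro indefinite_integral_continuous_1 integrable_continuous_real)
  have "continuous_on {0..s} (\<lambda>t. t * (1 - (norm \<zeta>)\<^sup>2 * t ^ (2 * n)) * (Re (deriv K (of_real t)))\<^sup>2)"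
    by (intro continuous_intros continuous_on_deriv_K_real sub)
  then have 2: "continuous_on {0..s} (\<lambda>r. integral {0..r} (\<lambda>t. t * (1 - (norm \<zeta>)\<^sup>2 * t ^ (2 * n)) * (Re (deriv K (of_real t)))\<^sup>2))"
    by (intro indefinite_integral_continuous_1 integrable_continuous_real)
  show ?thesis
    unfolding root_rhs_def[abs_def]
    by (intro continuous_intros majorant_continuous_on K_hol sub 1 2)
qed

lemma root_rhs_0: "root_rhs \<phi> \<zeta> n 0 = 0"
  using K_0[of 0] by (simp add: root_rhs_def)

lemma root_rhs_ge: assumes "norm \<zeta> \<le> 1" "0 \<le> r" "r < 1" shows "r \<le> root_rhs \<phi> \<zeta> n r"
proof -
  have sub: "{0..r} \<subseteq> {-1<..<1}" using assms by auto
  have "norm (deriv K 0) * r \<le> majorant K r" by (rule majorant_ge_linear[OF K_hol assms(2,3)])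
  then have "r \<le> majorant K r" using deriv_K[of 0] G_0[of 0] by simp
  moreover have "0 \<le> norm \<zeta> * integral {0..r} (\<lambda>t. t ^ n * majorant (deriv K) t)"
  proof (rule mult_nonneg_nonneg[OF norm_ge_zero integral_nonneg])
    show "(\<lambda>t. t ^ n * majorant (deriv K) t) integrable_on {0..r}"
      by (intro integrable_continuous_real continuous_intros majorant_continuous_on holomorphic_deriv[OF K_hol] sub) auto
    show "0 \<le> t ^ n * majorant (deriv K) t" if "t \<in> {0..r}" for t
      by (intro mult_nonneg_nonneg majorant_nonneg holomorphic_deriv[OF K_hol]) (use that assms in auto)
  qed
  moreover have "0 \<le> integral {0..r} (\<lambda>t. t * (1 - (norm \<zeta>)\<^sup>2 * t ^ (2 * n)) * (Re (deriv K (of_real t)))\<^sup>2)"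
  proof (rule integral_nonneg)
    show "(\<lambda>t. t * (1 - (norm \<zeta>)\<^sup>2 * t ^ (2 * n)) * (Re (deriv K (of_real t)))\<^sup>2) integrable_on {0..r}"
      by (intro integrable_continuous_real continuous_intros continuous_on_deriv_K_real sub)
    show "0 \<le> t * (1 - (norm \<zeta>)\<^sup>2 * t ^ (2 * n)) * (Re (deriv K (of_real t)))\<^sup>2" if "t \<in> {0..r}" for t
      using that assms mult_le_one[of "(norm \<zeta>)\<^sup>2" "t ^ (2 * n)"] by (simp add: power_le_one)
  qed
  ultimately show ?thesis unfolding root_rhs_def by linarith
qed

text \<open>The equation has a root in \<open>[0, L_one \<phi> \<zeta> n]\<close>, because \<open>r \<le> root_rhs \<phi> \<zeta> n r\<close>
  for all \<open>r\<close> in \<open>[0, 1)\<close> and \<open>L_one \<phi> \<zeta> n < 1\<close>.\<close>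

lemma smallest_root_exists:
  assumes \<zeta>: "norm \<zeta> \<le> 1" and n: "n \<ge> 1"
  obtains \<rho> where "smallest_root \<phi> \<zeta> n \<rho>" "\<And>r. 0 \<le> r \<Longrightarrow> r \<le> \<rho> \<Longrightarrow> root_rhs \<phi> \<zeta> n r \<le> L_one \<phi> \<zeta> n"
proof -
  let ?L = "L_one \<phi> \<zeta> n" and ?R = "root_rhs \<phi> \<zeta> n"
  have L: "0 < ?L" "?L < 1" using L_one_pos L_one_less_1 assms by auto
  have R1: "?L \<le> ?R ?L" by (rule root_rhs_ge) (use \<zeta> L in auto)
  define Z where "Z = {0..?L} \<inter> ?R -` {?L}"
  have "\<exists>x\<ge>0. x \<le> ?L \<and> ?R x = ?L"
    by (rule IVT'[of ?R 0 ?L ?L]) (use root_rhs_0 L R1 root_rhs_continuous in auto)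
  then have "Z \<noteq> {}" by (auto simp: Z_def)
  moreover have "compact Z"
  proof -
    have "closed Z" unfolding Z_def
      by (rule continuous_closed_preimage[OF root_rhs_continuous]) (use L in auto)
    then show ?thesis unfolding Z_def using compact_Int_closed[OF compact_Icc] by (metis inf.left_idem compact_Icc)
  qed
  ultimately obtain \<rho> where \<rho>: "\<rho> \<in> Z" "\<And>x. x \<in> Z \<Longrightarrow> \<rho> \<le> x" by (meson compact_attains_inf)
  have \<rho>': "0 \<le> \<rho>" "\<rho> \<le> ?L" "?R \<rho> = ?L" using \<rho>(1) by (auto simp: Z_def)
  have "\<rho> \<noteq> 0" using \<rho>'(3) root_rhs_0 L by auto
  then have \<rho>0: "0 < \<rho>" using \<rho>'(1) by simp
  have no: "?R s \<noteq> ?L" if "0 < s" "s < \<rho>" for s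
    using \<rho>(2)[of s] that \<rho>' by (auto simp: Z_def)
  show ?thesis
  proof (rule that)
    show "smallest_root \<phi> \<zeta> n \<rho>"
      unfolding smallest_root_def using \<rho>0 \<rho>' L no by fastforce
    show "?R r \<le> ?L" if r: "0 \<le> r" "r \<le> \<rho>" for r
    proof (rule ccontr)
      assume gt: "\<not> ?thesis"
      have "\<exists>x\<ge>0. x \<le> r \<and> ?R x = ?L"
        by (rule IVT') (use root_rhs_0 L gt r root_rhs_continuous[of r] \<rho>' in auto)
      then obtain x where x: "0 \<le> x" "x \<le> r" "?R x = ?L" by blast
      then have "x \<noteq> 0" "x \<noteq> r" using root_rhs_0 L gt by auto
      then show False using no[of x] x r by auto
    qed
  qed
qed

lemma majorant_and_area_le_root_rhs:
  assumes h: "h \<in> class_C \<phi>" and g: "g holomorphic_on unit_disc" "g 0 = 0"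
    and dil: "\<And>z. z \<in> unit_disc \<Longrightarrow> deriv g z = \<zeta> * z ^ n * deriv h z"
    and \<zeta>: "norm \<zeta> \<le> 1" and n: "n \<ge> 1" and r: "0 \<le> r" "r \<le> 1 / 3"
  shows "harmonic_majorant h g r + measure lebesgue ((\<lambda>z. h z + cnj (g z)) ` ball 0 r) / (2 * pi)
    \<le> root_rhs \<phi> \<zeta> n r"
proof -
  have hh: "h holomorphic_on unit_disc" "h 0 = 0" "deriv h 0 = 1"
    using h by (auto simp: class_C_def class_S_def)
  have g0: "deriv g 0 = 0" using dil[of 0] n by simp
  have sub: "{0..r} \<subseteq> {-1<..<1}" using r by auto
  have "harmonic_majorant h g r = majorant h r + majorant g r"
    by (rule harmonic_majorant_eq[OF hh g g0]) (use r in auto)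
  moreover have "majorant h r \<le> majorant K r"
    by (rule has_integral_le[OF majorant_has_integral[OF hh(1,2)] majorant_has_integral[OF K_hol K_0[of 0]]])
      (use r class_C_majorant_le[OF h] in auto)
  moreover have "majorant g r \<le> norm \<zeta> * integral {0..r} (\<lambda>t. t ^ n * majorant (deriv K) t)"
  proof (rule has_integral_le[OF majorant_has_integral[OF g]])
    have "(\<lambda>t. t ^ n * majorant (deriv K) t) integrable_on {0..r}"
      by (intro integrable_continuous_real continuous_intros majorant_continuous_on holomorphic_deriv[OF K_hol] sub) auto
    from has_integral_mult_right[OF integrable_integral[OF this]]
    show "((\<lambda>t. norm \<zeta> * (t ^ n * majorant (deriv K) t)) has_integral norm \<zeta> * integral {0..r} (\<lambda>t. t ^ n * majorant (deriv K) t)) {0..r}" .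
    fix t assume t: "t \<in> {0..r}"
    have "majorant (deriv g) t = norm \<zeta> * t ^ n * majorant (deriv h) t"
      by (rule majorant_monomial_mult[OF holomorphic_deriv[OF hh(1) open_ball] dil]) (use t r in auto)
    also have "\<dots> \<le> norm \<zeta> * t ^ n * majorant (deriv K) t"
      by (intro mult_left_mono class_C_majorant_le[OF h]) (use t r in auto)
    finally show "majorant (deriv g) t \<le> norm \<zeta> * (t ^ n * majorant (deriv K) t)" by (simp add: mult.assoc)
  qed (use r in auto)
  moreover have "measure lebesgue ((\<lambda>z. h z + cnj (g z)) ` ball 0 r)
      \<le> 2 * pi * integral {0..r} (\<lambda>t. t * (1 - (norm \<zeta>)\<^sup>2 * t ^ (2 * n)) * (Re (deriv K (of_real t)))\<^sup>2)"
  proof (rule harmonic_area_le[OF hh(1) g(1) r(1)])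
    show "continuous_on {0..r} (\<lambda>t. t * (1 - (norm \<zeta>)\<^sup>2 * t ^ (2 * n)) * (Re (deriv K (of_real t)))\<^sup>2)"
      by (intro continuous_intros continuous_on_deriv_K_real sub)
    fix z :: complex assume z: "norm z \<le> r"
    have zD: "z \<in> unit_disc" using z r by simp
    define c where "c = 1 - (norm \<zeta>)\<^sup>2 * norm z ^ (2 * n)"
    have c: "0 \<le> c"
      using zD \<zeta> mult_le_one[of "(norm \<zeta>)\<^sup>2" "norm z ^ (2 * n)"] by (simp add: c_def power_le_one)
    have "(norm (deriv h z))\<^sup>2 - (norm (deriv g z))\<^sup>2 = c * (norm (deriv h z))\<^sup>2"
      by (simp add: c_def dil[OF zD] norm_mult norm_power power_mult_distrib left_diff_distrib flip: power_mult)
        (simp add: mult.commute)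
    moreover have "norm (deriv h z) \<le> Re (deriv K (of_real (norm z)))"
      using class_C_distortion(2)[OF h zD] Re_deriv_K[of "norm z"] zD by simp
    then have "c * (norm (deriv h z))\<^sup>2 \<le> c * (Re (deriv K (of_real (norm z))))\<^sup>2"
      by (intro mult_left_mono power_mono c) auto
    ultimately have "\<bar>(norm (deriv h z))\<^sup>2 - (norm (deriv g z))\<^sup>2\<bar> \<le> c * (Re (deriv K (of_real (norm z))))\<^sup>2"
      using c by (simp add: abs_mult)
    from mult_left_mono[OF this, of "norm z"]
    show "norm z * \<bar>(norm (deriv h z))\<^sup>2 - (norm (deriv g z))\<^sup>2\<bar>
        \<le> norm z * (1 - (norm \<zeta>)\<^sup>2 * norm z ^ (2 * n)) * (Re (deriv K (of_real (norm z))))\<^sup>2"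
      by (simp add: c_def mult.assoc)
  qed (use r in auto)
  then have "measure lebesgue ((\<lambda>z. h z + cnj (g z)) ` ball 0 r) / (2 * pi)
      \<le> integral {0..r} (\<lambda>t. t * (1 - (norm \<zeta>)\<^sup>2 * t ^ (2 * n)) * (Re (deriv K (of_real t)))\<^sup>2)"
    by (simp add: divide_le_eq mult_ac)
  ultimately show ?thesis unfolding root_rhs_def by linarith
qed

lemma L_one_le_infdist:
  assumes h: "h \<in> class_C \<phi>" and g: "g holomorphic_on unit_disc" "g 0 = 0"
    and lt: "\<And>z. z \<in> unit_disc \<Longrightarrow> norm (deriv g z) < norm (deriv h z)"
    and dil: "\<And>z. z \<in> unit_disc \<Longrightarrow> deriv g z = \<zeta> * z ^ n * deriv h z"
    and \<zeta>: "norm \<zeta> \<le> 1" and n: "n \<ge> 1"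
  shows "L_one \<phi> \<zeta> n \<le> infdist 0 (frontier ((\<lambda>z. h z + cnj (g z)) ` unit_disc))"
proof -
  let ?f = "\<lambda>z. h z + cnj (g z)" and ?\<kappa> = "\<lambda>t. (1 - norm \<zeta> * t ^ n) * k0 t"
  have hh: "h holomorphic_on unit_disc" "h 0 = 0" "deriv h 0 = 1" "inj_on h unit_disc"
    using h by (auto simp: class_C_def class_S_def)
  obtain w where conv: "convex (h ` unit_disc)" by (rule class_C_subordinate[OF h])
  have inj: "inj_on ?f unit_disc" by (rule harmonic_inj_on[OF hh(1,4) conv g(1) lt])
  have cont: "continuous_on unit_disc ?f"
    by (intro continuous_intros holomorphic_on_imp_continuous_on hh g)
  have op: "open (?f ` unit_disc)" by (rule invariance_of_domain[OF cont open_ball inj])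
  have ne: "frontier (?f ` unit_disc) \<noteq> {}"
    using harmonic_image_neq_UNIV[OF hh(1,4) conv g(1) lt] by (simp add: frontier_eq_empty)
  have le: "integral {0..s} ?\<kappa> \<le> norm v" if s: "0 < s" "s < 1" and v: "v \<in> frontier (?f ` unit_disc)" for s v
  proof (rule ccontr)
    assume "\<not> ?thesis"
    then have less: "norm v < integral {0..s} ?\<kappa>" by simp
    have "v \<in> ?f ` unit_disc"
    proof (rule harmonic_covers_ball[OF hh(1) g(1) _ _ _ _ _ s(2) less])
      show "h 0 + cnj (g 0) = 0" using hh g by simp
      show "continuous_on {0..s} ?\<kappa>" by (intro continuous_intros continuous_on_k0 s)
      have p1: "norm \<zeta> * t ^ n < 1" if "t \<in> {0..s}" for t
      proof -
        have "t ^ n \<le> t ^ 1" by (rule power_decreasing) (use that s n in auto)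
        then have "t ^ n < 1" using that s by simp
        then show ?thesis using \<zeta> that mult_left_le_one_le[of "t ^ n" "norm \<zeta>"] by simp
      qed
      show "0 < ?\<kappa> t" if "t \<in> {0..s}" for t
        using p1[OF that] k0_pos[of t] that s by simp
      fix z :: complex assume z: "z \<in> unit_disc" "norm z \<le> s"
      have "k0 (norm z) \<le> norm (deriv h z)"
        using class_C_distortion(1)[OF h z(1)] k0_eq[of "norm z"] z by simp
      then have "?\<kappa> (norm z) \<le> (1 - norm \<zeta> * norm z ^ n) * norm (deriv h z)"
        by (rule mult_left_mono) (use p1[of "norm z"] z in auto)
      then show "?\<kappa> (norm z) \<le> norm (deriv h z) - norm (deriv g z)"
        by (simp add: dil[OF z(1)] norm_mult norm_power left_diff_distrib)
    qed (use s in auto)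
    then show False using v op by (simp add: frontier_def interior_open)
  qed
  have "L_one \<phi> \<zeta> n \<le> norm v" if v: "v \<in> frontier (?f ` unit_disc)" for v
  proof (rule tendsto_upperbound)
    have "continuous_on {0..1} (\<lambda>s. integral {0..s} ?\<kappa>)"
      by (rule indefinite_integral_continuous_1[OF lower_density_integrable]) auto
    then show "((\<lambda>s. integral {0..s} ?\<kappa>) \<longlongrightarrow> L_one \<phi> \<zeta> n) (at_left 1)"
      unfolding L_one_eq by (rule continuous_on_Icc_at_leftD) simp
    have "eventually (\<lambda>s::real. s \<in> {0<..<1}) (at_left 1)"
      by (rule eventually_at_left_real) simp
    then show "eventually (\<lambda>s. integral {0..s} ?\<kappa> \<le> norm v) (at_left 1)"
      by eventually_elim (use le v in auto)
  qed auto
  then show ?thesis using ne by (auto simp: infdist_notempty intro!: cINF_greatest)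
qed

end

theorem theorem4p2:
  fixes \<phi> f h g :: "complex \<Rightarrow> complex" and \<zeta> :: complex and n :: nat
  assumes "ma_minda \<phi>"
    and "n \<ge> 1"
    and "f \<in> class_HC n \<phi>"
    and "harmonic_parts f h g"
    and "\<And>z. z \<in> unit_disc \<Longrightarrow> deriv g z = \<zeta> * z ^ n * deriv h z"
    and "norm \<zeta> \<le> 1 / (2 * real n - 1)"
  shows "\<exists>\<rho>. smallest_root \<phi> \<zeta> n \<rho> \<and>
    (\<forall>r. 0 \<le> r \<and> r \<le> min (1 / 3) \<rho> \<longrightarrow>
       harmonic_majorant h g r + measure lebesgue (f ` ball 0 r) / (2 * pi)
         \<le> infdist (f 0) (frontier (f ` unit_disc)))"
proof -
  interpret ma_minda_function \<phi> by standard (rule assms(1))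
  have "1 / (2 * real n - 1) \<le> 1" using assms(2) by simp
  then have \<zeta>: "norm \<zeta> \<le> 1" using assms(6) by linarith
  have g: "g holomorphic_on unit_disc" "g 0 = 0" and h0: "h holomorphic_on unit_disc" "h 0 = 0"
    and f: "\<And>z. z \<in> unit_disc \<Longrightarrow> f z = h z + cnj (g z)"
    using assms(4) by (auto simp: harmonic_parts_def)
  obtain h1 g1 where 1: "harmonic_parts f h1 g1"
    "\<And>z. z \<in> unit_disc \<Longrightarrow> norm (deriv g1 z) < norm (deriv h1 z)" "h1 \<in> class_C \<phi>"
    using assms(3) unfolding class_HC_def by blast
  note eq = harmonic_parts_unique[OF assms(4) 1(1)]
  \<comment> \<open>The parts \<open>h1\<close>, \<open>g1\<close> from membership of \<open>f\<close> in the class agree with \<open>h\<close>, \<open>g\<close> on the disc only,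
    so their properties have to be transferred.\<close>
  have deriv_eq: "(deriv ^^ k) h z = (deriv ^^ k) h1 z" "(deriv ^^ k) g z = (deriv ^^ k) g1 z"
    if "z \<in> unit_disc" for z k
    using eq that by (auto intro!: higher_deriv_cong_ev eventually_nhds_in_open[THEN eventually_mono, of unit_disc])
  have lt: "norm (deriv g z) < norm (deriv h z)" if "z \<in> unit_disc" for z
    using 1(2)[OF that] deriv_eq[OF that, of 1] by simp
  have hC: "h \<in> class_C \<phi>"
  proof -
    have "h \<in> class_S"
      using 1(3) h0 deriv_eq(1)[of 0 1] eq(1) inj_on_cong[of unit_disc h h1] by (auto simp: class_C_def class_S_def)
    moreover have "1 + z * deriv (deriv h) z / deriv h z = 1 + z * deriv (deriv h1) z / deriv h1 z"
      if "z \<in> unit_disc" for z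
      using deriv_eq(1)[OF that, of 1] deriv_eq(1)[OF that, of 2] by (simp add: numeral_2_eq_2)
    then have "subordinate (\<lambda>z. 1 + z * deriv (deriv h) z / deriv h z) \<phi>"
      using 1(3) unfolding class_C_def subordinate_def by auto
    ultimately show ?thesis by (simp add: class_C_def)
  qed
  have f0: "f 0 = 0" using f[of 0] g h0 by simp
  have im: "f ` S = (\<lambda>z. h z + cnj (g z)) ` S" if "S \<subseteq> unit_disc" for S
    using f that by (intro image_cong) auto
  obtain \<rho> where \<rho>: "smallest_root \<phi> \<zeta> n \<rho>" "\<And>r. 0 \<le> r \<Longrightarrow> r \<le> \<rho> \<Longrightarrow> root_rhs \<phi> \<zeta> n r \<le> L_one \<phi> \<zeta> n"
    by (rule smallest_root_exists[OF \<zeta> assms(2)]) (rule that)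
  have "harmonic_majorant h g r + measure lebesgue (f ` ball 0 r) / (2 * pi) \<le> infdist (f 0) (frontier (f ` unit_disc))"
    if r: "0 \<le> r" "r \<le> min (1 / 3) \<rho>" for r
  proof -
    have "harmonic_majorant h g r + measure lebesgue (f ` ball 0 r) / (2 * pi) \<le> root_rhs \<phi> \<zeta> n r"
      using majorant_and_area_le_root_rhs[OF hC g assms(5) \<zeta> assms(2), of r] im[of "ball 0 r"] r
      by (simp add: subset_ball)
    also have "\<dots> \<le> L_one \<phi> \<zeta> n" by (rule \<rho>(2)) (use r in auto)
    also have "\<dots> \<le> infdist (f 0) (frontier (f ` unit_disc))"
      using L_one_le_infdist[OF hC g lt assms(5) \<zeta> assms(2)] im[of unit_disc] f0 by simp
    finally show ?thesis .
  qed
  then show ?thesis using \<rho>(1) by blast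
qed

end
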